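(* Let $A_q^L(\mathcal A)$ (resp. $A_q^R(\mathcal A)$) be the subalgebra of $A_q(X)$ generated by the elements $z^L_{i,j}$ (resp. $z^R_{i,j}$), $1\le i,j\le 2n$. The algebras $A_q^L(\mathcal A)$ and $A_q^R(\mathcal A)$ are isomorphic to the algebra $A_q(\mathcal A)$ generated by $z_{i,j}$ ($1\le i,j\le 2n$) with the following relations: \begin{align*} z_{i,j}&=-q^{-1}z_{j,i},\\ z_{i,l}z_{j,k}&=z_{j,k}z_{i,l},\\ z_{i,j}z_{i,k}&=q\,z_{i,k}z_{i,j},\\ z_{i,k}z_{j,l}-z_{j,l}z_{i,k}&=(q-q^{-1})z_{i,l}z_{j,k},\\ z_{i,j}z_{k,l}-z_{k,l}z_{i,j}&=(q-q^{-1})z_{i,k}z_{j,l}-q(q-q^{-1})z_{i,l}z_{j,k}, \end{align*} where $i<j<k<l$.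
   Context: $n\ge1$ is an integer and $q$ is a nonzero complex number which is either $1$ or not a root of unity, with a fixed square root $q^{1/2}$. $A_q(X)$ is the noncommutative $\mathbb C$-algebra generated by $x_{ij}$, $1\le i,j\le 2n$, with relations, for $i<j$ and $k<l$: $x_{ik}x_{jk}=q\,x_{jk}x_{ik}$, $x_{ki}x_{kj}=q\,x_{kj}x_{ki}$, $x_{il}x_{jk}=x_{jk}x_{il}$, $x_{ik}x_{jl}-x_{jl}x_{ik}=(q-q^{-1})x_{il}x_{jk}$. For $1\le i,j\le 2n$ put $$z^L_{i,j}=\sum_{k=1}^{n}q^{(i+j+1-4k)/2}\left(x_{i,2k-1}x_{j,2k}-q\,x_{i,2k}x_{j,2k-1}\right),$$ $$z^R_{i,j}=\sum_{k=1}^{n}q^{-(i+j+1-4k)/2}\left(x_{2k-1,i}x_{2k,j}-q\,x_{2k,i}x_{2k-1,j}\right).$$ These definitions imply $z^L_{i,i}=z^R_{i,i}=0$.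
   Formalization: The displayed relations are completed, as the literal list gives too large an algebra: z_{i,i}=0 is added, and z_{i,j}z_{i,k}=q z_{i,k}z_{i,j} is imposed for j<k and every i different from j and k, not only for i<j<k. *)

theory Defs
  imports
    Complex_Main
    "HOL-Library.Poly_Mapping"
    "HOL-Algebra.QuotRing"
    "HOL-Algebra.Module"
    "HOL-Algebra.Generated_Rings"
begin

text \<open>
  A complex algebra (associative, unital, not necessarily commutative) is a record of type
  \<^typ>\<open>(complex, 'a) module\<close>: the \<^typ>\<open>'a ring\<close> part carries the ring structure and
  \<^const>\<open>smult\<close> the scalar multiplication.
\<close>

section \<open>Algebras given by generators and relations\<close>

text \<open>Lists are made the free monoid, so that finitely supported functions on words, with the
  convolution product of \<^theory>\<open>HOL-Library.Poly_Mapping\<close>, are noncommutative polynomials.\<close>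

instantiation list :: (type) monoid_add
begin

definition zero_list :: "'a list" where "zero_list = []"
definition plus_list :: "'a list \<Rightarrow> 'a list \<Rightarrow> 'a list" where "plus_list xs ys = xs @ ys"

instance by standard (simp_all add: zero_list_def plus_list_def)

end

type_synonym 'a ncpoly = "'a list \<Rightarrow>\<^sub>0 complex"

definition gen :: "'a \<Rightarrow> 'a ncpoly" where
  "gen x = Poly_Mapping.single [x] 1"

definition scal :: "complex \<Rightarrow> 'a ncpoly \<Rightarrow> 'a ncpoly"  (infixr \<open>\<cdot>\<close> 75) where
  "c \<cdot> p = Poly_Mapping.single [] c * p"

definition free_algebra :: "'a set \<Rightarrow> (complex, 'a ncpoly) module" where
  "free_algebra X =
     \<lparr>carrier = {p. \<forall>w \<in> Poly_Mapping.keys p. set w \<subseteq> X},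
      mult = (*), one = 1, zero = 0, add = (+), smult = scal\<rparr>"

text \<open>\<^const>\<open>FactRing\<close> only keeps the ring structure; scalar multiplication is added in the way
  \<^const>\<open>rcoset_mult\<close> defines the product of cosets.\<close>

definition quot_algebra :: "(complex, 'b) module \<Rightarrow> 'b set \<Rightarrow> (complex, 'b set) module" where
  "quot_algebra A I =
     ring.extend (A Quot I)
       (module.fields (\<lambda>c S. \<Union>p\<in>S. I +>\<^bsub>A\<^esub> (c \<odot>\<^bsub>A\<^esub> p)))"

text \<open>A set \<open>R\<close> of noncommutative polynomials stands for the relations \<open>r = 0\<close>, \<open>r \<in> R\<close>.\<close>

definition presented_algebra :: "'a set \<Rightarrow> 'a ncpoly set \<Rightarrow> (complex, 'a ncpoly set) module" where
  "presented_algebra X R = quot_algebra (free_algebra X) (Idl\<^bsub>free_algebra X\<^esub> R)"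

definition presented_class :: "'a set \<Rightarrow> 'a ncpoly set \<Rightarrow> 'a ncpoly \<Rightarrow> 'a ncpoly set" where
  "presented_class X R p = (Idl\<^bsub>free_algebra X\<^esub> R) +>\<^bsub>free_algebra X\<^esub> p"

section \<open>Generated subalgebras and isomorphisms\<close>

definition generated_subalgebra ::
    "(complex, 'b) module \<Rightarrow> 'b set \<Rightarrow> (complex, 'b) module" where
  "generated_subalgebra A S =
     A\<lparr>carrier := generate_ring A (range (\<lambda>c. c \<odot>\<^bsub>A\<^esub> \<one>\<^bsub>A\<^esub>) \<union> S)\<rparr>"

definition algebra_isomorphic ::
    "(complex, 'b) module \<Rightarrow> (complex, 'c) module \<Rightarrow> bool" where
  "algebra_isomorphic A B \<longleftrightarrow>
     (\<exists>h \<in> ring_iso A B. \<forall>c. \<forall>x \<in> carrier A. h (c \<odot>\<^bsub>A\<^esub> x) = c \<odot>\<^bsub>B\<^esub> h x)"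

section \<open>The quantum matrix algebra and its antisymmetric elements\<close>

text \<open>In both presentations \<^term>\<open>gen (i, j)\<close> is the generator with row index \<open>i\<close> and column
  index \<open>j\<close>.\<close>

abbreviation index_pairs :: "nat \<Rightarrow> (nat \<times> nat) set" where
  "index_pairs n \<equiv> {1..2*n} \<times> {1..2*n}"

definition qmat_relations :: "nat \<Rightarrow> complex \<Rightarrow> (nat \<times> nat) ncpoly set" where
  "qmat_relations n q =
     (let x = (\<lambda>i j. gen (i, j)); V = {1..2*n} in
        {x i k * x j k - q \<cdot> (x j k * x i k) | i j k.
           i \<in> V \<and> j \<in> V \<and> k \<in> V \<and> i < j}
      \<union> {x k i * x k j - q \<cdot> (x k j * x k i) | i j k.
           i \<in> V \<and> j \<in> V \<and> k \<in> V \<and> i < j}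
      \<union> {x i l * x j k - x j k * x i l | i j k l.
           i \<in> V \<and> j \<in> V \<and> k \<in> V \<and> l \<in> V \<and> i < j \<and> k < l}
      \<union> {x i k * x j l - x j l * x i k - (q - inverse q) \<cdot> (x i l * x j k) | i j k l.
           i \<in> V \<and> j \<in> V \<and> k \<in> V \<and> l \<in> V \<and> i < j \<and> k < l})"

definition qmat_algebra ::
    "nat \<Rightarrow> complex \<Rightarrow> (complex, (nat \<times> nat) ncpoly set) module" where
  "qmat_algebra n q = presented_algebra (index_pairs n) (qmat_relations n q)"

text \<open>The parameter \<open>s\<close> is the chosen square root of \<open>q\<close>.\<close>

definition zL_poly :: "nat \<Rightarrow> complex \<Rightarrow> complex \<Rightarrow> nat \<Rightarrow> nat \<Rightarrow> (nat \<times> nat) ncpoly" where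
  "zL_poly n q s i j =
     (let x = (\<lambda>i j. gen (i, j)) in
      \<Sum>k = 1..n. (s powi (int i + int j + 1 - 4 * int k)) \<cdot>
        (x i (2*k-1) * x j (2*k) - q \<cdot> (x i (2*k) * x j (2*k-1))))"

definition zR_poly :: "nat \<Rightarrow> complex \<Rightarrow> complex \<Rightarrow> nat \<Rightarrow> nat \<Rightarrow> (nat \<times> nat) ncpoly" where
  "zR_poly n q s i j =
     (let x = (\<lambda>i j. gen (i, j)) in
      \<Sum>k = 1..n. (s powi (- (int i + int j + 1 - 4 * int k))) \<cdot>
        (x (2*k-1) i * x (2*k) j - q \<cdot> (x (2*k) i * x (2*k-1) j)))"

definition zL :: "nat \<Rightarrow> complex \<Rightarrow> complex \<Rightarrow> nat \<Rightarrow> nat \<Rightarrow> (nat \<times> nat) ncpoly set" where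
  "zL n q s i j = presented_class (index_pairs n) (qmat_relations n q) (zL_poly n q s i j)"

definition zR :: "nat \<Rightarrow> complex \<Rightarrow> complex \<Rightarrow> nat \<Rightarrow> nat \<Rightarrow> (nat \<times> nat) ncpoly set" where
  "zR n q s i j = presented_class (index_pairs n) (qmat_relations n q) (zR_poly n q s i j)"

definition left_subalgebra ::
    "nat \<Rightarrow> complex \<Rightarrow> complex \<Rightarrow> (complex, (nat \<times> nat) ncpoly set) module" where
  "left_subalgebra n q s =
     generated_subalgebra (qmat_algebra n q) {zL n q s i j | i j. i \<in> {1..2*n} \<and> j \<in> {1..2*n}}"

definition right_subalgebra ::
    "nat \<Rightarrow> complex \<Rightarrow> complex \<Rightarrow> (complex, (nat \<times> nat) ncpoly set) module" where
  "right_subalgebra n q s =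
     generated_subalgebra (qmat_algebra n q) {zR n q s i j | i j. i \<in> {1..2*n} \<and> j \<in> {1..2*n}}"

section \<open>The algebra of quantum antisymmetric matrices\<close>

text \<open>
  The diagonal generators vanish, as \<open>z\<^sup>L\<^sub>i\<^sub>i = z\<^sup>R\<^sub>i\<^sub>i = 0\<close> requires. The relation
  \<open>z\<^sub>i\<^sub>j z\<^sub>i\<^sub>k = q z\<^sub>i\<^sub>k z\<^sub>i\<^sub>j\<close> is imposed for \<open>j < k\<close> and every \<open>i\<close> different from both. Through
  \<open>z\<^sub>i\<^sub>j = - q\<^sup>-\<^sup>1 z\<^sub>j\<^sub>i\<close>, the cases \<open>j < i < k\<close> and \<open>j < k < i\<close> are the relations
  \<open>z\<^sub>j\<^sub>i z\<^sub>i\<^sub>k = q z\<^sub>i\<^sub>k z\<^sub>j\<^sub>i\<close> and \<open>z\<^sub>j\<^sub>i z\<^sub>k\<^sub>i = q z\<^sub>k\<^sub>i z\<^sub>j\<^sub>i\<close>. They do not follow from the case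
  \<open>i < j < k\<close>: already for \<open>q = 1\<close> nothing else would make \<open>z\<^sub>1\<^sub>2\<close> and \<open>z\<^sub>2\<^sub>3\<close> commute.
\<close>

definition qasym_relations :: "nat \<Rightarrow> complex \<Rightarrow> (nat \<times> nat) ncpoly set" where
  "qasym_relations n q =
     (let z = (\<lambda>i j. gen (i, j)); V = {1..2*n} in
        {z i i | i. i \<in> V}
      \<union> {z i j + inverse q \<cdot> z j i | i j. i \<in> V \<and> j \<in> V \<and> i < j}
      \<union> {z i l * z j k - z j k * z i l | i j k l.
           i \<in> V \<and> j \<in> V \<and> k \<in> V \<and> l \<in> V \<and> i < j \<and> j < k \<and> k < l}
      \<union> {z i j * z i k - q \<cdot> (z i k * z i j) | i j k.
           i \<in> V \<and> j \<in> V \<and> k \<in> V \<and> j < k \<and> i \<noteq> j \<and> i \<noteq> k}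
      \<union> {z i k * z j l - z j l * z i k - (q - inverse q) \<cdot> (z i l * z j k) | i j k l.
           i \<in> V \<and> j \<in> V \<and> k \<in> V \<and> l \<in> V \<and> i < j \<and> j < k \<and> k < l}
      \<union> {z i j * z k l - z k l * z i j
           - ((q - inverse q) \<cdot> (z i k * z j l)
              - (q * (q - inverse q)) \<cdot> (z i l * z j k)) | i j k l.
           i \<in> V \<and> j \<in> V \<and> k \<in> V \<and> l \<in> V \<and> i < j \<and> j < k \<and> k < l})"

definition qasym_algebra ::
    "nat \<Rightarrow> complex \<Rightarrow> (complex, (nat \<times> nat) ncpoly set) module" where
  "qasym_algebra n q = presented_algebra (index_pairs n) (qasym_relations n q)"

end

theory Submission
  imports Defs
    "HOL-Library.Function_Algebras"
    "HOL-Library.Multiset"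
    "HOL-Library.Product_Lexorder"
begin

text \<open>
  Let \<open>w i j\<close> be the sum, over the column pairs \<open>2k-1, 2k\<close>, of the quantum minors of \<open>x\<close> with
  rows \<open>i\<close> and \<open>j\<close> (\<open>symplectic\<close> below). The powers of \<open>q\<^sup>1\<^sup>/\<^sup>2\<close> in \<open>z\<^sup>L\<close> are absorbed by
  multiplying the rows and columns of \<open>x\<close> with nonzero scalars, which preserves the relations of
  a quantum matrix, and \<open>z\<^sup>R\<close> is the same construction for the transposed matrix, which is again
  a quantum matrix. So both halves of the theorem say that \<open>z i j \<mapsto> w i j\<close> is an isomorphism onto its image.

  The map exists because \<open>w\<close> satisfies the defining relations in every ring that contains a
  quantum matrix (\<open>symplectic_antisym\<close>). The column pairs are added one at a time. The part of
  \<open>w\<close> built from earlier columns satisfies an exchange rule with the entries of a later column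
  (\<open>passes\<close>), and this rule makes the mixed terms cancel that the next minor contributes.

  The map is injective by comparing a spanning set with its image. Read as rewrite rules, the
  relations replace a word in the \<open>z i j\<close> by lexicographically smaller ones, so the sorted words
  in the letters \<open>z i j\<close> with \<open>i < j\<close> span the abstract algebra (\<open>normal_form\<close>). Their images are
  linearly independent, which is checked in a representation: operators on functions of integer
  exponents, that is, multiplications by variables and \<open>q\<close>-dilations. There a quantum matrix is
  made from a diagonal one by elementary row operations, each with a new variable
  (\<open>quantum_matrix_row_step\<close>). As \<open>w\<close> is bilinear in the rows, it undergoes the same operations
  and no cancellation occurs. For suitable weights of the variables every \<open>w i j\<close> with \<open>i < j\<close>
  has a leading monomial (\<open>generic_skew_model\<close>), and the exponents of these monomials are linearly
  independent (\<open>coord_exponent\<close>). Hence distinct sorted words have distinct leading monomials, and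
  no nontrivial combination of them is zero (\<open>kernel_trivial\<close>).
\<close>

section \<open>Quantum matrices and the symplectic form of their rows\<close>

text \<open>
  The relations are demanded for all natural numbers as indices. A matrix of finite size is
  extended by zero; it satisfies the additional relations because each index that occurs in a
  relation occurs in every term of it.
\<close>

definition quantum_matrix :: "'b::ring_1 \<Rightarrow> 'b \<Rightarrow> (nat \<Rightarrow> nat \<Rightarrow> 'b) \<Rightarrow> bool" where
  "quantum_matrix Q Qi X \<longleftrightarrow>
     (\<forall>i j k. i < j \<longrightarrow> X i k * X j k = Q * (X j k * X i k)) \<and>
     (\<forall>i j k. i < j \<longrightarrow> X k i * X k j = Q * (X k j * X k i)) \<and>
     (\<forall>i j k l. i < j \<longrightarrow> k < l \<longrightarrow> X i l * X j k = X j k * X i l) \<and>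
     (\<forall>i j k l. i < j \<longrightarrow> k < l \<longrightarrow>
        X i k * X j l - X j l * X i k = (Q - Qi) * (X i l * X j k))"

lemmas quantum_matrix_relations =
  quantum_matrix_def[THEN iffD1, THEN conjunct1, rule_format]
  quantum_matrix_def[THEN iffD1, THEN conjunct2, THEN conjunct1, rule_format]
  quantum_matrix_def[THEN iffD1, THEN conjunct2, THEN conjunct2, THEN conjunct1, rule_format]
  quantum_matrix_def[THEN iffD1, THEN conjunct2, THEN conjunct2, THEN conjunct2, rule_format]

text \<open>
  The parameter is a central unit of a ring and not a number, so that everything proved here
  applies to algebras over the complex numbers as well as to rings of classes of polynomials.
\<close>

locale q_scalars =
  fixes Q Qi :: "'b::ring_1"
  assumes Q_inv: "Q * Qi = 1" and Q_central: "Q * x = x * Q"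
begin

lemma Qi_inv: "Qi * Q = 1"
  using Q_central Q_inv by metis

lemma Qi_central: "Qi * x = x * Qi"
  by (metis Q_central Q_inv mult.assoc mult.left_neutral mult.right_neutral)

lemma Q_cancel: "Q * (Qi * x) = x" "Qi * (Q * x) = x"
  by (simp_all add: mult.assoc[symmetric] Q_inv Qi_inv)

text \<open>
  These are the relations of the quantum antisymmetric matrices, oriented as rewrite rules that
  bring a product of two entries into lexicographic order. The middle three clauses are the three
  possible positions of the shared index in \<open>z i j * z i k = q * z i k * z i j\<close>, after both factors
  have been written with increasing indices.
\<close>

definition quantum_antisym :: "(nat \<Rightarrow> nat \<Rightarrow> 'b) \<Rightarrow> bool" where
  "quantum_antisym Z \<longleftrightarrow>
     (\<forall>i. Z i i = 0) \<and>
     (\<forall>i j. i < j \<longrightarrow> Z j i = - (Q * Z i j)) \<and>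
     (\<forall>i j k l. i < j \<longrightarrow> j < k \<longrightarrow> k < l \<longrightarrow> Z j k * Z i l = Z i l * Z j k) \<and>
     (\<forall>i j k. i < j \<longrightarrow> j < k \<longrightarrow> Z i k * Z i j = Qi * (Z i j * Z i k)) \<and>
     (\<forall>i j k. i < j \<longrightarrow> j < k \<longrightarrow> Z j k * Z i j = Qi * (Z i j * Z j k)) \<and>
     (\<forall>i j k. i < j \<longrightarrow> j < k \<longrightarrow> Z j k * Z i k = Qi * (Z i k * Z j k)) \<and>
     (\<forall>i j k l. i < j \<longrightarrow> j < k \<longrightarrow> k < l \<longrightarrow>
        Z j l * Z i k = Z i k * Z j l - (Q - Qi) * (Z i l * Z j k)) \<and>
     (\<forall>i j k l. i < j \<longrightarrow> j < k \<longrightarrow> k < l \<longrightarrow>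
        Z k l * Z i j = Z i j * Z k l - (Q - Qi) * (Z i k * Z j l)
          + Q * ((Q - Qi) * (Z i l * Z j k)))"

text \<open>
  The rule for moving an entry \<open>x k\<close> of a later column of a quantum matrix to the left of a skew
  form \<open>W\<close> made from earlier columns. It is linear in \<open>W\<close>, so it can be checked for one minor and
  then summed.
\<close>

definition passes :: "(nat \<Rightarrow> nat \<Rightarrow> 'b) \<Rightarrow> (nat \<Rightarrow> 'b) \<Rightarrow> bool" where
  "passes W x \<longleftrightarrow>
     (\<forall>i j k. k < i \<longrightarrow> i < j \<longrightarrow> W i j * x k = x k * W i j) \<and>
     (\<forall>i j. i < j \<longrightarrow> W i j * x i = Q * (x i * W i j)) \<and>
     (\<forall>i j k. i < k \<longrightarrow> k < j \<longrightarrow> W i j * x k = x k * W i j + (Q - Qi) * (x i * W k j)) \<and>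
     (\<forall>i j. i < j \<longrightarrow> W i j * x j = Q * (x j * W i j)) \<and>
     (\<forall>i j k. i < j \<longrightarrow> j < k \<longrightarrow>
        W i j * x k = x k * W i j + (Q - Qi) * (x j * W i k) - Qi * ((Q - Qi) * (x i * W j k)))"

lemmas passesD =
  passes_def[THEN iffD1, THEN conjunct1, rule_format]
  passes_def[THEN iffD1, THEN conjunct2, THEN conjunct1, rule_format]
  passes_def[THEN iffD1, THEN conjunct2, THEN conjunct2, THEN conjunct1, rule_format]
  passes_def[THEN iffD1, THEN conjunct2, THEN conjunct2, THEN conjunct2, THEN conjunct1, rule_format]
  passes_def[THEN iffD1, THEN conjunct2, THEN conjunct2, THEN conjunct2, THEN conjunct2, rule_format]

lemmas quantum_antisymD =
  quantum_antisym_def[THEN iffD1, THEN conjunct1, rule_format]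
  quantum_antisym_def[THEN iffD1, THEN conjunct2, THEN conjunct1, rule_format]
  quantum_antisym_def[THEN iffD1, THEN conjunct2, THEN conjunct2, THEN conjunct1, rule_format]
  quantum_antisym_def[THEN iffD1, THEN conjunct2, THEN conjunct2, THEN conjunct2, THEN conjunct1, rule_format]
  quantum_antisym_def[THEN iffD1, THEN conjunct2, THEN conjunct2, THEN conjunct2, THEN conjunct2, THEN conjunct1, rule_format]
  quantum_antisym_def[THEN iffD1, THEN conjunct2, THEN conjunct2, THEN conjunct2, THEN conjunct2, THEN conjunct2, THEN conjunct1, rule_format]
  quantum_antisym_def[THEN iffD1, THEN conjunct2, THEN conjunct2, THEN conjunct2, THEN conjunct2, THEN conjunct2, THEN conjunct2, THEN conjunct1, rule_format]
  quantum_antisym_def[THEN iffD1, THEN conjunct2, THEN conjunct2, THEN conjunct2, THEN conjunct2, THEN conjunct2, THEN conjunct2, THEN conjunct2, rule_format]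

lemma quantum_matrixD:
  assumes "quantum_matrix Q Qi X"
  shows "\<And>i j k. i < j \<Longrightarrow> X j k * X i k = Qi * (X i k * X j k)"
    and "\<And>i j k. i < j \<Longrightarrow> X k j * X k i = Qi * (X k i * X k j)"
    and "\<And>i j k l. i < j \<Longrightarrow> k < l \<Longrightarrow> X i l * X j k = X j k * X i l"
    and "\<And>i j k l. i < j \<Longrightarrow> k < l \<Longrightarrow>
        X j l * X i k = X i k * X j l - (Q - Qi) * (X j k * X i l)"
proof -
  note rel = quantum_matrix_relations[OF assms]
  fix i j k l :: nat assume ij: "i < j"
  show "X j k * X i k = Qi * (X i k * X j k)" "X k j * X k i = Qi * (X k i * X k j)"
    by (simp_all only: rel(1)[OF ij] rel(2)[OF ij] Q_cancel)
  assume kl: "k < l"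
  show com: "X i l * X j k = X j k * X i l"
    by (rule rel(3)[OF ij kl])
  have "X i k * X j l = (Q - Qi) * (X i l * X j k) + X j l * X i k"
    using rel(4)[OF ij kl] by (simp only: diff_eq_eq)
  then show "X j l * X i k = X i k * X j l - (Q - Qi) * (X j k * X i l)"
    by (simp only: com add_diff_cancel_left')
qed

text \<open>
  With products bracketed to the right, a rewrite rule for two adjacent factors is needed a second
  time for the case that further factors follow.
\<close>

lemma assoc_rule: "a * b = c \<Longrightarrow> a * (b * z) = c * (z::'b)"
  by (simp add: mult.assoc[symmetric])

abbreviation minor :: "(nat \<Rightarrow> nat \<Rightarrow> 'b) \<Rightarrow> nat \<Rightarrow> nat \<Rightarrow> nat \<Rightarrow> nat \<Rightarrow> 'b" where
  "minor X a b i j \<equiv> X i a * X j b - Q * (X i b * X j a)"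

text \<open>
  Both sides are brought to the normal form in which entries of the column \<open>c\<close> stand left of those
  of \<open>a\<close>, and these left of those of \<open>b\<close>, with increasing row indices inside a column. The relations
  of a quantum matrix, read as rewrite rules, reach this form.
\<close>

lemma minor_passes:
  assumes X: "quantum_matrix Q Qi X" and ab: "a < b" "b < c"
  shows "passes (minor X a b) (\<lambda>k. X k c)"
proof -
  have ac: "a < c" using ab by simp
  note D = quantum_matrixD[OF X]
  have cen: "X i j * Q = Q * X i j" "X i j * Qi = Qi * X i j" for i j
    by (rule Q_central[symmetric] Qi_central[symmetric])+
  have mat: "X j c * X i c = Qi * (X i c * X j c)"
    "X i a * X i c = Q * (X i c * X i a)" "X i b * X i c = Q * (X i c * X i b)"
    "X j a * X i a = Qi * (X i a * X j a)" "X j b * X i b = Qi * (X i b * X j b)"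
    "X i b * X i a = Qi * (X i a * X i b)"
    "X j b * X i a = X i a * X j b - (Q - Qi) * (X j a * X i b)"
    "X i b * X j a = X j a * X i b"
    "X j a * X i c = X i c * X j a" "X j b * X i c = X i c * X j b"
    "X i a * X j c = X j c * X i a + (Q - Qi) * (X i c * X j a)"
    "X i b * X j c = X j c * X i b + (Q - Qi) * (X i c * X j b)"
    if "i < j" for i j
    by (simp_all only: D(1)[OF that] D(2)[OF ab(2)] D(2)[OF ac] D(2)[OF ab(1)]
      D(3)[OF that ab(1)] D(3)[OF that ab(2)] D(3)[OF that ac] 
      D(4)[OF that ab(1)] D(4)[OF that ab(2)] D(4)[OF that ac] Q_cancel diff_add_cancel)
  have mat2: "X i a * X i c = Q * (X i c * X i a)" "X i b * X i c = Q * (X i c * X i b)"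
    "X i b * X i a = Qi * (X i a * X i b)" for i
    using mat(2,3,6)[of i "Suc i"] by simp_all
  note r = mat2 mat2[THEN assoc_rule] cen cen[THEN assoc_rule] Q_cancel Q_inv Qi_inv
  show ?thesis unfolding passes_def
  proof (intro conjI allI impI)
    fix i j k :: nat assume o: "k < i" "i < j"
    have o2: "k < j" using o by simp
    note m = mat[OF o(1)] mat[OF o(2)] mat[OF o2]
    show "minor X a b i j * X k c = X k c * minor X a b i j"
      by (simp add: r m m[THEN assoc_rule] algebra_simps)
  next
    fix i j :: nat assume o: "i < j"
    note m = mat[OF o(1)]
    show "minor X a b i j * X i c = Q * (X i c * minor X a b i j)"
      by (simp add: r m m[THEN assoc_rule] algebra_simps)
    show "minor X a b i j * X j c = Q * (X j c * minor X a b i j)"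
      by (simp add: r m m[THEN assoc_rule] algebra_simps)
  next
    fix i j k :: nat assume o: "i < k" "k < j"
    have o2: "i < j" using o by simp
    note m = mat[OF o(1)] mat[OF o(2)] mat[OF o2]
    show "minor X a b i j * X k c = X k c * minor X a b i j + (Q - Qi) * (X i c * minor X a b k j)"
      by (simp add: r m m[THEN assoc_rule] algebra_simps)
  next
    fix i j k :: nat assume o: "i < j" "j < k"
    have o2: "i < k" using o by simp
    note m = mat[OF o(1)] mat[OF o(2)] mat[OF o2]
    show "minor X a b i j * X k c = X k c * minor X a b i j + (Q - Qi) * (X j c * minor X a b i k)
        - Qi * ((Q - Qi) * (X i c * minor X a b j k))"
      by (simp add: r m m[THEN assoc_rule] algebra_simps)
  qed
qed

text \<open>
  In the expansion of a relation for \<open>W + minor\<close> the terms quadratic in \<open>W\<close> cancel by hypothesis.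
  The other terms cancel after rewriting to the order: column \<open>a\<close>, column \<open>b\<close>, entries of \<open>W\<close>. With
  \<open>W = 0\<close> this contains the commutation relations of the quantum minors of two columns.
\<close>

lemma quantum_antisym_add_minor:
  assumes X: "quantum_matrix Q Qi X" and ab: "a < b" and W: "quantum_antisym W"
    and p: "passes W (\<lambda>k. X k a)" "passes W (\<lambda>k. X k b)"
  shows "quantum_antisym (\<lambda>i j. W i j + minor X a b i j)"
proof -
  note D = quantum_matrixD[OF X] and W = quantum_antisymD[OF W] 
  note p = passesD[OF p(1)] passesD[OF p(2)]
  have cen: "X i j * Q = Q * X i j" "X i j * Qi = Qi * X i j" "W i j * Q = Q * W i j" "W i j * Qi = Qi * W i j" for i j
    by (rule Q_central[symmetric] Qi_central[symmetric])+
  have one: "X i b * X i a = Qi * (X i a * X i b)" for i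
    using D(2)[OF ab] .
  have mat: "X j a * X i a = Qi * (X i a * X j a)" "X j b * X i b = Qi * (X i b * X j b)"
    "X i b * X j a = X j a * X i b"
    "X j b * X i a = X i a * X j b - (Q - Qi) * (X j a * X i b)"
    "W i j * X i a = Q * (X i a * W i j)" "W i j * X i b = Q * (X i b * W i j)"
    "W i j * X j a = Q * (X j a * W i j)" "W i j * X j b = Q * (X j b * W i j)"
    if "i < j" for i j
    by (fact D(1)[OF that] D(3)[OF that ab] D(4)[OF that ab] p(2,4,7,9)[OF that])+
  have mat3: "W j k * X i a = X i a * W j k" "W j k * X i b = X i b * W j k"
    "W i k * X j a = X j a * W i k + (Q - Qi) * (X i a * W j k)"
    "W i k * X j b = X j b * W i k + (Q - Qi) * (X i b * W j k)"
    "W i j * X k a = X k a * W i j + (Q - Qi) * (X j a * W i k) - Qi * ((Q - Qi) * (X i a * W j k))"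
    "W i j * X k b = X k b * W i j + (Q - Qi) * (X j b * W i k) - Qi * ((Q - Qi) * (X i b * W j k))"
    "W i k * W i j = Qi * (W i j * W i k)"
    "W j k * W i j = Qi * (W i j * W j k)"
    "W j k * W i k = Qi * (W i k * W j k)"
    if "i < j" "j < k" for i j k
    by (fact p(1,3,5,6,8,10)[OF that] W(4,5,6)[OF that])+
  note r = one one[THEN assoc_rule] cen cen[THEN assoc_rule] Q_cancel Q_inv Qi_inv
  show ?thesis unfolding quantum_antisym_def
  proof (intro conjI allI impI)
    fix i show "W i i + minor X a b i i = 0"
      by (simp add: W(1) r algebra_simps)
  next
    fix i j :: nat assume o: "i < j"
    show "W j i + minor X a b j i = - (Q * (W i j + minor X a b i j))"
      by (simp add: W(2) r mat o algebra_simps)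
  next
    fix i j k :: nat assume o: "i < j" "j < k"
    have o2: "i < k" using o by simp
    note m = mat[OF o(1)] mat[OF o(2)] mat[OF o2] mat3[OF o]
    show "(W i k + minor X a b i k) * (W i j + minor X a b i j)
        = Qi * ((W i j + minor X a b i j) * (W i k + minor X a b i k))"
      by (simp add: r m m[THEN assoc_rule] algebra_simps)
    show "(W j k + minor X a b j k) * (W i j + minor X a b i j)
        = Qi * ((W i j + minor X a b i j) * (W j k + minor X a b j k))"
      by (simp add: r m m[THEN assoc_rule] algebra_simps)
    show "(W j k + minor X a b j k) * (W i k + minor X a b i k)
        = Qi * ((W i k + minor X a b i k) * (W j k + minor X a b j k))"
      by (simp add: r m m[THEN assoc_rule] algebra_simps)
  next
    fix i j k l :: nat assume o: "i < j" "j < k" "k < l"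
    have o2: "i < k" "i < l" "j < l" using o by simp_all
    note m = mat[OF o(1)] mat[OF o(2)] mat[OF o(3)] mat[OF o2(1)] mat[OF o2(2)] mat[OF o2(3)]
      mat3[OF o(1,2)] mat3[OF o(2,3)] mat3[OF o(1) o2(3)] mat3[OF o2(1) o(3)]
      W(3)[OF o] W(7)[OF o] W(8)[OF o]
    show "(W j k + minor X a b j k) * (W i l + minor X a b i l)
        = (W i l + minor X a b i l) * (W j k + minor X a b j k)"
      by (simp add: r m m[THEN assoc_rule] algebra_simps)
    show "(W j l + minor X a b j l) * (W i k + minor X a b i k)
        = (W i k + minor X a b i k) * (W j l + minor X a b j l)
          - (Q - Qi) * ((W i l + minor X a b i l) * (W j k + minor X a b j k))"
      by (simp add: r m m[THEN assoc_rule] algebra_simps)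
    show "(W k l + minor X a b k l) * (W i j + minor X a b i j)
        = (W i j + minor X a b i j) * (W k l + minor X a b k l)
          - (Q - Qi) * ((W i k + minor X a b i k) * (W j l + minor X a b j l))
          + Q * ((Q - Qi) * ((W i l + minor X a b i l) * (W j k + minor X a b j k)))"
      by (simp add: r m m[THEN assoc_rule] algebra_simps)
  qed
qed

lemma passes_add:
  assumes "passes V x" "passes W x"
  shows "passes (\<lambda>i j. V i j + W i j) x"
  unfolding passes_def
  by (intro conjI allI impI;
      simp add: passesD[OF assms(1)] passesD[OF assms(2)] distrib_left distrib_right)

definition symplectic :: "nat \<Rightarrow> (nat \<Rightarrow> nat \<Rightarrow> 'b) \<Rightarrow> nat \<Rightarrow> nat \<Rightarrow> 'b" where
  "symplectic n X i j = (\<Sum>k = 1..n. minor X (2*k-1) (2*k) i j)"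

lemma symplectic_Suc: "symplectic (Suc n) X = (\<lambda>i j. symplectic n X i j + minor X (2*n+1) (2*n+2) i j)"
  by (simp add: symplectic_def fun_eq_iff)

text \<open>
  The induction carries along the exchange rule with all columns that are still to come.
\<close>

theorem symplectic_antisym:
  assumes X: "quantum_matrix Q Qi X"
  shows "quantum_antisym (symplectic n X)"
proof -
  have "quantum_antisym (symplectic n X) \<and> (\<forall>c > 2*n. passes (symplectic n X) (\<lambda>k. X k c))"
  proof (induction n)
    case 0
    show ?case by (simp add: symplectic_def quantum_antisym_def passes_def)
  next
    case (Suc n)
    then have a: "quantum_antisym (symplectic n X)"
      and p: "\<And>c. c > 2*n \<Longrightarrow> passes (symplectic n X) (\<lambda>k. X k c)"
      by blast+
    have "quantum_antisym (symplectic (Suc n) X)"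
      unfolding symplectic_Suc
      by (rule quantum_antisym_add_minor[OF X _ a p p]) simp_all
    moreover have "passes (symplectic (Suc n) X) (\<lambda>k. X k c)" if "c > 2 * Suc n" for c
      unfolding symplectic_Suc
      by (rule passes_add[OF p minor_passes[OF X]]) (use that in simp_all)
    ultimately show ?case by blast
  qed
  then show ?thesis by blast
qed

lemma quantum_matrix_transpose:
  assumes X: "quantum_matrix Q Qi X"
  shows "quantum_matrix Q Qi (\<lambda>i j. X j i)"
proof -
  note rel = quantum_matrix_relations[OF X]
  show ?thesis unfolding quantum_matrix_def
  proof (intro conjI allI impI)
    fix i j k l :: nat assume o: "i < j"
    show "X k i * X k j = Q * (X k j * X k i)" "X i k * X j k = Q * (X j k * X i k)"
      by (rule rel[OF o])+
    assume o2: "k < l"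
    show "X l i * X k j = X k j * X l i"
      by (rule rel(3)[OF o2 o, symmetric])
    show "X k i * X l j - X l j * X k i = (Q - Qi) * (X l i * X k j)"
      unfolding rel(4)[OF o2 o] rel(3)[OF o2 o] ..
  qed
qed

text \<open>
  The condition on \<open>S\<close> holds for the product of a row factor and a column factor. It makes all
  terms of a relation acquire the same central factor.
\<close>

lemma quantum_matrix_scale:
  assumes X: "quantum_matrix Q Qi X" and cen: "\<And>i c x. S i c * x = x * S i c"
    and S: "\<And>i j c d. S i c * S j d = S i d * S j c"
  shows "quantum_matrix Q Qi (\<lambda>i c. S i c * X i c)"
proof -
  note rel = quantum_matrix_relations[OF X]
  have m: "(S i c * x) * (S j d * y) = (S i c * S j d) * (x * y)" for i c j d x y
    using cen by (metis mult.assoc)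
  have Qm: "Q * ((S i c * S j d) * x) = (S i c * S j d) * (Q * x)" 
     "(Q - Qi) * ((S i c * S j d) * x) = (S i c * S j d) * ((Q - Qi) * x)" for i c j d x
    using cen by (metis mult.assoc)+
  have com: "S j d * S i c = S i c * S j d" for i j c d
    by (rule cen)
  show ?thesis unfolding quantum_matrix_def
  proof (intro conjI allI impI)
    fix i j k l :: nat assume o: "i < j"
    show "S i k * X i k * (S j k * X j k) = Q * (S j k * X j k * (S i k * X i k))"
      unfolding m com[of j k i k] Qm rel(1)[OF o] ..
    show "S k i * X k i * (S k j * X k j) = Q * (S k j * X k j * (S k i * X k i))"
      unfolding m com[of k j k i] Qm rel(2)[OF o] ..
    assume o2: "k < l"
    show "S i l * X i l * (S j k * X j k) = S j k * X j k * (S i l * X i l)"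
      unfolding m com[of j k i l] rel(3)[OF o o2] ..
    show "S i k * X i k * (S j l * X j l) - S j l * X j l * (S i k * X i k) =
       (Q - Qi) * (S i l * X i l * (S j k * X j k))"
      unfolding m com[of j l i k] S[of i l j k] Qm rel(4)[OF o o2, symmetric]
      by (simp only: right_diff_distrib)
  qed
qed

section \<open>Elementary row operations\<close>

text \<open>
  This is multiplication from the left by a quantum matrix that differs from the identity only in
  the rows and columns \<open>r\<close>, \<open>r + 1\<close>, where it has the diagonal entries \<open>k\<close>, \<open>k'\<close> and the entry \<open>t\<close>
  below the diagonal.
\<close>

definition row_step :: "nat \<Rightarrow> 'b \<Rightarrow> 'b \<Rightarrow> 'b \<Rightarrow> (nat \<Rightarrow> nat \<Rightarrow> 'b) \<Rightarrow> nat \<Rightarrow> nat \<Rightarrow> 'b" where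
  "row_step r t k k' X i c =
     (if i = r then k * X r c else if i = Suc r then k' * X (Suc r) c + t * X r c else X i c)"

text \<open>
  A product of two quantum matrices whose entries commute with each other is a quantum matrix; this
  is the case of an elementary left factor. A relation involves two rows, so it is enough to treat
  the positions of two rows relative to \<open>r\<close> and \<open>r + 1\<close>.
\<close>

lemma quantum_matrix_row_step:
  assumes X: "quantum_matrix Q Qi X"
    and cen: "\<And>i c. X i c * t = t * X i c" "\<And>i c. X i c * k = k * X i c" "\<And>i c. X i c * k' = k' * X i c"
    and t: "k * t = Q * (t * k)" "k' * t = Qi * (t * k')" "k' * k = k * k'"
  shows "quantum_matrix Q Qi (row_step r t k k' X)"
proof -
  note D = quantum_matrixD[OF X]
  have sc: "X i j * Q = Q * X i j" "X i j * Qi = Qi * X i j" "k * Q = Q * k" "k * Qi = Qi * k"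
    "k' * Q = Q * k'" "k' * Qi = Qi * k'" "t * Q = Q * t" "t * Qi = Qi * t" for i j
    by (rule Q_central[symmetric] Qi_central[symmetric])+
  note r = sc sc[THEN assoc_rule] cen cen[THEN assoc_rule] t t[THEN assoc_rule] Q_cancel Q_inv Qi_inv
  have ns: "r < Suc r" by simp
  have tri: "i = r \<and> j = Suc r \<or> i = r \<and> j > Suc r \<or> i = Suc r \<and> j > Suc r \<or> i < r \<and> j = r \<or>
    i < r \<and> j = Suc r \<or> i \<notin> {r, Suc r} \<and> j \<notin> {r, Suc r}" if "i < j" for i j
    using that by auto
  show ?thesis unfolding quantum_matrix_def
  proof (intro conjI allI impI)
    fix i j c :: nat assume o: "i < j"
    show "row_step r t k k' X i c * row_step r t k k' X j c
        = Q * (row_step r t k k' X j c * row_step r t k k' X i c)"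
      using tri[OF o]
    proof (elim disjE conjE)
      assume a: "i = r" "j = Suc r"
      note e = D(1)[OF ns]
      show ?thesis unfolding a
        by (simp add: row_step_def r e e[THEN assoc_rule] algebra_simps)
    next
      assume a: "i = r" "j > Suc r"
      then have o: "r < j" by simp
      note e = D(1)[OF o]
      show ?thesis using a
        by (simp add: row_step_def r e e[THEN assoc_rule] algebra_simps)
    next
      assume a: "i = Suc r" "j > Suc r"
      then have o: "r < j" by simp
      note e = D(1)[OF ns] D(1)[OF o] D(1)[OF a(2)]
      show ?thesis using a
        by (simp add: row_step_def r e e[THEN assoc_rule] algebra_simps)
    next
      assume a: "i < r" "j = r"
      note e = D(1)[OF a(1)]
      show ?thesis using a
        by (simp add: row_step_def r e e[THEN assoc_rule] algebra_simps)
    next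
      assume a: "i < r" "j = Suc r"
      then have o: "i < Suc r" by simp
      note e = D(1)[OF a(1)] D(1)[OF o]
      show ?thesis using a
        by (simp add: row_step_def r e e[THEN assoc_rule] algebra_simps)
    next
      assume a: "i \<notin> {r, Suc r}" "j \<notin> {r, Suc r}"
      note e = D(1)[OF o]
      show ?thesis using a
        by (simp add: row_step_def r e)
    qed
  next
    fix i c d :: nat assume o: "c < d"
    note e = D(2)[OF o] D(3)[OF ns o] D(4)[OF ns o]
    show "row_step r t k k' X i c * row_step r t k k' X i d
        = Q * (row_step r t k k' X i d * row_step r t k k' X i c)"
      by (simp add: row_step_def r e e[THEN assoc_rule] algebra_simps)
  next
    fix i j c d :: nat assume o: "i < j" "c < d"
    show "row_step r t k k' X i d * row_step r t k k' X j c
        = row_step r t k k' X j c * row_step r t k k' X i d"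
      using tri[OF o(1)]
    proof (elim disjE conjE)
      assume a: "i = r" "j = Suc r"
      note e = D(2)[OF o(2)] D(3)[OF ns o(2)] D(4)[OF ns o(2)]
      show ?thesis using a
        by (simp add: row_step_def r e e[THEN assoc_rule] algebra_simps)
    next
      assume a: "i = r" "j > Suc r"
      then have p: "r < j" by simp
      note e = D(3)[OF p o(2)] D(4)[OF p o(2)]
      show ?thesis using a
        by (simp add: row_step_def r e e[THEN assoc_rule] algebra_simps)
    next
      assume a: "i = Suc r" "j > Suc r"
      then have p: "r < j" by simp
      note e = D(3)[OF p o(2)] D(4)[OF p o(2)] D(3)[OF a(2) o(2)] D(4)[OF a(2) o(2)]
      show ?thesis using a
        by (simp add: row_step_def r e e[THEN assoc_rule] algebra_simps)
    next
      assume a: "i < r" "j = r"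
      note e = D(3)[OF a(1) o(2)] D(4)[OF a(1) o(2)]
      show ?thesis using a
        by (simp add: row_step_def r e e[THEN assoc_rule] algebra_simps)
    next
      assume a: "i < r" "j = Suc r"
      then have p: "i < Suc r" by simp
      note e = D(3)[OF a(1) o(2)] D(4)[OF a(1) o(2)] D(3)[OF p o(2)] D(4)[OF p o(2)]
      show ?thesis using a
        by (simp add: row_step_def r e e[THEN assoc_rule] algebra_simps)
    next
      assume a: "i \<notin> {r, Suc r}" "j \<notin> {r, Suc r}"
      note e = D(3)[OF o(1) o(2)] D(4)[OF o(1) o(2)]
      show ?thesis using a
        by (simp add: row_step_def r e e[THEN assoc_rule] algebra_simps)
    qed
    show "row_step r t k k' X i c * row_step r t k k' X j d -
       row_step r t k k' X j d * row_step r t k k' X i c =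
       (Q - Qi) * (row_step r t k k' X i d * row_step r t k k' X j c)"
      using tri[OF o(1)]
    proof (elim disjE conjE)
      assume a: "i = r" "j = Suc r"
      note e = D(2)[OF o(2)] D(3)[OF ns o(2)] D(4)[OF ns o(2)]
      show ?thesis using a
        by (simp add: row_step_def r e e[THEN assoc_rule] algebra_simps)
    next
      assume a: "i = r" "j > Suc r"
      then have p: "r < j" by simp
      note e = D(3)[OF p o(2)] D(4)[OF p o(2)]
      show ?thesis using a
        by (simp add: row_step_def r e e[THEN assoc_rule] algebra_simps)
    next
      assume a: "i = Suc r" "j > Suc r"
      then have p: "r < j" by simp
      note e = D(3)[OF p o(2)] D(4)[OF p o(2)] D(3)[OF a(2) o(2)] D(4)[OF a(2) o(2)]
      show ?thesis using a
        by (simp add: row_step_def r e e[THEN assoc_rule] algebra_simps)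
    next
      assume a: "i < r" "j = r"
      note e = D(3)[OF a(1) o(2)] D(4)[OF a(1) o(2)]
      show ?thesis using a
        by (simp add: row_step_def r e e[THEN assoc_rule] algebra_simps)
    next
      assume a: "i < r" "j = Suc r"
      then have p: "i < Suc r" by simp
      note e = D(3)[OF a(1) o(2)] D(4)[OF a(1) o(2)] D(3)[OF p o(2)] D(4)[OF p o(2)]
      show ?thesis using a
        by (simp add: row_step_def r e e[THEN assoc_rule] algebra_simps)
    next
      assume a: "i \<notin> {r, Suc r}" "j \<notin> {r, Suc r}"
      note e = D(3)[OF o(1) o(2)] D(4)[OF o(1) o(2)]
      show ?thesis using a
        by (simp add: row_step_def r e e[THEN assoc_rule] algebra_simps)
    qed
  qed
qed

end

section \<open>Operators on functions of integer exponents\<close>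

text \<open>
  A function of the exponents stands for a Laurent series. All functions are allowed, with no
  condition on the support, because leading terms are only compared where they exist.
\<close>

typedef 'e op = "{T :: ('e \<Rightarrow> complex) \<Rightarrow> 'e \<Rightarrow> complex.
    (\<forall>f g. T (\<lambda>e. f e + g e) = (\<lambda>e. T f e + T g e)) \<and> (\<forall>c f. T (\<lambda>e. c * f e) = (\<lambda>e. c * T f e))}"
  morphisms app Op
  by (rule exI[of _ "\<lambda>f. f"]) simp

setup_lifting type_definition_op

lemma app_add: "app T (\<lambda>e. f e + g e) = (\<lambda>e. app T f e + app T g e)"
  and app_scale: "app T (\<lambda>e. c * f e) = (\<lambda>e. c * app T f e)"
  using app[of T] by auto

lemma op_eqI: "(\<And>f e. app S f e = app T f e) \<Longrightarrow> S = T"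
  by (metis app_inject ext)

instantiation op :: (type) ring_1
begin
lift_definition zero_op :: "'a op" is "\<lambda>f e. 0" by simp
lift_definition one_op :: "'a op" is "\<lambda>f. f" by simp
lift_definition plus_op :: "'a op \<Rightarrow> 'a op \<Rightarrow> 'a op" is "\<lambda>S T f e. S f e + T f e"
  by (simp add: algebra_simps)
lift_definition minus_op :: "'a op \<Rightarrow> 'a op \<Rightarrow> 'a op" is "\<lambda>S T f e. S f e - T f e"
  by (simp add: algebra_simps)
lift_definition uminus_op :: "'a op \<Rightarrow> 'a op" is "\<lambda>S f e. - S f e"
  by (simp add: algebra_simps)
lift_definition times_op :: "'a op \<Rightarrow> 'a op \<Rightarrow> 'a op" is "\<lambda>S T f. S (T f)" by simp
instance
proof
  have "app (0 :: 'a op) (\<lambda>e. 1) \<noteq> app 1 (\<lambda>e. 1)"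
    by (simp add: zero_op.rep_eq one_op.rep_eq fun_eq_iff)
  then show "(0 :: 'a op) \<noteq> 1" by metis
qed (rule op_eqI; simp add: zero_op.rep_eq one_op.rep_eq plus_op.rep_eq minus_op.rep_eq
      uminus_op.rep_eq times_op.rep_eq app_add; fail)+
end

lemmas app_simps [simp] = zero_op.rep_eq one_op.rep_eq plus_op.rep_eq minus_op.rep_eq
  uminus_op.rep_eq times_op.rep_eq

lift_definition const_op :: "complex \<Rightarrow> 'e op" is "\<lambda>c f e. c * f e"
  by (auto simp: algebra_simps)

lemma const_op_central: "const_op c * T = T * const_op c"
  by (rule op_eqI) (simp add: const_op.rep_eq app_scale)

lemma const_op_hom: "const_op (a + b) = const_op a + const_op b"
  "const_op (a * b) = const_op a * const_op b" "const_op 1 = 1" "const_op 0 = 0"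
  by (rule op_eqI, simp add: const_op.rep_eq algebra_simps)+

text \<open>
  Multiplication by the variable \<open>v\<close>, and the substitution \<open>v \<mapsto> a v\<close>.
\<close>

lift_definition shift :: "'v \<Rightarrow> ('v \<Rightarrow> int) op" is "\<lambda>v f e. f (e(v := e v - 1))" by simp
lift_definition dilation :: "complex \<Rightarrow> 'v \<Rightarrow> ('v \<Rightarrow> int) op" is "\<lambda>a v f e. (a powi e v) * f e"
  by (auto simp: algebra_simps)

lemma shift_shift: "shift u * shift v = shift v * shift u"
  by (rule op_eqI) (cases "u = v"; simp add: shift.rep_eq fun_upd_twist)

lemma dilation_dilation: "dilation a u * dilation b v = dilation b v * dilation a u"
  by (rule op_eqI) (simp add: dilation.rep_eq)

lemma dilation_shift_other: "u \<noteq> v \<Longrightarrow> dilation a u * shift v = shift v * dilation a u"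
  by (rule op_eqI) (simp add: dilation.rep_eq shift.rep_eq)

lemma dilation_shift: "a \<noteq> 0 \<Longrightarrow> dilation a v * shift v = const_op a * (shift v * dilation a v)"
  by (rule op_eqI) (simp add: dilation.rep_eq shift.rep_eq const_op.rep_eq power_int_diff)

definition unit :: "'v \<Rightarrow> 'v \<Rightarrow> int" where "unit v = (\<lambda>u. if u = v then 1 else 0)"

lemma shift_app: "app (shift v) f (e + unit v) = f e"
proof -
  have "(e + unit v)(v := (e + unit v) v - 1) = e"
    by (auto simp: unit_def fun_eq_iff)
  then show ?thesis by (simp add: shift.rep_eq)
qed

section \<open>Leading exponents\<close>

text \<open>
  Weights are given to finitely many variables only, so that the weight of an arbitrary exponent
  is a finite sum; the remaining variables have weight zero.
\<close>

locale weighted_vars =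
  fixes V :: "'v set" and wt :: "'v \<Rightarrow> int"
  assumes finite_V: "finite V"
begin

definition weight :: "('v \<Rightarrow> int) \<Rightarrow> int" where "weight e = (\<Sum>v\<in>V. wt v * e v)"

lemma weight_add: "weight (d + e) = weight d + weight e"
  by (simp add: weight_def algebra_simps sum.distrib)

lemma weight_zero: "weight 0 = 0" by (simp add: weight_def)

lemma weight_unit: "v \<in> V \<Longrightarrow> weight (unit v) = wt v"
  using finite_V by (simp add: weight_def unit_def if_distrib cong: if_cong)

lemma weight_sum: "weight (\<Sum>i\<in>I. f i) = (\<Sum>i\<in>I. weight (f i))"
  by (induction I rule: infinite_finite_induct)
    (simp_all only: sum.infinite sum.empty sum.insert weight_zero weight_add not_False_eq_True)

definition peak :: "(('v \<Rightarrow> int) \<Rightarrow> complex) \<Rightarrow> ('v \<Rightarrow> int) \<Rightarrow> bool" where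
  "peak f e \<longleftrightarrow> f e \<noteq> 0 \<and> (\<forall>d. f d \<noteq> 0 \<longrightarrow> d = e \<or> weight d < weight e)"

text \<open>
  The operator multiplies leading monomials by the monomial with exponent \<open>a\<close>, up to a nonzero
  factor which may depend on the argument. This is stable under products, unlike a condition on
  the value at a single function.
\<close>

definition leads :: "('v \<Rightarrow> int) op \<Rightarrow> ('v \<Rightarrow> int) \<Rightarrow> bool" where
  "leads T a \<longleftrightarrow> (\<forall>f e. peak f e \<longrightarrow> peak (app T f) (e + a))"

lemma leads_mult: "leads S a \<Longrightarrow> leads T b \<Longrightarrow> leads (S * T) (b + a)"
  unfolding leads_def by (simp add: add.assoc[symmetric])

lemma leads_one: "leads 1 0" by (simp add: leads_def)

lemma leads_dilation: "a \<noteq> 0 \<Longrightarrow> leads (dilation a v) 0"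
  by (simp add: leads_def peak_def dilation.rep_eq)

lemma leads_shift: "leads (shift v) (unit v)"
  unfolding leads_def
proof (intro allI impI)
  fix f :: "('v \<Rightarrow> int) \<Rightarrow> complex" and e assume p: "peak f e"
  show "peak (app (shift v) f) (e + unit v)"
    unfolding peak_def
  proof (intro conjI allI impI)
    show "app (shift v) f (e + unit v) \<noteq> 0" using p by (simp add: shift_app peak_def)
    fix d assume d: "app (shift v) f d \<noteq> 0"
    have eq: "d = (d - unit v) + unit v" by simp
    from d have "f (d - unit v) \<noteq> 0" by (metis eq shift_app)
    then have "d - unit v = e \<or> weight (d - unit v) < weight e" using p by (simp add: peak_def)
    then show "d = e + unit v \<or> weight d < weight (e + unit v)"
      using weight_add[of "d - unit v" "unit v"] weight_add[of e "unit v"] by auto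
  qed
qed

lemma leads_add:
  assumes "leads S a" "leads T b" "weight b < weight a"
  shows "leads (S + T) a"
  unfolding leads_def
proof (intro allI impI)
  fix f :: "('v \<Rightarrow> int) \<Rightarrow> complex" and e assume "peak f e"
  then have S: "peak (app S f) (e + a)" and T: "peak (app T f) (e + b)"
    using assms by (auto simp: leads_def)
  have lt: "weight (e + b) < weight (e + a)" using assms(3) by (simp add: weight_add)
  have "app T f (e + a) = 0" using T lt unfolding peak_def by (metis less_asym' less_irrefl)
  then show "peak (app (S + T) f) (e + a)"
    using S T lt unfolding peak_def app_simps by (metis add_cancel_right_right less_trans add_0)
qed

lemma leads_prod_list:
  "(\<And>x. x \<in> set xs \<Longrightarrow> leads (F x) (E x)) \<Longrightarrow> leads (prod_list (map F xs)) (sum_list (map E xs))"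
  by (induction xs) (simp_all add: leads_one leads_mult add.commute[of "E _"])

text \<open>
  All operators are applied to the monomial with exponent zero. Among the terms with nonzero
  coefficient choose one whose exponent has the largest weight: every other term vanishes at this exponent,
  since its own leading exponent is a different one and its lower terms have smaller weight.
\<close>

lemma leads_independent:
  assumes "finite I" and lead: "\<And>i. i \<in> I \<Longrightarrow> leads (T i) (a i)" and inj: "inj_on a I"
    and zero: "(\<Sum>i\<in>I. const_op (c i) * T i) = 0" and i: "i \<in> I"
  shows "c i = 0"
proof (rule ccontr)
  assume ci: "c i \<noteq> 0"
  define J where "J = {i \<in> I. c i \<noteq> 0}"
  have J: "finite J" "J \<noteq> {}" using assms(1) i ci by (auto simp: J_def)
  define m where "m = Max ((\<lambda>i. weight (a i)) ` J)"
  have "m \<in> (\<lambda>i. weight (a i)) ` J" unfolding m_def using J by (intro Max_in) auto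
  then obtain k where k: "k \<in> J" "weight (a k) = m" by auto
  have max: "weight (a j) \<le> weight (a k)" if "j \<in> J" for j
    unfolding k(2) m_def using J that by (intro Max_ge) auto
  define f :: "('v \<Rightarrow> int) \<Rightarrow> complex" where "f = (\<lambda>e. if e = 0 then 1 else 0)"
  have "peak f 0" by (auto simp: peak_def f_def)
  then have p: "peak (app (T j) f) (a j)" if "j \<in> I" for j
    using lead[OF that] unfolding leads_def by (metis add_0)
  have z: "c j * app (T j) f (a k) = 0" if "j \<in> I" "j \<noteq> k" for j
  proof (cases "j \<in> J")
    case True
    have "a k \<noteq> a j" using inj that k(1) by (auto simp: inj_on_def J_def)
    then show ?thesis using p[OF that(1)] max[OF True] by (force simp: peak_def)
  qed (use that in \<open>simp add: J_def\<close>)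
  have "app (\<Sum>i\<in>I'. const_op (c i) * T i) f e = (\<Sum>i\<in>I'. c i * app (T i) f e)" for I' e
    by (induction I' rule: infinite_finite_induct) (simp_all add: const_op.rep_eq)
  then have "(\<Sum>i\<in>I. c i * app (T i) f (a k)) = 0"
    using zero by (metis app_simps(1))
  moreover have "(\<Sum>i\<in>I. c i * app (T i) f (a k)) = (\<Sum>i\<in>{k}. c i * app (T i) f (a k))"
    using assms(1) k(1) z by (intro sum.mono_neutral_right) (auto simp: J_def)
  ultimately have "c k * app (T k) f (a k) = 0" by simp
  then show False using p[of k] k(1) by (simp add: J_def peak_def)
qed

end

context q_scalars
begin

definition pairing :: "nat \<Rightarrow> (nat \<Rightarrow> 'b) \<Rightarrow> (nat \<Rightarrow> 'b) \<Rightarrow> 'b" where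
  "pairing n x y = (\<Sum>k = 1..n. x (2*k-1) * y (2*k) - Q * (x (2*k) * y (2*k-1)))"

lemma symplectic_pairing: "symplectic n X i j = pairing n (X i) (X j)"
  by (simp add: symplectic_def pairing_def)

lemma pairing_add: "pairing n (\<lambda>c. x c + x' c) y = pairing n x y + pairing n x' y"
  "pairing n x (\<lambda>c. y c + y' c) = pairing n x y + pairing n x y'"
  by (simp_all add: pairing_def sum.distrib[symmetric] algebra_simps)

lemma pairing_left: "pairing n (\<lambda>c. a * x c) y = a * pairing n x y"
proof -
  have "Q * (a * x) = a * (Q * x)" for x
    by (metis Q_central mult.assoc)
  then show ?thesis by (simp add: pairing_def sum_distrib_left right_diff_distrib mult.assoc)
qed

lemma pairing_right:
  assumes "\<And>c. x c * b = b * x c"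
  shows "pairing n x (\<lambda>c. b * y c) = b * pairing n x y"
proof -
  have "x c * (b * z) = b * (x c * z)" "Q * (b * z) = b * (Q * z)" for c z
    by (metis assms mult.assoc) (metis Q_central mult.assoc)
  then show ?thesis by (simp add: pairing_def sum_distrib_left right_diff_distrib)
qed

text \<open>
  The form is bilinear in the rows, as the coefficients of the row operation commute with the
  entries of the matrix.
\<close>

lemma symplectic_row_step:
  assumes cen: "\<And>i c. X i c * t = t * X i c" "\<And>i c. X i c * k = k * X i c" "\<And>i c. X i c * k' = k' * X i c"
  shows "i \<noteq> r \<Longrightarrow> i \<noteq> Suc r \<Longrightarrow> j \<noteq> r \<Longrightarrow> j \<noteq> Suc r \<Longrightarrow> symplectic n (row_step r t k k' X) i j = symplectic n X i j"
    and "j \<noteq> r \<Longrightarrow> j \<noteq> Suc r \<Longrightarrow> symplectic n (row_step r t k k' X) r j = k * symplectic n X r j"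
    and "i \<noteq> r \<Longrightarrow> i \<noteq> Suc r \<Longrightarrow> symplectic n (row_step r t k k' X) i r = k * symplectic n X i r"
    and "symplectic n X r r = 0 \<Longrightarrow> symplectic n (row_step r t k k' X) r (Suc r) = k * (k' * symplectic n X r (Suc r))"
    and "j \<noteq> r \<Longrightarrow> j \<noteq> Suc r \<Longrightarrow>
      symplectic n (row_step r t k k' X) (Suc r) j = k' * symplectic n X (Suc r) j + t * symplectic n X r j"
    and "i \<noteq> r \<Longrightarrow> i \<noteq> Suc r \<Longrightarrow>
      symplectic n (row_step r t k k' X) i (Suc r) = k' * symplectic n X i (Suc r) + t * symplectic n X i r"
proof -
  have rows: "row_step r t k k' X r = (\<lambda>c. k * X r c)"
    "row_step r t k k' X (Suc r) = (\<lambda>c. k' * X (Suc r) c + t * X r c)"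
    "row_step r t k k' X i = X i" if "i \<noteq> r" "i \<noteq> Suc r" for i
    using that by (simp_all add: row_step_def fun_eq_iff)
  have rows': "row_step r t k k' X r = (\<lambda>c. k * X r c)"
    "row_step r t k k' X (Suc r) = (\<lambda>c. k' * X (Suc r) c + t * X r c)"
    by (simp_all add: row_step_def fun_eq_iff)
  note sim = symplectic_pairing rows' rows(3) pairing_add pairing_left pairing_right cen
  show "i \<noteq> r \<Longrightarrow> i \<noteq> Suc r \<Longrightarrow> j \<noteq> r \<Longrightarrow> j \<noteq> Suc r \<Longrightarrow> symplectic n (row_step r t k k' X) i j = symplectic n X i j"
    and "j \<noteq> r \<Longrightarrow> j \<noteq> Suc r \<Longrightarrow> symplectic n (row_step r t k k' X) r j = k * symplectic n X r j"
    and "i \<noteq> r \<Longrightarrow> i \<noteq> Suc r \<Longrightarrow> symplectic n (row_step r t k k' X) i r = k * symplectic n X i r"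
    and "symplectic n X r r = 0 \<Longrightarrow> symplectic n (row_step r t k k' X) r (Suc r) = k * (k' * symplectic n X r (Suc r))"
    and "j \<noteq> r \<Longrightarrow> j \<noteq> Suc r \<Longrightarrow>
      symplectic n (row_step r t k k' X) (Suc r) j = k' * symplectic n X (Suc r) j + t * symplectic n X r j"
    and "i \<noteq> r \<Longrightarrow> i \<noteq> Suc r \<Longrightarrow>
      symplectic n (row_step r t k k' X) i (Suc r) = k' * symplectic n X i (Suc r) + t * symplectic n X i r"
    by (simp_all add: sim)
qed

end

section \<open>A quantum matrix with independent leading exponents\<close>

text \<open>
  Put \<open>N = 2n\<close>. The matrix starts as the diagonal matrix with entries \<open>Scale 1, 1, Scale 3, 1, ...\<close>,
  so that at first only \<open>w p (p + 1)\<close> for odd \<open>p\<close> is nonzero. For each odd \<open>p\<close>, in decreasing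
  order, there are two sweeps of elementary row operations. The first one uses \<open>Sweep1 p r\<close> to add
  row \<open>r\<close> to row \<open>r + 1\<close> for \<open>r = p + 1, ..., N - 1\<close>, the second one uses \<open>Sweep2 p r\<close> for
  \<open>r = p, ..., N - 2\<close>. In total there are \<open>n (2n - 1)\<close> variables, one for each pair \<open>i < j\<close>.

  The first sweep makes \<open>w p j\<close> nonzero for all \<open>j > p\<close>, and the first operation of the second sweep
  copies these values to row \<open>p + 1\<close>. The remaining operations of the second sweep replace the
  leading monomials of \<open>w p j\<close> for \<open>p + 1 < j < N\<close> and no others. For \<open>p + 1 < i < j\<close> the leading
  monomial of \<open>w i j\<close> stays the same, as the monomials that stage \<open>p\<close> adds have much smaller weight.
\<close>

datatype var = Scale nat | Sweep1 nat nat | Sweep2 nat nat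

type_synonym mop = "(var \<Rightarrow> int) op"

locale skew_model =
  fixes q :: complex and n :: nat
  assumes q_nonzero: "q \<noteq> 0"
begin

sublocale q_scalars "const_op q :: 'e op" "const_op (inverse q)"
proof
  show "const_op q * const_op (inverse q) = (1 :: 'e op)"
    by (simp only: const_op_hom(2)[symmetric] right_inverse[OF q_nonzero] const_op_hom(3))
qed (rule const_op_central)

definition N :: nat where "N = 2 * n"
text \<open>
  The nonzero weights at stage \<open>p\<close> have the order of magnitude \<open>penalty p\<close>, which dominates the weights of
  all leading exponents of the stages after \<open>p\<close>, that is, of larger indices.
\<close>

definition base :: int where "base = 4 * int N + 8"
definition penalty :: "nat \<Rightarrow> int" where "penalty p = base ^ (N - p)"

definition V :: "var set" where
  "V = Scale ` {..N} \<union> (\<lambda>(p, r). Sweep1 p r) ` ({..N} \<times> {..N}) \<union> (\<lambda>(p, r). Sweep2 p r) ` ({..N} \<times> {..N})"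

text \<open>
  The last two cases for \<open>Sweep2\<close> decide the competition inside stage \<open>p\<close>. In \<open>w p j\<close> with
  \<open>j < N\<close> the product of \<open>Sweep2\<close> variables wins, because of the bonus \<open>2N\<close> on \<open>Sweep2 p (p + 1)\<close>,
  which outweighs the at most \<open>N\<close> later losses by \<open>1\<close>. In \<open>w (p + 1) j\<close> that bonus is not available
  and \<open>Sweep1\<close> wins, since its variables are heavier by \<open>1\<close>.
\<close>

fun wt :: "var \<Rightarrow> int" where
  "wt (Scale p) = - penalty p"
| "wt (Sweep1 p r) = - penalty p"
| "wt (Sweep2 p r) = (if r \<le> p then 0 else if r = Suc p then 2 * int N - penalty p else - penalty p - 1)"

sublocale weighted_vars V wt
  by unfold_locales (simp add: V_def)

text \<open>
  The leading exponent of \<open>w i j\<close>, for \<open>i < j\<close>, after all stages. For odd \<open>i\<close> the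
  variables \<open>Sweep2\<close> cannot reach \<open>j = N\<close>, as the second sweep stops one row earlier.
\<close>

definition exponent :: "nat \<Rightarrow> nat \<Rightarrow> var \<Rightarrow> int" where
  "exponent i j = (if odd i
      then unit (Scale i) + (\<Sum>r = Suc i..<j. unit (if j < N then Sweep2 i r else Sweep1 i r))
      else unit (Scale (i-1)) + (\<Sum>r = i..<j. unit (Sweep1 (i-1) r)) + unit (Sweep2 (i-1) (i-1)))"

text \<open>
  The operator does not involve the variable \<open>v\<close>.
\<close>

definition free :: "var \<Rightarrow> mop \<Rightarrow> bool" where
  "free v Z \<longleftrightarrow> Z * shift v = shift v * Z \<and> (\<forall>a. Z * dilation a v = dilation a v * Z)"

lemma free_zero: "free v 0" and free_one: "free v 1"
  by (simp_all add: free_def)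

lemma free_add: "free v X \<Longrightarrow> free v Y \<Longrightarrow> free v (X + Y)"
  by (simp add: free_def distrib_left distrib_right)

lemma free_mult: "free v X \<Longrightarrow> free v Y \<Longrightarrow> free v (X * Y)"
  unfolding free_def by (metis mult.assoc)

lemma free_shift: "u \<noteq> v \<Longrightarrow> free u (shift v)"
  by (simp add: free_def shift_shift[of v u] dilation_shift_other)

lemma free_dilation: "u \<noteq> v \<Longrightarrow> free u (dilation a v)"
  by (simp add: free_def dilation_shift_other[symmetric] dilation_dilation[of _ v _ u])

abbreviation step :: "nat \<Rightarrow> var \<Rightarrow> (nat \<Rightarrow> nat \<Rightarrow> mop) \<Rightarrow> nat \<Rightarrow> nat \<Rightarrow> mop" where
  "step r v \<equiv> row_step r (shift v) (dilation q v) (dilation (inverse q) v)"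

lemma free_step:
  assumes "\<And>i c. free u (X i c)" "u \<noteq> v"
  shows "free u (step r v X i c)"
  unfolding row_step_def using assms
  by (simp add: free_mult free_add free_shift free_dilation)

abbreviation q_matrix :: "(nat \<Rightarrow> nat \<Rightarrow> mop) \<Rightarrow> bool" where
  "q_matrix \<equiv> quantum_matrix (const_op q) (const_op (inverse q))"

context
  fixes X :: "nat \<Rightarrow> nat \<Rightarrow> mop" and v :: var
  assumes X: "q_matrix X" and free: "\<And>i c. free v (X i c)"
begin

lemma step_q_matrix: "q_matrix (step r v X)"
proof (rule quantum_matrix_row_step[OF X])
  show "X i c * shift v = shift v * X i c" for i c
    using free[of i c] by (simp add: free_def)
  show "X i c * dilation q v = dilation q v * X i c" for i c
    using free[of i c] by (simp add: free_def)
  show "X i c * dilation (inverse q) v = dilation (inverse q) v * X i c" for i c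
    using free[of i c] by (simp add: free_def)
  show "dilation q v * shift v = const_op q * (shift v * dilation q v)"
    "dilation (inverse q) v * shift v = const_op (inverse q) * (shift v * dilation (inverse q) v)"
    using q_nonzero by (simp_all only: dilation_shift nonzero_imp_inverse_nonzero not_False_eq_True)
qed (rule dilation_dilation)

lemma symplectic_step:
  shows "i \<noteq> r \<Longrightarrow> i \<noteq> Suc r \<Longrightarrow> j \<noteq> r \<Longrightarrow> j \<noteq> Suc r \<Longrightarrow> symplectic n (step r v X) i j = symplectic n X i j"
    and "j \<noteq> r \<Longrightarrow> j \<noteq> Suc r \<Longrightarrow> symplectic n (step r v X) r j = dilation q v * symplectic n X r j"
    and "i \<noteq> r \<Longrightarrow> i \<noteq> Suc r \<Longrightarrow> symplectic n (step r v X) i r = dilation q v * symplectic n X i r"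
    and "symplectic n (step r v X) r (Suc r)
       = dilation q v * (dilation (inverse q) v * symplectic n X r (Suc r))"
    and "j \<noteq> r \<Longrightarrow> j \<noteq> Suc r \<Longrightarrow> symplectic n (step r v X) (Suc r) j
       = dilation (inverse q) v * symplectic n X (Suc r) j + shift v * symplectic n X r j"
    and "i \<noteq> r \<Longrightarrow> i \<noteq> Suc r \<Longrightarrow> symplectic n (step r v X) i (Suc r)
       = dilation (inverse q) v * symplectic n X i (Suc r) + shift v * symplectic n X i r"
proof -
  have "X i c * shift v = shift v * X i c" "X i c * dilation a v = dilation a v * X i c" for i c a
    using free[of i c] by (simp_all add: free_def)
  note st = symplectic_row_step[of X "shift v" "dilation q v" "dilation (inverse q) v", OF this(1,2,2)]
  show "i \<noteq> r \<Longrightarrow> i \<noteq> Suc r \<Longrightarrow> j \<noteq> r \<Longrightarrow> j \<noteq> Suc r \<Longrightarrow> symplectic n (step r v X) i j = symplectic n X i j"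
    and "j \<noteq> r \<Longrightarrow> j \<noteq> Suc r \<Longrightarrow> symplectic n (step r v X) r j = dilation q v * symplectic n X r j"
    and "i \<noteq> r \<Longrightarrow> i \<noteq> Suc r \<Longrightarrow> symplectic n (step r v X) i r = dilation q v * symplectic n X i r"
    and "j \<noteq> r \<Longrightarrow> j \<noteq> Suc r \<Longrightarrow> symplectic n (step r v X) (Suc r) j
       = dilation (inverse q) v * symplectic n X (Suc r) j + shift v * symplectic n X r j"
    and "i \<noteq> r \<Longrightarrow> i \<noteq> Suc r \<Longrightarrow> symplectic n (step r v X) i (Suc r)
       = dilation (inverse q) v * symplectic n X i (Suc r) + shift v * symplectic n X i r"
    by (rule st; assumption)+
  show "symplectic n (step r v X) r (Suc r) = dilation q v * (dilation (inverse q) v * symplectic n X r (Suc r))"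
    by (rule st(4)) (rule quantum_antisymD(1)[OF symplectic_antisym[OF X]])
qed

text \<open>
  Only pairs of rows with exactly one index \<open>r + 1\<close> and the other index different from \<open>r\<close> gain a
  new summand. The pair \<open>r, r + 1\<close> does not, because the pairing of a row with itself is zero.
\<close>

lemma step_unchanged:
  assumes "i < j" "i = r \<and> j = Suc r \<or> i \<noteq> Suc r \<and> j \<noteq> Suc r"
  obtains D where "leads D 0" "symplectic n (step r v X) i j = D * symplectic n X i j"
proof -
  have D: "leads (dilation q v) 0" "leads (dilation (inverse q) v) 0"
    using q_nonzero by (simp_all add: leads_dilation)
  show ?thesis
  proof (cases "i = r")
    case True
    show ?thesis
    proof (cases "j = Suc r")
      case True
      have "leads (dilation q v * dilation (inverse q) v) 0"
        using leads_mult[OF D] by simp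
      then show ?thesis by (rule that) (use \<open>i = r\<close> True in \<open>simp add: symplectic_step(4) mult.assoc\<close>)
    next
      case False
      show ?thesis by (rule that[OF D(1)]) (use True False assms in \<open>simp add: symplectic_step(2)\<close>)
    qed
  next
    case i: False
    show ?thesis
    proof (cases "j = r")
      case True
      show ?thesis by (rule that[OF D(1)]) (use True i assms in \<open>simp add: symplectic_step(3)\<close>)
    next
      case False
      show ?thesis by (rule that[OF leads_one]) (use False i assms in \<open>simp add: symplectic_step(1)\<close>)
    qed
  qed
qed

lemma step_unchanged_leads:
  assumes "i < j" "i = r \<and> j = Suc r \<or> i \<noteq> Suc r \<and> j \<noteq> Suc r"
  shows "leads (symplectic n X i j) a \<Longrightarrow> leads (symplectic n (step r v X) i j) a"
    and "symplectic n X i j = 0 \<Longrightarrow> symplectic n (step r v X) i j = 0"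
proof -
  obtain D where D: "leads D 0" "symplectic n (step r v X) i j = D * symplectic n X i j"
    using step_unchanged[OF assms] by blast
  show "leads (symplectic n X i j) a \<Longrightarrow> leads (symplectic n (step r v X) i j) a"
    using leads_mult[OF D(1), of _ a] D(2) by simp
  show "symplectic n X i j = 0 \<Longrightarrow> symplectic n (step r v X) i j = 0"
    using D(2) by simp
qed

text \<open>
  Here \<open>i', j'\<close> is the pair \<open>i, j\<close> with \<open>r + 1\<close> replaced by \<open>r\<close>.
\<close>

lemma symplectic_step_changed:
  assumes "i < j" "i \<noteq> r \<or> j \<noteq> Suc r" "i = Suc r \<and> (i', j') = (r, j) \<or> j = Suc r \<and> (i', j') = (i, r)"
  shows "symplectic n (step r v X) i j = dilation (inverse q) v * symplectic n X i j + shift v * symplectic n X i' j'"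
  using assms symplectic_step(5)[of j r] symplectic_step(6)[of i r] by auto

text \<open>
  In the sum of an old and a new summand the heavier one determines the leading exponent: the old
  one here, the new one in the next lemma.
\<close>

lemma step_keep:
  assumes ch: "i < j" "i \<noteq> r \<or> j \<noteq> Suc r" "i = Suc r \<and> (i', j') = (r, j) \<or> j = Suc r \<and> (i', j') = (i, r)"
    and "v \<in> V" "leads (symplectic n X i j) a"
    and "symplectic n X i' j' = 0 \<or> (\<exists>b. leads (symplectic n X i' j') b \<and> weight b + wt v < weight a)"
  shows "leads (symplectic n (step r v X) i j) a"
proof -
  have a: "leads (dilation (inverse q) v * symplectic n X i j) a"
    using leads_mult[OF leads_dilation assms(5), of "inverse q" v] q_nonzero by simp
  from assms(6) show ?thesis
  proof
    assume "symplectic n X i' j' = 0"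
    then show ?thesis using a symplectic_step_changed[OF ch] by simp
  next
    assume "\<exists>b. leads (symplectic n X i' j') b \<and> weight b + wt v < weight a"
    then obtain b where "leads (symplectic n X i' j') b" and b: "weight b + wt v < weight a" by blast
    then have "leads (shift v * symplectic n X i' j') (b + unit v)"
      by (intro leads_mult leads_shift)
    then show ?thesis unfolding symplectic_step_changed[OF ch]
      by (rule leads_add[OF a]) (use b \<open>v \<in> V\<close> in \<open>simp only: weight_add weight_unit\<close>)
  qed
qed

lemma step_switch:
  assumes ch: "i < j" "i \<noteq> r \<or> j \<noteq> Suc r" "i = Suc r \<and> (i', j') = (r, j) \<or> j = Suc r \<and> (i', j') = (i, r)"
    and "v \<in> V" "leads (symplectic n X i' j') b"
    and "symplectic n X i j = 0 \<or> (\<exists>a. leads (symplectic n X i j) a \<and> weight a < weight b + wt v)"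
  shows "leads (symplectic n (step r v X) i j) (b + unit v)"
proof -
  have b: "leads (shift v * symplectic n X i' j') (b + unit v)"
    by (intro leads_mult leads_shift assms)
  from assms(6) show ?thesis
  proof
    assume "symplectic n X i j = 0"
    then show ?thesis using b symplectic_step_changed[OF ch] by simp
  next
    assume "\<exists>a. leads (symplectic n X i j) a \<and> weight a < weight b + wt v"
    then obtain a where "leads (symplectic n X i j) a" and a: "weight a < weight b + wt v" by blast
    then have "leads (dilation (inverse q) v * symplectic n X i j) a"
      using leads_mult[OF leads_dilation, of "inverse q" "symplectic n X i j" a v] q_nonzero by simp
    then show ?thesis unfolding symplectic_step_changed[OF ch] add.commute[of "dilation _ _ * _"]
      by (rule leads_add[OF b]) (use a \<open>v \<in> V\<close> in \<open>simp only: weight_add weight_unit\<close>)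
  qed
qed

end

lemma base_ge: "base \<ge> 4 * int N + 8" by (simp add: base_def)

lemma penalty_pos: "penalty p \<ge> 1" using base_ge by (simp add: penalty_def one_le_power)

lemma penalty_antimono: "p \<le> p' \<Longrightarrow> penalty p' \<le> penalty p"
  unfolding penalty_def using base_ge by (intro power_increasing) auto

definition weight_bound :: "nat \<Rightarrow> int" where "weight_bound p = (penalty p + 1) * (int N + 1)"

text \<open>
  The number \<open>weight_bound (p + 2)\<close> bounds the weights of the leading exponents of all pairs of
  indices larger than \<open>p + 1\<close>, see \<open>exponent_bound\<close> below.
\<close>

lemma penalty_dominates:
  assumes "p + 2 \<le> N"
  shows "2 * weight_bound (p + 2) + 2 * int N + 2 < penalty p"
proof -
  have "N - p = Suc (Suc (N - (p + 2)))" using assms by simp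
  then have "penalty p = base * (base * penalty (p + 2))" by (simp add: penalty_def)
  moreover have "base * (base * penalty (p+2)) \<ge> 2 * (base * penalty (p+2))"
    using base_ge penalty_pos[of "p+2"] by (intro mult_right_mono) auto
  moreover have "base * penalty (p+2) \<ge> (4 * int N + 8) * penalty (p+2)"
    using base_ge penalty_pos[of "p+2"] by (intro mult_right_mono) auto
  moreover have "int N * penalty (p+2) \<ge> int N * 1" using penalty_pos[of "p+2"] by (intro mult_left_mono) auto
  ultimately show ?thesis using penalty_pos[of "p+2"] unfolding weight_bound_def by (simp add: algebra_simps)
qed

text \<open>
  The leading exponent of \<open>w p j\<close> after the first sweep of stage \<open>p\<close>.
\<close>

definition sweep1_exponent :: "nat \<Rightarrow> nat \<Rightarrow> var \<Rightarrow> int" where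
  "sweep1_exponent p j = unit (Scale p) + (\<Sum>r = Suc p..<j. unit (Sweep1 p r))"

lemma weight_units:
  "p \<le> N \<Longrightarrow> weight (unit (Scale p)) = - penalty p"
  "p \<le> N \<Longrightarrow> r \<le> N \<Longrightarrow> weight (unit (Sweep1 p r)) = - penalty p"
  "p \<le> N \<Longrightarrow> r \<le> N \<Longrightarrow> weight (unit (Sweep2 p r)) = wt (Sweep2 p r)"
  by (subst weight_unit; force simp: V_def)+

lemma weight_sweep1_exponent:
  assumes "p < j" "j \<le> N"
  shows "weight (sweep1_exponent p j) = - penalty p * int (j - p)"
proof -
  have "weight (sweep1_exponent p j) = - penalty p + (\<Sum>r = Suc p..<j. - penalty p)"
    using assms by (simp add: sweep1_exponent_def weight_add weight_sum weight_units del: sum_constant)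
  then show ?thesis using assms by (simp add: of_nat_diff algebra_simps)
qed

lemma exponent_even: "odd p \<Longrightarrow> exponent (Suc p) j = sweep1_exponent p j + unit (Sweep2 p p)"
  by (simp add: exponent_def sweep1_exponent_def)

lemma weight_exponent_even:
  assumes "odd p" "Suc p < j" "j \<le> N"
  shows "weight (exponent (Suc p) j) = - penalty p * int (j - p)"
  using assms by (simp add: exponent_even weight_add weight_sweep1_exponent weight_units)

lemma exponent_odd:
  assumes "odd p"
  shows "j < N \<Longrightarrow> exponent p j = unit (Scale p) + (\<Sum>r = Suc p..<j. unit (Sweep2 p r))" "exponent p N = sweep1_exponent p N"
  using assms by (simp_all add: exponent_def sweep1_exponent_def)

lemma weight_exponent_odd_first:
  assumes "odd p" "Suc p \<le> N"
  shows "weight (exponent p (Suc p)) = - penalty p"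
  using assms by (simp add: exponent_def weight_add weight_zero weight_units)

lemma weight_exponent_odd:
  assumes "odd p" "Suc p < j" "j < N"
  shows "weight (exponent p j) = - (penalty p + 1) * int (j - p) + 2 * int N + 2"
proof -
  have "(\<Sum>r = Suc p..<j. wt (Sweep2 p r)) = wt (Sweep2 p (Suc p)) + (\<Sum>r = Suc (Suc p)..<j. - penalty p - 1)"
    using assms by (subst sum.atLeast_Suc_lessThan) auto
  moreover have "wt (Sweep2 p (Suc p)) = 2 * int N - penalty p" by simp
  ultimately have "weight (exponent p j) = - penalty p + (2 * int N - penalty p) + (\<Sum>r = Suc (Suc p)..<j. - penalty p - 1)"
    using assms by (simp add: exponent_odd weight_add weight_sum weight_units del: sum_constant wt.simps)
  then show ?thesis using assms by (simp add: of_nat_diff algebra_simps)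
qed

lemma exponent_bound:
  assumes "odd p" "p \<le> i" "i < j" "j \<le> N"
  shows "\<bar>weight (exponent i j)\<bar> \<le> weight_bound p"
proof -
  have big: "\<bar>a\<bar> \<le> weight_bound p" if "- (penalty p' + 1) * (int N + 1) \<le> a" "a \<le> 2 * int N + 2" "p \<le> p'" for a p'
  proof -
    have "(penalty p' + 1) * (int N + 1) \<le> weight_bound p"
      unfolding weight_bound_def using penalty_antimono[OF that(3)] by (intro mult_right_mono) auto
    moreover have "2 * (int N + 1) \<le> weight_bound p"
      unfolding weight_bound_def using penalty_pos[of p] by (intro mult_right_mono) auto
    ultimately show ?thesis using that by (simp add: algebra_simps)
  qed
  have sweep1_exponent: "\<bar>- penalty p' * int (j - p')\<bar> \<le> weight_bound p" if "p \<le> p'" "p' < j" for p'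
  proof (rule big[OF _ _ that(1)])
    have "penalty p' * int (j - p') \<le> penalty p' * (int N + 1)"
      using penalty_pos[of p'] assms by (intro mult_left_mono) auto
    then show "- (penalty p' + 1) * (int N + 1) \<le> - penalty p' * int (j - p')" by (simp add: algebra_simps)
    have "0 \<le> penalty p' * int (j - p')" using penalty_pos[of p'] by simp
    then show "- penalty p' * int (j - p') \<le> 2 * int N + 2" by linarith
  qed
  show ?thesis
  proof (cases "odd i")
    case i: True
    consider "j = N" | "j = Suc i" | "j < N" "Suc i < j" using assms by linarith
    then show ?thesis
    proof cases
      case 1
      then show ?thesis using sweep1_exponent[of i] assms i by (simp add: exponent_odd weight_sweep1_exponent)
    next
      case 2
      then show ?thesis using sweep1_exponent[of i] assms i by (simp add: weight_exponent_odd_first)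
    next
      case 3
      have "(penalty i + 1) * int (j - i) \<le> (penalty i + 1) * (int N + 1)"
        using penalty_pos[of i] assms by (intro mult_left_mono) auto
      moreover have "0 \<le> (penalty i + 1) * int (j - i)" using penalty_pos[of i] by simp
      ultimately show ?thesis unfolding weight_exponent_odd[OF i 3(2,1)]
        by (intro big[OF _ _ assms(2)]) linarith+
    qed
  next
    case False
    then obtain p' where p': "i = Suc p'" "odd p'" using assms by (cases i) auto
    moreover have "p \<le> p'" using p' assms(1,2) by (cases "p = Suc p'") auto
    ultimately show ?thesis using sweep1_exponent[of p'] assms by (simp add: weight_exponent_even)
  qed
qed

definition start :: "nat \<Rightarrow> mop" where
  "start i = (if odd i then shift (Scale i) else 1)"

text \<open>
  The state of the construction while rows with index at least \<open>p\<close> are processed: the variables in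
  \<open>F\<close> have not been used, the rows before \<open>p\<close> are still those of the diagonal matrix, and \<open>L\<close> describes
  what is known of each \<open>w i j\<close>.
\<close>

definition stage :: "nat \<Rightarrow> var set \<Rightarrow> (nat \<Rightarrow> nat \<Rightarrow> mop \<Rightarrow> bool) \<Rightarrow> (nat \<Rightarrow> nat \<Rightarrow> mop) \<Rightarrow> bool" where
  "stage p F L X \<longleftrightarrow> q_matrix X \<and> (\<forall>v\<in>F. \<forall>i c. free v (X i c)) \<and>
     (\<forall>i<p. \<forall>c. X i c = (if i = c then start i else 0)) \<and> (\<forall>i\<ge>p. \<forall>c<p. X i c = 0) \<and>
     (\<forall>i j. p \<le> i \<longrightarrow> i < j \<longrightarrow> j \<le> N \<longrightarrow> L i j (symplectic n X i j))"

definition fresh :: "nat \<Rightarrow> var set" where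
  "fresh p = {Sweep1 p' r | p' r. p' < p} \<union> {Sweep2 p' r | p' r. p' < p}"

lemma stage_step:
  assumes "stage p F L X" "v \<in> F" "p \<le> r" "v \<notin> F'" "F' \<subseteq> F"
    and "\<And>i j. q_matrix X \<Longrightarrow> (\<And>i c. free v (X i c)) \<Longrightarrow>
      (\<And>i j. p \<le> i \<Longrightarrow> i < j \<Longrightarrow> j \<le> N \<Longrightarrow> L i j (symplectic n X i j)) \<Longrightarrow>
      p \<le> i \<Longrightarrow> i < j \<Longrightarrow> j \<le> N \<Longrightarrow> L' i j (symplectic n (step r v X) i j)"
  shows "stage p F' L' (step r v X)"
proof -
  note st = assms(1)[unfolded stage_def]
  have X: "q_matrix X" and free: "\<And>u i c. u \<in> F \<Longrightarrow> free u (X i c)" using st by auto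
  show ?thesis unfolding stage_def
  proof (intro conjI ballI allI impI)
    show "q_matrix (step r v X)" using free assms(2) by (intro step_q_matrix X) auto
    show "free u (step r v X i c)" if "u \<in> F'" for u i c
      using that assms by (intro free_step free) auto
    show "step r v X i c = (if i = c then start i else 0)" if "i < p" for i c
      using that st assms(3) by (simp add: row_step_def)
    show "step r v X i c = 0" if "p \<le> i" "c < p" for i c
      using that st assms(3) by (simp add: row_step_def)
    show "L' i j (symplectic n (step r v X) i j)" if "p \<le> i" "i < j" "j \<le> N" for i j
      by (rule assms(6)) (use that st free assms(2) in auto)
  qed
qed

text \<open>
  The knowledge about \<open>w i j\<close> when the first, respectively the second, sweep of stage \<open>p\<close> is about to
  add row \<open>R\<close> to row \<open>R + 1\<close>.
\<close>

definition sweep1_leads :: "nat \<Rightarrow> nat \<Rightarrow> nat \<Rightarrow> nat \<Rightarrow> mop \<Rightarrow> bool" where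
  "sweep1_leads p R i j Z \<longleftrightarrow>
     (if Suc p < i then leads Z (exponent i j) else if i = p \<and> j \<le> R then leads Z (sweep1_exponent p j) else Z = 0)"

definition sweep2_leads :: "nat \<Rightarrow> nat \<Rightarrow> nat \<Rightarrow> nat \<Rightarrow> mop \<Rightarrow> bool" where
  "sweep2_leads p R i j Z \<longleftrightarrow> leads Z (if i = p \<and> (R < j \<or> j = N) then sweep1_exponent p j else exponent i j)"

lemma inner_gap:
  assumes p: "odd p" and i: "p + 2 \<le> i" "i < j" "j \<le> N" and i': "p + 2 \<le> i'" "i' < j'" "j' \<le> N"
  shows "weight (exponent i' j') - penalty p < weight (exponent i j)"
proof -
  have "\<bar>weight (exponent i j)\<bar> \<le> weight_bound (p+2)" "\<bar>weight (exponent i' j')\<bar> \<le> weight_bound (p+2)"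
    using assms by (intro exponent_bound; simp)+
  moreover have "2 * weight_bound (p+2) + 2 * int N + 2 < penalty p"
    using assms by (intro penalty_dominates) simp
  ultimately show ?thesis by linarith
qed

text \<open>
  The operation turns \<open>w p (R + 1)\<close> from zero into \<open>Sweep1 p R * w p R\<close>. Row \<open>p + 1\<close> still pairs to
  zero with all later rows, and for pairs of later rows the new summand is too light to matter
  (\<open>inner_gap\<close>).
\<close>

lemma sweep1_step:
  assumes p: "odd p" "p < R" "R < N"
    and st: "stage p (fresh p \<union> {Sweep1 p r | r. R \<le> r} \<union> {Sweep2 p r | r. True}) (sweep1_leads p R) X"
  shows "stage p (fresh p \<union> {Sweep1 p r | r. Suc R \<le> r} \<union> {Sweep2 p r | r. True}) (sweep1_leads p (Suc R)) (step R (Sweep1 p R) X)"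
proof (rule stage_step[OF st])
  show "Sweep1 p R \<in> fresh p \<union> {Sweep1 p r |r. R \<le> r} \<union> {Sweep2 p r |r. True}" by blast
  show "p \<le> R" using p by simp
  show "Sweep1 p R \<notin> fresh p \<union> {Sweep1 p r |r. Suc R \<le> r} \<union> {Sweep2 p r |r. True}" by (auto simp: fresh_def)
  show "fresh p \<union> {Sweep1 p r |r. Suc R \<le> r} \<union> {Sweep2 p r |r. True} \<subseteq> fresh p \<union> {Sweep1 p r |r. R \<le> r} \<union> {Sweep2 p r |r. True}"
    by auto
  fix i j assume X: "q_matrix X" and free: "\<And>i c. free (Sweep1 p R) (X i c)"
    and L: "\<And>i j. p \<le> i \<Longrightarrow> i < j \<Longrightarrow> j \<le> N \<Longrightarrow> sweep1_leads p R i j (symplectic n X i j)"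
    and ij: "p \<le> i" "i < j" "j \<le> N"
  have V: "Sweep1 p R \<in> V" using p by (auto simp: V_def)
  have diag: "symplectic n X i i = 0" for i by (rule quantum_antisymD(1)[OF symplectic_antisym[OF X]])
  note unchanged = step_unchanged_leads[OF X free ij(2), of R]
  note keep = step_keep[OF X free ij(2) _ _ V]
  show "sweep1_leads p (Suc R) i j (symplectic n (step R (Sweep1 p R) X) i j)"
  proof (cases "i = R \<and> j = Suc R \<or> i \<noteq> Suc R \<and> j \<noteq> Suc R")
    case True
    show ?thesis
    proof (cases "i = p \<and> j = Suc R")
      case True
      then show ?thesis using \<open>i = R \<and> j = Suc R \<or> _\<close> p by auto
    next
      case False
      then show ?thesis using L[OF ij] unchanged[OF True] by (auto simp: sweep1_leads_def split: if_splits)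
    qed
  next
    case False
    then have ch: "i \<noteq> R \<or> j \<noteq> Suc R" by blast
    show ?thesis
    proof (cases "i = Suc R")
      case True
      have ch': "i = Suc R \<and> (R, j) = (R, j) \<or> j = Suc R \<and> (R, j) = (i, R)" using True by simp
      have "leads (symplectic n (step R (Sweep1 p R) X) i j) (exponent i j)"
      proof (rule keep[OF ch ch'])
        show "leads (symplectic n X i j) (exponent i j)" using L[OF ij] True p by (simp add: sweep1_leads_def)
        show "symplectic n X R j = 0 \<or> (\<exists>b. leads (symplectic n X R j) b \<and> weight b + wt (Sweep1 p R) < weight (exponent i j))"
        proof (cases "R = Suc p")
          case True
          then show ?thesis using L[of R j] \<open>i = Suc R\<close> ij by (simp add: sweep1_leads_def)
        next
          case False
          then have "leads (symplectic n X R j) (exponent R j)" using L[of R j] True ij p by (simp add: sweep1_leads_def)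
          moreover have "weight (exponent R j) + wt (Sweep1 p R) < weight (exponent i j)"
            using inner_gap[OF p(1), of i j R j] True False ij p by simp
          ultimately show ?thesis by blast
        qed
      qed
      then show ?thesis using True p by (simp add: sweep1_leads_def)
    next
      case iR: False
      then have j: "j = Suc R" and i: "i < R" using False ij by auto
      then have ch': "i = Suc R \<and> (i, R) = (R, j) \<or> j = Suc R \<and> (i, R) = (i, R)" by simp
      consider "i = p" | "i = Suc p" | "Suc p < i" using ij by linarith
      then show ?thesis
      proof cases
        case 1
        have "leads (symplectic n (step R (Sweep1 p R) X) i j) (sweep1_exponent p R + unit (Sweep1 p R))"
        proof (rule step_switch[OF X free ij(2) ch ch' V])
          show "leads (symplectic n X i R) (sweep1_exponent p R)" using L[of i R] 1 p by (simp add: sweep1_leads_def)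
          show "symplectic n X i j = 0 \<or> (\<exists>a. leads (symplectic n X i j) a \<and> weight a < weight (sweep1_exponent p R) + wt (Sweep1 p R))"
            using L[OF ij] 1 j by (simp add: sweep1_leads_def)
        qed
        moreover have "sweep1_exponent p R + unit (Sweep1 p R) = sweep1_exponent p j"
          using j p by (simp add: sweep1_exponent_def add.assoc)
        ultimately show ?thesis using 1 j by (simp add: sweep1_leads_def)
      next
        case 2
        have "symplectic n X i j = 0" using L[OF ij] 2 by (simp add: sweep1_leads_def)
        moreover have "symplectic n X i R = 0" using L[of i R] 2 i p by (simp add: sweep1_leads_def)
        ultimately have "symplectic n (step R (Sweep1 p R) X) i j = 0"
          using symplectic_step_changed[OF X free ij(2) ch ch'] by simp
        then show ?thesis using 2 by (simp add: sweep1_leads_def)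
      next
        case 3
        have "leads (symplectic n (step R (Sweep1 p R) X) i j) (exponent i j)"
        proof (rule keep[OF ch ch'])
          show "leads (symplectic n X i j) (exponent i j)" using L[OF ij] 3 by (simp add: sweep1_leads_def)
          have "leads (symplectic n X i R) (exponent i R)" using L[of i R] 3 i p by (simp add: sweep1_leads_def)
          moreover have "weight (exponent i R) + wt (Sweep1 p R) < weight (exponent i j)"
            using inner_gap[OF p(1), of i j i R] 3 i ij p by simp
          ultimately show "symplectic n X i R = 0 \<or> (\<exists>b. leads (symplectic n X i R) b \<and> weight b + wt (Sweep1 p R) < weight (exponent i j))"
            by blast
        qed
        then show ?thesis using 3 by (simp add: sweep1_leads_def)
      qed
    qed
  qed
qed

lemma sweep2_start:
  assumes p: "odd p" "Suc p < N"
    and st: "stage p (fresh p \<union> {Sweep2 p r | r. True}) (sweep1_leads p N) X"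
  shows "stage p (fresh p \<union> {Sweep2 p r | r. Suc p \<le> r}) (sweep2_leads p (Suc p)) (step p (Sweep2 p p) X)"
proof (rule stage_step[OF st])
  show "Sweep2 p p \<in> fresh p \<union> {Sweep2 p r |r. True}" by blast
  show "p \<le> p" by simp
  show "Sweep2 p p \<notin> fresh p \<union> {Sweep2 p r |r. Suc p \<le> r}" by (auto simp: fresh_def)
  show "fresh p \<union> {Sweep2 p r |r. Suc p \<le> r} \<subseteq> fresh p \<union> {Sweep2 p r |r. True}" by auto
  fix i j assume X: "q_matrix X" and free: "\<And>i c. free (Sweep2 p p) (X i c)"
    and L: "\<And>i j. p \<le> i \<Longrightarrow> i < j \<Longrightarrow> j \<le> N \<Longrightarrow> sweep1_leads p N i j (symplectic n X i j)"
    and ij: "p \<le> i" "i < j" "j \<le> N"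
  have V: "Sweep2 p p \<in> V" using p by (auto simp: V_def)
  note unchanged = step_unchanged_leads(1)[OF X free ij(2), of p]
  show "sweep2_leads p (Suc p) i j (symplectic n (step p (Sweep2 p p) X) i j)"
  proof (cases "i = Suc p")
    case True
    have ch: "i \<noteq> p \<or> j \<noteq> Suc p" "i = Suc p \<and> (p, j) = (p, j) \<or> j = Suc p \<and> (p, j) = (i, p)"
      using True by auto
    have "leads (symplectic n (step p (Sweep2 p p) X) i j) (sweep1_exponent p j + unit (Sweep2 p p))"
    proof (rule step_switch[OF X free ij(2) ch V])
      show "leads (symplectic n X p j) (sweep1_exponent p j)" using L[of p j] ij by (simp add: sweep1_leads_def)
      show "symplectic n X i j = 0 \<or> (\<exists>a. leads (symplectic n X i j) a \<and> weight a < weight (sweep1_exponent p j) + wt (Sweep2 p p))"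
        using L[OF ij] True by (simp add: sweep1_leads_def)
    qed
    then show ?thesis using True p by (simp add: sweep2_leads_def exponent_even)
  next
    case False
    then have "i = p \<and> j = Suc p \<or> i \<noteq> Suc p \<and> j \<noteq> Suc p" using ij by auto
    note u = unchanged[OF this]
    show ?thesis
    proof (cases "i = p")
      case True
      have "leads (symplectic n (step p (Sweep2 p p) X) i j) (sweep1_exponent p j)"
        using L[OF ij] True ij by (intro u) (simp add: sweep1_leads_def)
      moreover have "exponent p (Suc p) = sweep1_exponent p (Suc p)" using p by (simp add: exponent_def sweep1_exponent_def)
      moreover have "j = Suc p \<or> Suc p < j" using ij True by auto
      ultimately show ?thesis using True by (auto simp: sweep2_leads_def)
    next
      case False
      have "leads (symplectic n (step p (Sweep2 p p) X) i j) (exponent i j)"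
        using L[OF ij] False \<open>i \<noteq> Suc p\<close> ij by (intro u) (simp add: sweep1_leads_def)
      then show ?thesis using False by (simp add: sweep2_leads_def)
    qed
  qed
qed

text \<open>
  The only leading exponent that changes is that of \<open>w p (R + 1)\<close>, where the new summand wins. For
  \<open>w (p + 1) (R + 1)\<close> the old summand wins by \<open>1\<close>. If \<open>R = p + 1\<close>, then the pairs \<open>p + 2, j\<close> receive
  a multiple of \<open>w (p + 1) j\<close>; this is light because its weight contains \<open>- penalty p\<close> at least twice
  and \<open>2N\<close> only once.
\<close>

lemma sweep2_step:
  assumes p: "odd p" "p < R" "Suc R < N"
    and st: "stage p (fresh p \<union> {Sweep2 p r | r. R \<le> r}) (sweep2_leads p R) X"
  shows "stage p (fresh p \<union> {Sweep2 p r | r. Suc R \<le> r}) (sweep2_leads p (Suc R)) (step R (Sweep2 p R) X)"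
proof (rule stage_step[OF st])
  show "Sweep2 p R \<in> fresh p \<union> {Sweep2 p r |r. R \<le> r}" by blast
  show "p \<le> R" using p by simp
  show "Sweep2 p R \<notin> fresh p \<union> {Sweep2 p r |r. Suc R \<le> r}" by (auto simp: fresh_def)
  show "fresh p \<union> {Sweep2 p r |r. Suc R \<le> r} \<subseteq> fresh p \<union> {Sweep2 p r |r. R \<le> r}" by auto
  fix i j assume X: "q_matrix X" and free: "\<And>i c. free (Sweep2 p R) (X i c)"
    and L: "\<And>i j. p \<le> i \<Longrightarrow> i < j \<Longrightarrow> j \<le> N \<Longrightarrow> sweep2_leads p R i j (symplectic n X i j)"
    and ij: "p \<le> i" "i < j" "j \<le> N"
  have V: "Sweep2 p R \<in> V" using p by (auto simp: V_def)
  note unchanged = step_unchanged_leads(1)[OF X free ij(2), of R]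
  note keep = step_keep[OF X free ij(2) _ _ V]
  have wS: "wt (Sweep2 p R) = (if R = Suc p then 2 * int N - penalty p else - penalty p - 1)" using p by simp
  have dom: "2 * weight_bound (p+2) + 2 * int N + 2 < penalty p" using p by (intro penalty_dominates) simp
  show "sweep2_leads p (Suc R) i j (symplectic n (step R (Sweep2 p R) X) i j)"
  proof (cases "i = p \<and> j = Suc R")
    case True
    have ch: "i \<noteq> R \<or> j \<noteq> Suc R" "i = Suc R \<and> (i, R) = (R, j) \<or> j = Suc R \<and> (i, R) = (i, R)"
      using True p by auto
    have "leads (symplectic n (step R (Sweep2 p R) X) i j) (exponent p R + unit (Sweep2 p R))"
    proof (rule step_switch[OF X free ij(2) ch V])
      show "leads (symplectic n X i R) (exponent p R)" using L[of i R] True p by (simp add: sweep2_leads_def)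
      have "leads (symplectic n X i j) (sweep1_exponent p j)" using L[OF ij] True by (simp add: sweep2_leads_def)
      moreover have "weight (sweep1_exponent p j) < weight (exponent p R) + wt (Sweep2 p R)"
      proof (cases "R = Suc p")
        case R: True
        then show ?thesis using True p
          by (simp add: weight_sweep1_exponent weight_exponent_odd_first)
      next
        case False
        then show ?thesis using True p unfolding wS
          by (simp add: weight_sweep1_exponent weight_exponent_odd of_nat_diff algebra_simps)
      qed
      ultimately show "symplectic n X i j = 0 \<or> (\<exists>a. leads (symplectic n X i j) a \<and> weight a < weight (exponent p R) + wt (Sweep2 p R))"
        by blast
    qed
    moreover have "exponent p R + unit (Sweep2 p R) = exponent p j"
      using True p by (simp add: exponent_odd add.assoc)
    ultimately show ?thesis using True p by (simp add: sweep2_leads_def)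
  next
    case notnew: False
    \<comment> \<open>All other pairs keep the exponent \<open>e\<close> that they had before.\<close>
    define e where "e = (if i = p \<and> (R < j \<or> j = N) then sweep1_exponent p j else exponent i j)"
    have old: "leads (symplectic n X i j) e" using L[OF ij] by (simp add: sweep2_leads_def e_def)
    have "leads (symplectic n (step R (Sweep2 p R) X) i j) e"
    proof (cases "i = R \<and> j = Suc R \<or> i \<noteq> Suc R \<and> j \<noteq> Suc R")
      case True
      then show ?thesis by (rule unchanged[OF _ old])
    next
      case False
      then have ch: "i \<noteq> R \<or> j \<noteq> Suc R" by blast
      have e: "e = exponent i j" using False notnew p by (auto simp: e_def)
      show ?thesis
      proof (cases "i = Suc R")
        case True
        have ch': "i = Suc R \<and> (R, j) = (R, j) \<or> j = Suc R \<and> (R, j) = (i, R)" using True by simp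
        have "leads (symplectic n X R j) (exponent R j)" using L[of R j] True ij p by (simp add: sweep2_leads_def)
        moreover have "weight (exponent R j) + wt (Sweep2 p R) < weight e"
        proof (cases "R = Suc p")
          case R: True
          \<comment> \<open>With \<open>j - p \<ge> 1\<close> both \<open>w (p + 1) j\<close> and the new variable contribute \<open>- penalty p\<close>.\<close>
          have "penalty p * int (j - p) \<ge> penalty p * 1" using penalty_pos[of p] True R ij by (intro mult_left_mono) auto
          moreover have "weight (exponent R j) = - penalty p * int (j - p)"
            using R True ij p by (simp add: weight_exponent_even)
          moreover have "\<bar>weight (exponent i j)\<bar> \<le> weight_bound (p+2)" using True R ij p by (intro exponent_bound) auto
          moreover have "0 \<le> weight_bound (p+2)" using penalty_pos[of "p+2"] by (simp add: weight_bound_def)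
          moreover have "wt (Sweep2 p R) = 2 * int N - penalty p" using R by simp
          ultimately show ?thesis unfolding e using dom by linarith
        next
          case False
          then show ?thesis using inner_gap[OF p(1), of i j R j] True ij p unfolding e by simp
        qed
        ultimately show ?thesis by (intro keep[OF ch ch' old]) blast
      next
        case iR: False
        then have j: "j = Suc R" and i: "i < R" using False ij by auto
        then have ch': "i = Suc R \<and> (i, R) = (R, j) \<or> j = Suc R \<and> (i, R) = (i, R)" by simp
        have ip: "i \<noteq> p" using notnew j by blast
        then have "leads (symplectic n X i R) (exponent i R)" using L[of i R] ij i p by (simp add: sweep2_leads_def)
        moreover have "weight (exponent i R) + wt (Sweep2 p R) < weight e"
        proof (cases "i = Suc p")
          case True
          then show ?thesis using p i j unfolding e wS
            by (simp add: weight_exponent_even of_nat_diff algebra_simps)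
        next
          case False
          then show ?thesis using inner_gap[OF p(1), of i j i R] ip i ij p unfolding e by simp
        qed
        ultimately show ?thesis by (intro keep[OF ch ch' old]) blast
      qed
    qed
    moreover have "e = (if i = p \<and> (Suc R < j \<or> j = N) then sweep1_exponent p j else exponent i j)"
      using notnew p by (auto simp: e_def)
    ultimately show ?thesis by (simp add: sweep2_leads_def)
  qed
qed

text \<open>
  The case \<open>p + 1 = N\<close> is special: both sweeps are empty.
\<close>

lemma stage_complete:
  assumes p: "odd p" "p < N" and st: "stage (p + 2) (fresh (p + 2)) (\<lambda>i j Z. leads Z (exponent i j)) X"
  shows "\<exists>Y. stage p (fresh p) (\<lambda>i j Z. leads Z (exponent i j)) Y"
proof -
  note st' = st[unfolded stage_def]
  have base: "stage p (fresh p \<union> {Sweep1 p r | r. Suc p \<le> r} \<union> {Sweep2 p r | r. True}) (sweep1_leads p (Suc p)) X"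
    unfolding stage_def
  proof (intro conjI ballI allI impI)
    show "q_matrix X" using st' by blast
    show "free v (X i c)" if "v \<in> fresh p \<union> {Sweep1 p r | r. Suc p \<le> r} \<union> {Sweep2 p r | r. True}" for v i c
      using that st' by (auto simp: fresh_def)
    have row: "X i c = (if i = c then start i else 0)" if "i < p + 2" for i c
      using that st' by blast
    show "X i c = (if i = c then start i else 0)" if "i < p" for i c
      using that by (simp add: row)
    show "X i c = 0" if "p \<le> i" "c < p" for i c
      using that st' by (cases "i < p + 2") auto
    fix i j assume ij: "p \<le> i" "i < j" "j \<le> N"
    show "sweep1_leads p (Suc p) i j (symplectic n X i j)"
    proof (cases "Suc p < i")
      case True
      then show ?thesis using st' ij by (simp add: sweep1_leads_def)
    next
      case False
      define m where "m = (p + 1) div 2"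
      have m: "p = 2 * m - 1" "Suc p = 2 * m" "m \<in> {1..n}" using p by (auto simp: m_def N_def elim!: oddE)
      have "symplectic n X i j = (\<Sum>k\<in>{m}. X i (2*k-1) * X j (2*k) - const_op q * (X i (2*k) * X j (2*k-1)))"
        unfolding symplectic_def
      proof (rule sum.mono_neutral_right)
        show "\<forall>k\<in>{1..n} - {m}. X i (2*k-1) * X j (2*k) - const_op q * (X i (2*k) * X j (2*k-1)) = 0"
        proof
          fix k assume k: "k \<in> {1..n} - {m}"
          have "i < p + 2" using False by simp
          note row[OF this]
          moreover have "i \<noteq> 2*k-1" "i \<noteq> 2*k" using k m False ij by auto
          ultimately show "X i (2*k-1) * X j (2*k) - const_op q * (X i (2*k) * X j (2*k-1)) = 0" by simp
        qed
      qed (use m in auto)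
      then have symplectic: "symplectic n X i j = X i p * X j (Suc p) - const_op q * (X i (Suc p) * X j p)"
        using m by simp
      have zero: "X j p = 0" "X j (Suc p) = (if j = Suc p then 1 else 0)"
        using st' row[of j "Suc p"] row[of j p] ij False p
        by (cases "j = Suc p"; force simp: start_def)+
      show ?thesis
      proof (cases "i = p")
        case True
        then have "X i p = shift (Scale p)" "X i (Suc p) = 0" using row[of i] p by (auto simp: start_def)
        then have "symplectic n X i j = (if j = Suc p then shift (Scale p) else 0)"
          using zero by (simp add: symplectic)
        then show ?thesis using True ij leads_shift by (auto simp: sweep1_leads_def sweep1_exponent_def)
      next
        case i: False
        then have "X i p = 0" using row[of i p] False ij by auto
        then have "symplectic n X i j = 0" using zero by (simp add: symplectic)
        then show ?thesis using False i by (simp add: sweep1_leads_def)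
      qed
    qed
  qed
  have "\<exists>X. stage p (fresh p \<union> {Sweep1 p r | r. R \<le> r} \<union> {Sweep2 p r | r. True}) (sweep1_leads p R) X"
    if "Suc p \<le> R" "R \<le> N" for R
    using that
  proof (induction R rule: dec_induct)
    case (step R)
    then show ?case using sweep1_step[of p R] p by auto
  qed (use base in blast)
  from this[of N] p obtain X1 where
    "stage p (fresh p \<union> {Sweep1 p r | r. N \<le> r} \<union> {Sweep2 p r | r. True}) (sweep1_leads p N) X1" by auto
  then have X1: "stage p (fresh p \<union> {Sweep2 p r | r. True}) (sweep1_leads p N) X1"
    unfolding stage_def by blast
  show ?thesis
  proof (cases "Suc p = N")
    case True
    then have "stage p (fresh p) (\<lambda>i j Z. leads Z (exponent i j)) X1"
      using X1 exponent_odd(2)[OF p(1)] unfolding stage_def sweep1_leads_def by (auto simp: le_Suc_eq dest!: le_antisym)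
    then show ?thesis by blast
  next
    case False
    have "\<exists>X. stage p (fresh p \<union> {Sweep2 p r | r. R \<le> r}) (sweep2_leads p R) X"
      if "Suc p \<le> R" "R \<le> N - 1" for R
      using that
    proof (induction R rule: dec_induct)
      case base
      then show ?case using sweep2_start[OF p(1) _ X1] False p by auto
    next
      case (step R)
      moreover have "Suc R < N" using step.prems p by simp
      ultimately show ?case using sweep2_step[of p R] p by auto
    qed
    moreover have "Suc p \<le> N - 1" using p False by simp
    ultimately obtain X2 where
      X2: "stage p (fresh p \<union> {Sweep2 p r | r. N - 1 \<le> r}) (sweep2_leads p (N - 1)) X2" by blast
    have "stage p (fresh p) (\<lambda>i j Z. leads Z (exponent i j)) X2"
      unfolding stage_def
    proof (intro conjI)
      show "\<forall>i j. p \<le> i \<longrightarrow> i < j \<longrightarrow> j \<le> N \<longrightarrow> leads (symplectic n X2 i j) (exponent i j)"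
      proof (intro allI impI)
        fix i j assume ij: "p \<le> i" "i < j" "j \<le> N"
        then have sweep2_leads: "sweep2_leads p (N-1) i j (symplectic n X2 i j)" using X2 unfolding stage_def by blast
        show "leads (symplectic n X2 i j) (exponent i j)"
        proof (cases "i = p \<and> j = N")
          case True
          then show ?thesis using sweep2_leads exponent_odd(2)[OF p(1)] by (simp add: sweep2_leads_def)
        next
          case False
          then have "\<not> (i = p \<and> (N - 1 < j \<or> j = N))" using ij by linarith
          then show ?thesis using sweep2_leads unfolding sweep2_leads_def by (simp only: if_False)
        qed
      qed
    qed (use X2 in \<open>auto simp: stage_def\<close>)
    then show ?thesis by blast
  qed
qed

theorem generic_skew_model:
  obtains X :: "nat \<Rightarrow> nat \<Rightarrow> mop" where "q_matrix X"
    "\<And>i j. 1 \<le> i \<Longrightarrow> i < j \<Longrightarrow> j \<le> N \<Longrightarrow> leads (symplectic n X i j) (exponent i j)"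
proof -
  \<comment> \<open>The stages run from \<open>p = N + 1\<close>, where nothing is required, down to \<open>p = 1\<close>; \<open>m\<close> counts them.\<close>
  let ?L = "\<lambda>i j Z. leads Z (exponent i j)"
  have "m \<le> n \<Longrightarrow> \<exists>X. stage (2 * (n - m) + 1) (fresh (2 * (n - m) + 1)) ?L X" for m
  proof (induction m)
    case 0
    let ?X = "\<lambda>i c. if i = c then start i else 0"
    have com: "start i * start j = start j * start i" for i j
      by (simp add: start_def shift_shift[of "Scale i"])
    have "stage (N+1) (fresh (N+1)) ?L ?X"
      unfolding stage_def
    proof (intro conjI ballI allI impI)
      show "q_matrix ?X"
        unfolding quantum_matrix_def by (auto simp: com)
      show "free v (if i = c then start i else 0)" if "v \<in> fresh (N+1)" for v i c
        using that by (auto simp: fresh_def start_def free_zero free_one intro!: free_shift)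
    qed auto
    then show ?case by (intro exI[of _ ?X]) (simp add: N_def)
  next
    case (Suc m)
    then have "2 * (n - m) + 1 = (2 * (n - Suc m) + 1) + 2" by simp
    with Suc obtain X where "stage ((2 * (n - Suc m) + 1) + 2) (fresh ((2 * (n - Suc m) + 1) + 2)) ?L X" by auto
    then show ?case by (rule stage_complete[rotated 2]) (use Suc.prems in \<open>auto simp: N_def\<close>)
  qed
  from this[of n] obtain X where "stage 1 (fresh 1) ?L X" by auto
  then show ?thesis by (intro that[of X]) (auto simp: stage_def)
qed

lemma unit_app: "unit v u = (if u = v then 1 else 0)"
  by (simp add: unit_def)

lemma sum_unit:
  assumes "finite I" "inj F"
  shows "(\<Sum>i\<in>I. unit (F i)) x = (if x \<in> F ` I then 1 else 0 :: int)"
  using assms(1)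
proof (induction I)
  case (insert i I)
  then have "x = F i \<Longrightarrow> x \<notin> F ` I" using assms(2) by (auto dest: injD)
  then show ?case using insert by (auto simp: unit_def)
qed simp

lemma exponent_apply:
  "exponent k l (Scale a) = (if a = (if odd k then k else k - 1) then 1 else 0)"
  "exponent k l (Sweep1 a r) = (if odd k then if l < N then 0 else if a = k \<and> k < r \<and> r < l then 1 else 0
     else if a = k - 1 \<and> k \<le> r \<and> r < l then 1 else 0)"
  "exponent k l (Sweep2 a r) = (if odd k then if l < N \<and> a = k \<and> k < r \<and> r < l then 1 else 0
     else if a = k - 1 \<and> r = k - 1 then 1 else 0)"
proof -
  have inj: "inj (Sweep2 m)" "inj (Sweep1 m)" for m by (simp_all add: inj_def)
  show "exponent k l (Scale a) = (if a = (if odd k then k else k - 1) then 1 else 0)"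
    unfolding exponent_def
    by (cases "odd k"; cases "l < N"; auto simp: sum_unit inj image_iff unit_app)
  show "exponent k l (Sweep1 a r) = (if odd k then if l < N then 0 else if a = k \<and> k < r \<and> r < l then 1 else 0
     else if a = k - 1 \<and> k \<le> r \<and> r < l then 1 else 0)"
    unfolding exponent_def
    by (cases "odd k"; cases "l < N"; auto simp: sum_unit inj image_iff unit_app)
  show "exponent k l (Sweep2 a r) = (if odd k then if l < N \<and> a = k \<and> k < r \<and> r < l then 1 else 0
     else if a = k - 1 \<and> r = k - 1 then 1 else 0)"
    unfolding exponent_def
    by (cases "odd k"; cases "l < N"; auto simp: sum_unit inj image_iff unit_app)
qed

text \<open>
  The functionals dual to the leading exponents. A sum of such exponents, with multiplicities, has
  at \<open>Sweep2 i j\<close> the total multiplicity of the pairs \<open>i, l\<close> with \<open>j < l < N\<close>, and similarly at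
  \<open>Sweep1\<close>; differences of neighbouring values isolate single multiplicities.
\<close>

definition coord :: "nat \<Rightarrow> nat \<Rightarrow> (var \<Rightarrow> int) \<Rightarrow> int" where
  "coord i j e =
     (if odd i then
        if j = Suc i then e (Scale i) - e (Sweep2 i (Suc i)) - e (Sweep1 i (Suc i))
        else if j = N then e (Sweep1 i (Suc i)) - e (Sweep2 i i)
        else e (Sweep2 i (j-1)) - e (Sweep2 i j)
      else
        if j = N then e (Sweep2 (i-1) (i-1)) - e (Sweep1 (i-1) i) + e (Sweep1 (i-1) (j-1))
        else e (Sweep1 (i-1) (j-1)) - e (Sweep1 (i-1) j))"

lemma coord_exponent:
  assumes "0 < i" "i < j" "j \<le> N" "0 < k" "k < l" "l \<le> N"
  shows "coord i j (exponent k l) = (if i = k \<and> j = l then 1 else 0)"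
proof -
  have even: "\<exists>p. odd p \<and> m = Suc p" if "even m" "0 < m" for m :: nat
    using that by (cases m) auto
  show ?thesis
  proof (cases "odd i")
    case i: True
    show ?thesis
    proof (cases "odd k")
      case True
      then show ?thesis using assms i by (auto simp: coord_def exponent_apply)
    next
      case False
      then obtain p where "odd p" "k = Suc p" using even[of k] assms by auto
      then show ?thesis using assms i by (auto simp: coord_def exponent_apply)
    qed
  next
    case False
    then obtain p where p: "odd p" "i = Suc p" using even[of i] assms by auto
    show ?thesis
    proof (cases "odd k")
      case True
      then show ?thesis using assms p by (auto simp: coord_def exponent_apply)
    next
      case False
      then obtain p' where "odd p'" "k = Suc p'" using even[of k] assms by auto
      then show ?thesis using assms p by (auto simp: coord_def exponent_apply)
    qed
  qed
qed

lemma coord_add: "coord i j (d + e) = coord i j d + coord i j e" "coord i j 0 = 0"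
  by (simp_all add: coord_def)

lemma coord_sum_list:
  assumes "0 < i" "i < j" "j \<le> N" "set xs \<subseteq> {(k, l). 0 < k \<and> k < l \<and> l \<le> N}"
  shows "coord i j (sum_list (map (\<lambda>(k, l). exponent k l) xs)) = int (count (mset xs) (i, j))"
  using assms(4)
proof (induction xs)
  case (Cons x xs)
  then show ?case using assms(1-3)
    by (cases x) (auto simp: coord_add coord_exponent simp del: plus_fun_apply)
qed (simp add: coord_add)

text \<open>
  Applying \<open>coord i j\<close> to a sum of leading exponents counts how often the pair \<open>i, j\<close> occurs.
\<close>

lemma exponent_inj:
  assumes "set xs \<subseteq> {(k, l). 0 < k \<and> k < l \<and> l \<le> N}" "set ys \<subseteq> {(k, l). 0 < k \<and> k < l \<and> l \<le> N}"
    and "sum_list (map (\<lambda>(k, l). exponent k l) xs) = sum_list (map (\<lambda>(k, l). exponent k l) ys)"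
  shows "mset xs = mset ys"
proof (rule multiset_eqI)
  fix x
  show "count (mset xs) x = count (mset ys) x"
  proof (cases "x \<in> {(k, l). 0 < k \<and> k < l \<and> l \<le> N}")
    case True
    then show ?thesis using coord_sum_list[OF _ _ _ assms(1)] coord_sum_list[OF _ _ _ assms(2)] assms(3)
      by (cases x) (metis (no_types, lifting) case_prodD mem_Collect_eq of_nat_eq_iff)
  next
    case False
    then have "x \<notin># mset xs" "x \<notin># mset ys" using assms by auto
    then show ?thesis by (simp only: not_in_iff)
  qed
qed

end

section \<open>Evaluation of noncommutative polynomials\<close>

lemma ncpoly_induct [case_names zero add]:
  fixes p :: "'a ncpoly"
  assumes "P 0" "\<And>p w c. P p \<Longrightarrow> P (p + Poly_Mapping.single w c)"
  shows "P p"
proof (induction p rule: update_induct)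
  case const
  then show ?case using assms(1) by simp
next
  case (update p w c)
  have "Poly_Mapping.update w c p = p + Poly_Mapping.single w c"
    using update by (intro poly_mapping_eqI) (auto simp: lookup_update lookup_add lookup_single when_def in_keys_iff)
  then show ?case using assms(2)[OF update(3)] by simp
qed

lemma ncpoly_one: "(1 :: 'a ncpoly) = Poly_Mapping.single [] 1"
  by (simp add: zero_list_def[symmetric])

locale scalars =
  fixes \<kappa> :: "complex \<Rightarrow> 'b::ring_1"
  assumes \<kappa>_add: "\<kappa> (a + b) = \<kappa> a + \<kappa> b" and \<kappa>_mult: "\<kappa> (a * b) = \<kappa> a * \<kappa> b"
    and \<kappa>_one: "\<kappa> 1 = 1" and \<kappa>_central: "\<kappa> a * x = x * \<kappa> a"
begin

lemma \<kappa>_zero: "\<kappa> 0 = 0"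
  using \<kappa>_add[of 0 0] by simp

lemma \<kappa>_minus: "\<kappa> (- a) = - \<kappa> a"
  using \<kappa>_add[of a "- a"] by (simp add: \<kappa>_zero eq_neg_iff_add_eq_0 add.commute)

lemma \<kappa>_diff: "\<kappa> (a - b) = \<kappa> a - \<kappa> b"
  using \<kappa>_add[of a "- b"] by (simp add: \<kappa>_minus)

lemma q_scalars:
  assumes "q \<noteq> 0"
  shows "q_scalars (\<kappa> q) (\<kappa> (inverse q))"
proof
  show "\<kappa> q * \<kappa> (inverse q) = 1"
    by (simp only: \<kappa>_mult[symmetric] right_inverse[OF assms] \<kappa>_one)
qed (rule \<kappa>_central)

definition evaluate :: "('a \<Rightarrow> 'b) \<Rightarrow> 'a ncpoly \<Rightarrow> 'b" where
  "evaluate f p = (\<Sum>w\<in>Poly_Mapping.keys p. \<kappa> (Poly_Mapping.lookup p w) * prod_list (map f w))"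

lemma evaluate_superset:
  assumes "finite W" "Poly_Mapping.keys p \<subseteq> W"
  shows "evaluate f p = (\<Sum>w\<in>W. \<kappa> (Poly_Mapping.lookup p w) * prod_list (map f w))"
  unfolding evaluate_def using assms
  by (intro sum.mono_neutral_left) (auto simp: in_keys_iff \<kappa>_zero)

lemma evaluate_add: "evaluate f (p + r) = evaluate f p + evaluate f r"
proof -
  let ?W = "Poly_Mapping.keys p \<union> Poly_Mapping.keys r"
  have "Poly_Mapping.keys (p + r) \<subseteq> ?W" by (rule Poly_Mapping.keys_add)
  then show ?thesis
    by (simp add: evaluate_superset[of ?W] lookup_add \<kappa>_add distrib_right sum.distrib)
qed

lemma evaluate_zero: "evaluate f 0 = 0"
  by (simp add: evaluate_def)

lemma evaluate_single: "evaluate f (Poly_Mapping.single w c) = \<kappa> c * prod_list (map f w)"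
  by (subst evaluate_superset[of "{w}"]) auto

lemma evaluate_mult: "evaluate f (p * r) = evaluate f p * evaluate f r"
proof (induction p rule: ncpoly_induct)
  case (add p v a)
  have "evaluate f (Poly_Mapping.single v a * r) = evaluate f (Poly_Mapping.single v a) * evaluate f r"
  proof (induction r rule: ncpoly_induct)
    case (add r w b)
    have "\<kappa> a * (x * (\<kappa> b * y)) = \<kappa> a * (\<kappa> b * (x * y))" for x y
      by (metis \<kappa>_central mult.assoc)
    then show ?case
      by (simp add: distrib_left evaluate_add add mult_single evaluate_single plus_list_def \<kappa>_mult mult.assoc)
  qed (simp add: evaluate_zero)
  then show ?case by (simp add: distrib_right evaluate_add add)
qed (simp add: evaluate_zero)

lemma evaluate_minus: "evaluate f (- p) = - evaluate f p"
  using evaluate_add[of f p "- p"] by (simp add: evaluate_zero eq_neg_iff_add_eq_0 add.commute)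

lemma evaluate_diff: "evaluate f (p - r) = evaluate f p - evaluate f r"
  using evaluate_add[of f p "- r"] by (simp add: evaluate_minus)

lemma evaluate_one: "evaluate f 1 = 1"
  using evaluate_single[of f "[]" 1] by (simp add: ncpoly_one[symmetric] \<kappa>_one)

lemma evaluate_gen: "evaluate f (gen x) = f x"
  by (simp add: gen_def evaluate_single \<kappa>_one)

lemma evaluate_scal: "evaluate f (c \<cdot> p) = \<kappa> c * evaluate f p"
  by (simp add: scal_def evaluate_mult evaluate_single)

lemma evaluate_sum: "evaluate f (\<Sum>i\<in>I. p i) = (\<Sum>i\<in>I. evaluate f (p i))"
  by (induction I rule: infinite_finite_induct) (simp_all add: evaluate_zero evaluate_add)

lemmas evaluate_simps = evaluate_add evaluate_zero evaluate_mult evaluate_minus evaluate_diff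
  evaluate_one evaluate_gen evaluate_scal evaluate_sum

lemma evaluate_cong:
  "(\<And>w x. w \<in> Poly_Mapping.keys p \<Longrightarrow> x \<in> set w \<Longrightarrow> f x = g x) \<Longrightarrow> evaluate f p = evaluate g p"
  unfolding evaluate_def by (intro sum.cong arg_cong[of _ _ prod_list] arg_cong2[of _ _ _ _ "(*)"]) auto

end

text \<open>
  The same evaluation is used with three targets: polynomials themselves, the operators above, and
  the ring of classes of polynomials introduced below.
\<close>

abbreviation ncconst :: "complex \<Rightarrow> 'a ncpoly" where
  "ncconst \<equiv> Poly_Mapping.single []"

interpretation nc: scalars "ncconst :: complex \<Rightarrow> 'a ncpoly"
proof
  show "ncconst a * p = p * ncconst a" for a and p :: "'a ncpoly"
    by (induction p rule: ncpoly_induct)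
      (simp_all add: distrib_left distrib_right mult_single plus_list_def mult.commute)
  show "ncconst 1 = (1 :: 'a ncpoly)" by (simp only: ncpoly_one)
qed (simp_all add: single_add mult_single plus_list_def)

interpretation op: scalars "const_op :: complex \<Rightarrow> 'e op"
  by unfold_locales (rule const_op_hom const_op_central)+

lemma word_monomial: "prod_list (map gen w) = (Poly_Mapping.single w 1 :: 'a ncpoly)"
  by (induction w) (simp_all add: gen_def mult_single plus_list_def ncpoly_one)

lemma evaluate_gen_id: "nc.evaluate gen p = p"
proof (induction p rule: ncpoly_induct)
  case (add p w c)
  then show ?case
    by (simp add: nc.evaluate_add nc.evaluate_single word_monomial mult_single plus_list_def)
qed (simp add: nc.evaluate_zero)

section \<open>The free algebra as a ring with carrier\<close>

abbreviation words_over :: "'a set \<Rightarrow> 'a ncpoly set" where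
  "words_over X \<equiv> carrier (free_algebra X)"

lemma words_over_iff: "p \<in> words_over X \<longleftrightarrow> (\<forall>w\<in>Poly_Mapping.keys p. set w \<subseteq> X)"
  by (simp add: free_algebra_def)

lemma free_algebra_ops [simp]:
  "monoid.mult (free_algebra X) = (*)" "add (free_algebra X) = (+)" "one (free_algebra X) = 1"
  "zero (free_algebra X) = 0" "smult (free_algebra X) = scal"
  by (simp_all add: free_algebra_def)

lemma words_over_zero: "0 \<in> words_over X" by (simp add: words_over_iff)

lemma words_over_single: "set w \<subseteq> X \<Longrightarrow> Poly_Mapping.single w c \<in> words_over X"
  by (simp add: words_over_iff)

lemma words_over_one: "1 \<in> words_over X"
  by (simp add: ncpoly_one words_over_single)

lemma words_over_add: "p \<in> words_over X \<Longrightarrow> r \<in> words_over X \<Longrightarrow> p + r \<in> words_over X"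
  using Poly_Mapping.keys_add[of p r] by (auto simp: words_over_iff)

lemma words_over_mult: "p \<in> words_over X \<Longrightarrow> r \<in> words_over X \<Longrightarrow> p * r \<in> words_over X"
  using Poly_Mapping.keys_mult[of p r] by (fastforce simp: words_over_iff plus_list_def)

lemma words_over_minus: "p \<in> words_over X \<Longrightarrow> - p \<in> words_over X"
  by (simp add: words_over_iff)

lemma words_over_diff: "p \<in> words_over X \<Longrightarrow> r \<in> words_over X \<Longrightarrow> p - r \<in> words_over X"
  using words_over_add[OF _ words_over_minus] by force

lemma words_over_gen: "x \<in> X \<Longrightarrow> gen x \<in> words_over X"
  unfolding gen_def by (intro words_over_single) simp

lemma words_over_scal: "p \<in> words_over X \<Longrightarrow> c \<cdot> p \<in> words_over X"
  unfolding scal_def by (intro words_over_mult words_over_single) auto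

lemma words_over_sum: "(\<And>i. i \<in> I \<Longrightarrow> p i \<in> words_over X) \<Longrightarrow> (\<Sum>i\<in>I. p i) \<in> words_over X"
  by (induction I rule: infinite_finite_induct) (simp_all add: words_over_zero words_over_add)

lemmas words_over_intros = words_over_zero words_over_one words_over_add words_over_mult
  words_over_minus words_over_diff words_over_gen words_over_scal words_over_sum

lemma ring_free_algebra: "ring (free_algebra X)"
proof (rule ringI)
  show "abelian_group (free_algebra X)"
  proof (rule abelian_groupI)
    fix p assume "p \<in> words_over X"
    then show "\<exists>r\<in>words_over X. r \<oplus>\<^bsub>free_algebra X\<^esub> p = \<zero>\<^bsub>free_algebra X\<^esub>"
      by (intro bexI[of _ "- p"]) (simp_all add: words_over_minus)
  qed (simp_all add: words_over_intros add.assoc add.commute)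
  show "monoid (free_algebra X)"
    by (rule monoidI) (simp_all add: words_over_intros mult.assoc)
qed (simp_all add: distrib_left distrib_right)

interpretation free: ring "free_algebra X" for X by (rule ring_free_algebra)

lemma free_a_inv: "p \<in> words_over X \<Longrightarrow> \<ominus>\<^bsub>free_algebra X\<^esub> p = - p"
  using free.r_neg[of p X] free.a_inv_closed[of p X]
  by (simp add: eq_neg_iff_add_eq_0 add.commute)

lemma ideal_free_algebraI:
  assumes "I \<subseteq> words_over X" "0 \<in> I" "\<And>p r. p \<in> I \<Longrightarrow> r \<in> I \<Longrightarrow> p + r \<in> I"
    and "\<And>p r. p \<in> I \<Longrightarrow> r \<in> words_over X \<Longrightarrow> r * p \<in> I"
    and "\<And>p r. p \<in> I \<Longrightarrow> r \<in> words_over X \<Longrightarrow> p * r \<in> I"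
  shows "ideal I (free_algebra X)"
proof (rule idealI)
  show "subgroup I (add_monoid (free_algebra X))"
  proof
    fix p assume p: "p \<in> I"
    have "(- 1) * p \<in> I" by (rule assms(4)[OF p]) (simp add: words_over_minus words_over_one)
    then have "- p \<in> I" by simp
    moreover have "inv\<^bsub>add_monoid (free_algebra X)\<^esub> p = - p"
      using free_a_inv[of p X] p assms(1) by (auto simp: a_inv_def)
    ultimately show "inv\<^bsub>add_monoid (free_algebra X)\<^esub> p \<in> I" by simp
  qed (use assms(1-3) in auto)
qed (use assms(4,5) in \<open>simp_all add: ring_free_algebra\<close>)

lemma ideal_free_algebraD:
  assumes "ideal I (free_algebra X)"
  shows "I \<subseteq> words_over X" "0 \<in> I" "\<And>p r. p \<in> I \<Longrightarrow> r \<in> I \<Longrightarrow> p + r \<in> I"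
    "\<And>p r. p \<in> I \<Longrightarrow> r \<in> words_over X \<Longrightarrow> r * p \<in> I"
    "\<And>p r. p \<in> I \<Longrightarrow> r \<in> words_over X \<Longrightarrow> p * r \<in> I"
    "\<And>p r. p \<in> I \<Longrightarrow> r \<in> I \<Longrightarrow> p - r \<in> I"
    "\<And>p. p \<in> I \<Longrightarrow> - p \<in> I" "\<And>p c. p \<in> I \<Longrightarrow> c \<cdot> p \<in> I"
proof -
  interpret ideal I "free_algebra X" by fact
  show sub: "I \<subseteq> words_over X" by (rule a_subset)
  show "0 \<in> I" using zero_closed by simp
  show add: "\<And>p r. p \<in> I \<Longrightarrow> r \<in> I \<Longrightarrow> p + r \<in> I" using a_closed by simp
  show l: "\<And>p r. p \<in> I \<Longrightarrow> r \<in> words_over X \<Longrightarrow> r * p \<in> I" using I_l_closed by simp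
  show "\<And>p r. p \<in> I \<Longrightarrow> r \<in> words_over X \<Longrightarrow> p * r \<in> I" using I_r_closed by simp
  show neg: "\<And>p. p \<in> I \<Longrightarrow> - p \<in> I"
    using l[of _ "- 1"] by (simp add: words_over_minus words_over_one)
  show "\<And>p r. p \<in> I \<Longrightarrow> r \<in> I \<Longrightarrow> p - r \<in> I" using add[OF _ neg] by force
  show "\<And>p c. p \<in> I \<Longrightarrow> c \<cdot> p \<in> I" unfolding scal_def by (intro l words_over_single) auto
qed

section \<open>Calculating modulo all two-sided ideals at once\<close>

text \<open>
  The relations of the quantum antisymmetric matrices were derived for elements of a type that is a
  ring, whereas a quotient by an ideal that depends on \<open>n\<close> and \<open>q\<close> is not a type. The product of the
  quotients of a ring by all its two-sided ideals does not depend on anything but the ring. It is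
  a quotient of the functions from ideals to the ring, and an identity in it can be read off in
  each single quotient.
\<close>

definition two_sided :: "'r::ring_1 set \<Rightarrow> bool" where
  "two_sided J \<longleftrightarrow> 0 \<in> J \<and> (\<forall>a\<in>J. \<forall>b\<in>J. a + b \<in> J) \<and> (\<forall>a\<in>J. \<forall>r. r * a \<in> J \<and> a * r \<in> J)"

lemma two_sidedD:
  assumes "two_sided J"
  shows "0 \<in> J" "a \<in> J \<Longrightarrow> b \<in> J \<Longrightarrow> a + b \<in> J" "a \<in> J \<Longrightarrow> r * a \<in> J" "a \<in> J \<Longrightarrow> a * r \<in> J"
    "a \<in> J \<Longrightarrow> - a \<in> J" "a \<in> J \<Longrightarrow> b \<in> J \<Longrightarrow> a - b \<in> J"
proof -
  show 1: "0 \<in> J" "a \<in> J \<Longrightarrow> b \<in> J \<Longrightarrow> a + b \<in> J" "a \<in> J \<Longrightarrow> r * a \<in> J" "a \<in> J \<Longrightarrow> a * r \<in> J" for a b r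
    using assms by (auto simp: two_sided_def)
  show 2: "a \<in> J \<Longrightarrow> - a \<in> J" for a using 1(3)[of a "- 1"] by simp
  show "a \<in> J \<Longrightarrow> b \<in> J \<Longrightarrow> a - b \<in> J" using 1(2)[of a "- b"] 2[of b] by simp
qed

lemma two_sided_cong:
  assumes J: "two_sided J" and ab: "a - b \<in> J" and cd: "c - d \<in> J"
  shows "(a + c) - (b + d) \<in> J" "(a - c) - (b - d) \<in> J" "a * c - b * d \<in> J" "(- a) - (- b) \<in> J"
proof -
  have eq: "(a + c) - (b + d) = (a - b) + (c - d)" "(a - c) - (b - d) = (a - b) - (c - d)"
    "a * c - b * d = a * (c - d) + (a - b) * d" "(- a) - (- b) = - (a - b)"
    by (simp_all add: algebra_simps)
  show "(a + c) - (b + d) \<in> J" "(a - c) - (b - d) \<in> J" "a * c - b * d \<in> J" "(- a) - (- b) \<in> J"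
    unfolding eq by (intro two_sidedD(2-6)[OF J] ab cd)+
qed

definition quot_rel :: "('r::ring_1 set \<Rightarrow> 'r) \<Rightarrow> ('r set \<Rightarrow> 'r) \<Rightarrow> bool" where
  "quot_rel f g \<longleftrightarrow> (\<forall>J. two_sided J \<longrightarrow> f J - g J \<in> J)"

lemma quot_rel_sym: "quot_rel f g \<Longrightarrow> quot_rel g f"
  unfolding quot_rel_def using two_sidedD(5) by (metis minus_diff_eq)

lemma quot_rel_point:
  assumes "quot_rel f g" "two_sided J" "g J - x \<in> J"
  shows "f J - x \<in> J"
proof -
  have "(f J - g J) + (g J - x) \<in> J"
    using assms by (intro two_sidedD(2)[OF assms(2)]) (auto simp: quot_rel_def)
  then show ?thesis by simp
qed

lemma equivp_quot_rel: "equivp (quot_rel :: ('r::ring_1 set \<Rightarrow> 'r) \<Rightarrow> _)"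
proof (intro equivpI reflpI sympI transpI)
  fix f g h :: "'r set \<Rightarrow> 'r"
  show "quot_rel f f" by (simp add: quot_rel_def two_sidedD)
  show "quot_rel f g \<Longrightarrow> quot_rel g f" by (rule quot_rel_sym)
  show "quot_rel f g \<Longrightarrow> quot_rel g h \<Longrightarrow> quot_rel f h"
    using quot_rel_point[of f g] unfolding quot_rel_def[of _ h] by blast
qed

quotient_type (overloaded) 'r all_quotients = "'r::ring_1 set \<Rightarrow> 'r" / quot_rel
  by (rule equivp_quot_rel)

instantiation all_quotients :: (ring_1) ring_1
begin
lift_definition zero_all_quotients :: "'a all_quotients" is "\<lambda>J. 0" .
lift_definition one_all_quotients :: "'a all_quotients" is "\<lambda>J. 1" .
lift_definition plus_all_quotients :: "'a all_quotients \<Rightarrow> 'a all_quotients \<Rightarrow> 'a all_quotients"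
  is "\<lambda>f g J. f J + g J" by (simp add: quot_rel_def two_sided_cong(1))
lift_definition minus_all_quotients :: "'a all_quotients \<Rightarrow> 'a all_quotients \<Rightarrow> 'a all_quotients"
  is "\<lambda>f g J. f J - g J" by (simp add: quot_rel_def two_sided_cong(2))
lift_definition uminus_all_quotients :: "'a all_quotients \<Rightarrow> 'a all_quotients" is "\<lambda>f J. - f J"
  unfolding quot_rel_def by (blast intro: two_sided_cong(4))
lift_definition times_all_quotients :: "'a all_quotients \<Rightarrow> 'a all_quotients \<Rightarrow> 'a all_quotients"
  is "\<lambda>f g J. f J * g J" by (simp add: quot_rel_def two_sided_cong(3))
instance
proof
  show "(0 :: 'a all_quotients) \<noteq> 1"
  proof transfer
    have "two_sided {0 :: 'a}" by (simp add: two_sided_def)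
    then show "\<not> quot_rel (\<lambda>J. 0 :: 'a) (\<lambda>J. 1)" by (force simp: quot_rel_def)
  qed
qed (transfer; simp add: quot_rel_def two_sidedD algebra_simps; fail)+
end

text \<open>
  A quantum matrix over a particular quotient is extended by zero to the other ideals, where the
  relations then hold trivially. Scalars are constant functions. The relation \<open>is_at I a x\<close> says
  that \<open>a\<close> has the component \<open>x + I\<close> at \<open>I\<close>.
\<close>

lift_definition everywhere :: "'r::ring_1 \<Rightarrow> 'r all_quotients" is "\<lambda>x J. x" .
lift_definition only_at :: "'r::ring_1 set \<Rightarrow> 'r \<Rightarrow> 'r all_quotients" is "\<lambda>I x J. if J = I then x else 0" .
lift_definition is_at :: "'r::ring_1 set \<Rightarrow> 'r all_quotients \<Rightarrow> 'r \<Rightarrow> bool"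
  is "\<lambda>I f x. two_sided I \<longrightarrow> f I - x \<in> I"
  by (blast intro: quot_rel_point quot_rel_sym)

lemma is_at_simps:
  "is_at I (everywhere x) x" "is_at I (only_at I x) x" 
  by (transfer; simp add: two_sidedD)+

lemma is_at_zero: "is_at I 0 0" "is_at I 1 1"
  by (transfer; simp add: two_sidedD)+

lemma is_at_add: "is_at I a x \<Longrightarrow> is_at I b y \<Longrightarrow> is_at I (a + b) (x + y)"
  by transfer (simp add: two_sided_cong(1))

lemma is_at_mult: "is_at I a x \<Longrightarrow> is_at I b y \<Longrightarrow> is_at I (a * b) (x * y)"
  by transfer (simp add: two_sided_cong(3))

lemma is_at_zeroD: "is_at I 0 x \<Longrightarrow> two_sided I \<Longrightarrow> x \<in> I"
  by transfer (use two_sidedD(5) in force)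

lemma only_at_zero: "x \<in> I \<Longrightarrow> two_sided I \<Longrightarrow> only_at I x = 0"
  by transfer (auto simp: quot_rel_def two_sidedD)

lemma only_at_ops:
  "only_at I x + only_at I y = only_at I (x + y)" "only_at I x - only_at I y = only_at I (x - y)"
  "only_at I x * only_at I y = only_at I (x * y)" "everywhere x * only_at I y = only_at I (x * y)"
  by (transfer; auto simp: quot_rel_def two_sidedD)+

lemma everywhere_hom:
  "everywhere (x + y) = everywhere x + everywhere y" "everywhere (x * y) = everywhere x * everywhere y"
  "everywhere 1 = 1"
  by (transfer; rule equivp_reflp[OF equivp_quot_rel])+

lemma everywhere_central:
  assumes "\<And>y. x * y = y * x"
  shows "everywhere x * a = a * everywhere x"
proof -
  have "quot_rel (\<lambda>J. x * f J) (\<lambda>J. f J * x)" for f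
    using equivp_reflp[OF equivp_quot_rel] by (subst assms)
  then show ?thesis by (transfer fixing: x)
qed

interpretation quot: scalars "\<lambda>c. everywhere (ncconst c :: 'a ncpoly)"
proof
  show "everywhere (ncconst (a + b)) = everywhere (ncconst a :: 'a ncpoly) + everywhere (ncconst b)" for a b
    by (simp only: nc.\<kappa>_add everywhere_hom)
  show "everywhere (ncconst (a * b)) = everywhere (ncconst a :: 'a ncpoly) * everywhere (ncconst b)" for a b
    by (simp only: nc.\<kappa>_mult everywhere_hom)
  show "everywhere (ncconst 1 :: 'a ncpoly) = 1"
    by (simp only: nc.\<kappa>_one everywhere_hom)
  show "everywhere (ncconst a) * x = x * everywhere (ncconst a)" for a and x :: "'a ncpoly all_quotients"
    by (rule everywhere_central) (rule nc.\<kappa>_central)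
qed

lemma is_at_evaluate:
  fixes F :: "'b \<Rightarrow> 'a ncpoly all_quotients"
  assumes "\<And>x. is_at I (F x) (G x)"
  shows "is_at I (quot.evaluate F p) (nc.evaluate G p)"
proof (induction p rule: ncpoly_induct)
  case (add p w c)
  have "is_at I (prod_list (map F w)) (prod_list (map G w))"
    by (induction w) (simp_all add: is_at_zero is_at_mult assms)
  then show ?case using add
    by (simp add: quot.evaluate_add nc.evaluate_add quot.evaluate_single nc.evaluate_single
        is_at_add is_at_mult is_at_simps)
qed (simp add: nc.evaluate_zero quot.evaluate_zero is_at_zero)

section \<open>The defining relations under evaluation\<close>

context scalars
begin

lemma evaluate_qmat_relations:
  assumes "q \<noteq> 0" "quantum_matrix (\<kappa> q) (\<kappa> (inverse q)) X" "r \<in> qmat_relations n q"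
  shows "evaluate (\<lambda>(i, j). X i j) r = 0"
proof -
  note rel = quantum_matrix_relations[OF assms(2)]
  show ?thesis
    using assms(3) unfolding qmat_relations_def Let_def
  proof (elim UnE CollectE exE conjE; hypsubst)
    fix i j k :: nat assume "i < j"
    show "evaluate (\<lambda>(i, j). X i j) (gen (i, k) * gen (j, k) - q \<cdot> (gen (j, k) * gen (i, k))) = 0"
      by (simp add: evaluate_simps rel(1)[OF \<open>i < j\<close>])
    show "evaluate (\<lambda>(i, j). X i j) (gen (k, i) * gen (k, j) - q \<cdot> (gen (k, j) * gen (k, i))) = 0"
      by (simp add: evaluate_simps rel(2)[OF \<open>i < j\<close>])
  next
    fix i j k l :: nat assume o: "i < j" "k < l"
    show "evaluate (\<lambda>(i, j). X i j) (gen (i, l) * gen (j, k) - gen (j, k) * gen (i, l)) = 0"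
      by (simp add: evaluate_simps rel(3)[OF o])
    show "evaluate (\<lambda>(i, j). X i j) (gen (i, k) * gen (j, l) - gen (j, l) * gen (i, k)
        - (q - inverse q) \<cdot> (gen (i, l) * gen (j, k))) = 0"
      by (simp add: evaluate_simps rel(4)[OF o] \<kappa>_diff)
  qed
qed

lemma evaluate_qasym_relations:
  assumes q: "q \<noteq> 0"
    and Z: "q_scalars.quantum_antisym (\<kappa> q) (\<kappa> (inverse q)) Z"
    and r: "r \<in> qasym_relations n q"
  shows "evaluate (\<lambda>(i, j). Z i j) r = 0"
proof -
  interpret q_scalars "\<kappa> q" "\<kappa> (inverse q)" by (rule q_scalars[OF q])
  note D = quantum_antisymD[OF Z]
  have c: "Z i j * (\<kappa> a * y) = \<kappa> a * (Z i j * y)" for i j y a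
    by (metis \<kappa>_central mult.assoc)
  show ?thesis
    using r unfolding qasym_relations_def Let_def
  proof (elim UnE CollectE exE conjE; hypsubst)
    fix i
    show "evaluate (\<lambda>(i, j). Z i j) (gen (i, i)) = 0"
      by (simp add: evaluate_simps D(1))
  next
    fix i j :: nat assume o: "i < j"
    show "evaluate (\<lambda>(i, j). Z i j) (gen (i, j) + inverse q \<cdot> gen (j, i)) = 0"
      by (simp add: evaluate_simps D(2)[OF o] Q_cancel)
  next
    fix i j k :: nat assume o: "j < k" "i \<noteq> j" "i \<noteq> k"
    consider "i < j" | "j < i" "i < k" | "k < i" using o by linarith
    then have "Z i j * Z i k = \<kappa> q * (Z i k * Z i j)"
    proof cases
      case 1
      then show ?thesis using o by (simp add: D(4) Q_cancel)
    next
      case 2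
      then show ?thesis by (simp add: D(2)[of j i] D(5)[of j i k] c mult.assoc Q_cancel)
    next
      case 3
      then show ?thesis using o by (simp add: D(2)[of j i] D(2)[of k i] D(6)[of j k i] c mult.assoc Q_cancel)
    qed
    then show "evaluate (\<lambda>(i, j). Z i j) (gen (i, j) * gen (i, k) - q \<cdot> (gen (i, k) * gen (i, j))) = 0"
      by (simp add: evaluate_simps)
  next
    fix i j k l :: nat assume o: "i < j" "j < k" "k < l"
    show "evaluate (\<lambda>(i, j). Z i j) (gen (i, l) * gen (j, k) - gen (j, k) * gen (i, l)) = 0"
      by (simp add: evaluate_simps D(3)[OF o])
    show "evaluate (\<lambda>(i, j). Z i j) (gen (i, k) * gen (j, l) - gen (j, l) * gen (i, k)
        - (q - inverse q) \<cdot> (gen (i, l) * gen (j, k))) = 0"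
      by (simp add: evaluate_simps D(7)[OF o] \<kappa>_diff)
    show "evaluate (\<lambda>(i, j). Z i j) (gen (i, j) * gen (k, l) - gen (k, l) * gen (i, j)
        - ((q - inverse q) \<cdot> (gen (i, k) * gen (j, l)) - (q * (q - inverse q)) \<cdot> (gen (i, l) * gen (j, k)))) = 0"
      by (simp add: evaluate_simps D(8)[OF o] \<kappa>_diff \<kappa>_mult mult.assoc)
  qed
qed

end

section \<open>Spanning by sorted words\<close>

lemma qasym_relationsI:
  "i \<in> {1..2*n} \<Longrightarrow> gen (i, i) \<in> qasym_relations n q"
  "i \<in> {1..2*n} \<Longrightarrow> j \<in> {1..2*n} \<Longrightarrow> i < j \<Longrightarrow>
     gen (i, j) + inverse q \<cdot> gen (j, i) \<in> qasym_relations n q"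
  "i \<in> {1..2*n} \<Longrightarrow> j \<in> {1..2*n} \<Longrightarrow> k \<in> {1..2*n} \<Longrightarrow> l \<in> {1..2*n} \<Longrightarrow> i < j \<Longrightarrow> j < k \<Longrightarrow> k < l \<Longrightarrow>
     gen (i, l) * gen (j, k) - gen (j, k) * gen (i, l) \<in> qasym_relations n q"
  "i \<in> {1..2*n} \<Longrightarrow> j \<in> {1..2*n} \<Longrightarrow> k \<in> {1..2*n} \<Longrightarrow> j < k \<Longrightarrow> i \<noteq> j \<Longrightarrow> i \<noteq> k \<Longrightarrow>
     gen (i, j) * gen (i, k) - q \<cdot> (gen (i, k) * gen (i, j)) \<in> qasym_relations n q"
  "i \<in> {1..2*n} \<Longrightarrow> j \<in> {1..2*n} \<Longrightarrow> k \<in> {1..2*n} \<Longrightarrow> l \<in> {1..2*n} \<Longrightarrow> i < j \<Longrightarrow> j < k \<Longrightarrow> k < l \<Longrightarrow>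
     gen (i, k) * gen (j, l) - gen (j, l) * gen (i, k) - (q - inverse q) \<cdot> (gen (i, l) * gen (j, k))
       \<in> qasym_relations n q"
  "i \<in> {1..2*n} \<Longrightarrow> j \<in> {1..2*n} \<Longrightarrow> k \<in> {1..2*n} \<Longrightarrow> l \<in> {1..2*n} \<Longrightarrow> i < j \<Longrightarrow> j < k \<Longrightarrow> k < l \<Longrightarrow>
     gen (i, j) * gen (k, l) - gen (k, l) * gen (i, j)
       - ((q - inverse q) \<cdot> (gen (i, k) * gen (j, l)) - (q * (q - inverse q)) \<cdot> (gen (i, l) * gen (j, k)))
       \<in> qasym_relations n q"
  unfolding qasym_relations_def Let_def
  subgoal by (rule UnI1, rule UnI1, rule UnI1, rule UnI1, rule UnI1) blast
  subgoal by (rule UnI1, rule UnI1, rule UnI1, rule UnI1, rule UnI2) blast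
  subgoal by (rule UnI1, rule UnI1, rule UnI1, rule UnI2) blast
  subgoal by (rule UnI1, rule UnI1, rule UnI2) blast
  subgoal by (rule UnI1, rule UnI2) blast
  subgoal by (rule UnI2) blast
  done

locale skew_relations =
  fixes n :: nat and q :: complex
  assumes q_nonzero: "q \<noteq> 0"
begin

sublocale q_scalars "ncconst q :: (nat \<times> nat) ncpoly" "ncconst (inverse q)"
  by (rule nc.q_scalars[OF q_nonzero])

abbreviation "X \<equiv> index_pairs n"
definition "I = Idl\<^bsub>free_algebra X\<^esub> qasym_relations n q"

lemma relations_subset: "qasym_relations n q \<subseteq> words_over X"
  unfolding qasym_relations_def Let_def
  by (intro subsetI; elim UnE CollectE exE conjE; hypsubst; intro words_over_intros; simp)

lemma ideal_I: "ideal I (free_algebra X)"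
  unfolding I_def by (rule free.genideal_ideal[OF relations_subset])

lemmas I_closed = ideal_free_algebraD[OF ideal_I]

lemma relation_in_I: "r \<in> qasym_relations n q \<Longrightarrow> r \<in> I"
  unfolding I_def using free.genideal_self[OF relations_subset] by blast

lemma word_in: "set w \<subseteq> X \<Longrightarrow> Poly_Mapping.single w c \<in> words_over X"
  by (rule words_over_single)

lemma const_in: "ncconst c \<in> words_over X"
  by (rule words_over_single) simp

lemmas mult_I = I_closed(4)[OF _ const_in]

lemma skew_symmetry:
  assumes "1 \<le> i" "i < j" "j \<le> 2 * n"
  shows "gen (j, i) + ncconst q * gen (i, j) \<in> I"
proof -
  have "gen (i, j) + inverse q \<cdot> gen (j, i) \<in> I"
    by (intro relation_in_I qasym_relationsI) (use assms in auto)
  from mult_I[OF this, of q] show ?thesis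
    by (simp add: scal_def distrib_left Q_cancel add.commute)
qed

lemma q_commutation:
  assumes "i \<in> {1..2*n}" "j \<in> {1..2*n}" "k \<in> {1..2*n}" "j < k" "i \<noteq> j" "i \<noteq> k"
  shows "gen (i, j) * gen (i, k) - ncconst q * (gen (i, k) * gen (i, j)) \<in> I"
proof -
  have "gen (i, j) * gen (i, k) - q \<cdot> (gen (i, k) * gen (i, j)) \<in> I"
    by (intro relation_in_I qasym_relationsI) (use assms in auto)
  then show ?thesis by (simp add: scal_def)
qed

text \<open>
  The three relations with a shared index, rewritten for generators with increasing indices. This
  uses skew symmetry to reverse the order of the indices in those generators for which the
  shared index is the larger one.
\<close>

lemma commutation_shared:
  assumes o: "1 \<le> i" "i < j" "j < k" "k \<le> 2 * n"
  shows "gen (i, k) * gen (i, j) - ncconst (inverse q) * (gen (i, j) * gen (i, k)) \<in> I"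
    and "gen (j, k) * gen (i, j) - ncconst (inverse q) * (gen (i, j) * gen (j, k)) \<in> I"
    and "gen (j, k) * gen (i, k) - ncconst (inverse q) * (gen (i, k) * gen (j, k)) \<in> I"
proof -
  let ?Q = "ncconst q :: (nat \<times> nat) ncpoly" and ?Qi = "ncconst (inverse q) :: (nat \<times> nat) ncpoly"
  have cen: "gen x * ?Q = ?Q * gen x" "gen x * ?Qi = ?Qi * gen x" for x :: "nat \<times> nat"
    by (rule Q_central[symmetric] Qi_central[symmetric])+
  note r = cen cen[THEN assoc_rule] Q_cancel Q_inv Qi_inv
  have mult_gen: "x \<in> X \<Longrightarrow> p \<in> I \<Longrightarrow> gen x * p \<in> I" "x \<in> X \<Longrightarrow> p \<in> I \<Longrightarrow> p * gen x \<in> I" for x p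
    by (intro I_closed(4,5) words_over_gen; assumption)+
  note cl = q_commutation I_closed(3,6,7) mult_I mult_gen
  have "- (?Qi * (gen (i, j) * gen (i, k) - ?Q * (gen (i, k) * gen (i, j)))) \<in> I"
    by (intro cl) (use o in auto)
  then show "gen (i, k) * gen (i, j) - ?Qi * (gen (i, j) * gen (i, k)) \<in> I"
    by (simp add: r algebra_simps)
  define b where "b = gen (j, i) + ?Q * gen (i, j)"
  define b' where "b' = gen (k, i) + ?Q * gen (i, k)"
  define b'' where "b'' = gen (k, j) + ?Q * gen (j, k)"
  have b: "b \<in> I" "b' \<in> I" "b'' \<in> I"
    unfolding b_def b'_def b''_def by (intro skew_symmetry; use o in simp)+
  \<comment> \<open>Multiples of \<open>b\<close>, \<open>b'\<close>, \<open>b''\<close> exchange, one at a time, the generators with decreasing indices.\<close>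
  have "- (?Qi * (?Qi * (b * gen (j, k) - (gen (j, i) * gen (j, k) - ?Q * (gen (j, k) * gen (j, i)))
      - ?Q * (gen (j, k) * b)))) \<in> I"
    by (intro b cl) (use o in auto)
  then show "gen (j, k) * gen (i, j) - ?Qi * (gen (i, j) * gen (j, k)) \<in> I"
    unfolding b_def by (simp add: r algebra_simps)
  have "- (?Qi * (?Qi * (?Qi * ((gen (k, i) * gen (k, j) - ?Q * (gen (k, j) * gen (k, i))) - b' * gen (k, j)
      + ?Q * (gen (i, k) * b'') + ?Q * (gen (k, j) * b') - ?Q * (?Q * (b'' * gen (i, k))))))) \<in> I"
    by (intro b cl) (use o in auto)
  then show "gen (j, k) * gen (i, k) - ?Qi * (gen (i, k) * gen (j, k)) \<in> I"
    unfolding b'_def b''_def by (simp add: r algebra_simps)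
qed

lemma commutation_disjoint:
  assumes o: "1 \<le> i" "i < j" "j < k" "k < l" "l \<le> 2 * n"
  shows "gen (j, k) * gen (i, l) - gen (i, l) * gen (j, k) \<in> I"
    and "gen (j, l) * gen (i, k) - (gen (i, k) * gen (j, l)
      - ncconst (q - inverse q) * (gen (i, l) * gen (j, k))) \<in> I"
    and "gen (k, l) * gen (i, j) - (gen (i, j) * gen (k, l)
      - (ncconst (q - inverse q) * (gen (i, k) * gen (j, l))
         - ncconst (q * (q - inverse q)) * (gen (i, l) * gen (j, k)))) \<in> I"
proof -
  have "gen (i, l) * gen (j, k) - gen (j, k) * gen (i, l) \<in> I"
    by (intro relation_in_I qasym_relationsI) (use o in auto)
  from I_closed(7)[OF this]
  show "gen (j, k) * gen (i, l) - gen (i, l) * gen (j, k) \<in> I" by simp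
  have "gen (i, k) * gen (j, l) - gen (j, l) * gen (i, k)
      - (q - inverse q) \<cdot> (gen (i, l) * gen (j, k)) \<in> I"
    by (intro relation_in_I qasym_relationsI) (use o in auto)
  from I_closed(7)[OF this]
  show "gen (j, l) * gen (i, k) - (gen (i, k) * gen (j, l)
      - ncconst (q - inverse q) * (gen (i, l) * gen (j, k))) \<in> I" by (simp add: scal_def algebra_simps)
  have "gen (i, j) * gen (k, l) - gen (k, l) * gen (i, j)
      - ((q - inverse q) \<cdot> (gen (i, k) * gen (j, l)) - (q * (q - inverse q)) \<cdot> (gen (i, l) * gen (j, k))) \<in> I"
    by (intro relation_in_I qasym_relationsI) (use o in auto)
  from I_closed(7)[OF this]
  show "gen (k, l) * gen (i, j) - (gen (i, j) * gen (k, l)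
      - (ncconst (q - inverse q) * (gen (i, k) * gen (j, l))
         - ncconst (q * (q - inverse q)) * (gen (i, l) * gen (j, k)))) \<in> I" by (simp add: scal_def algebra_simps)
qed

text \<open>
  Words are compared first by length and then lexicographically. This order is well founded, and
  that is all that termination of the rewriting needs: read as rewrite rules, the
  relations replace a word of length at most two by words of the same length with a smaller first
  letter.
\<close>

abbreviation smaller :: "((nat \<times> nat) list \<times> (nat \<times> nat) list) set" where
  "smaller \<equiv> lenlex {(x, y). x < y}"

definition reduces :: "(nat \<times> nat) list \<Rightarrow> (nat \<times> nat) ncpoly \<Rightarrow> bool" where
  "reduces w t \<longleftrightarrow> t \<in> words_over X \<and> Poly_Mapping.single w 1 - t \<in> I \<and>
     (\<forall>v\<in>Poly_Mapping.keys t. (v, w) \<in> smaller)"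

lemma reduces_append:
  assumes "reduces w t" "set u \<subseteq> X" "set v \<subseteq> X"
  shows "reduces (u @ w @ v) (Poly_Mapping.single u 1 * t * Poly_Mapping.single v 1)"
  unfolding reduces_def
proof (intro conjI ballI)
  let ?u = "Poly_Mapping.single u 1 :: (nat \<times> nat) ncpoly" and ?v = "Poly_Mapping.single v 1 :: (nat \<times> nat) ncpoly"
  note t = assms(1)[unfolded reduces_def]
  show "?u * t * ?v \<in> words_over X"
    using t by (intro words_over_mult word_in assms) auto
  have "?u * (Poly_Mapping.single w 1 - t) * ?v \<in> I"
    using t by (intro I_closed(4,5) word_in assms) auto
  then show "Poly_Mapping.single (u @ w @ v) 1 - ?u * t * ?v \<in> I"
    by (simp add: left_diff_distrib right_diff_distrib mult_single plus_list_def)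
  fix x assume "x \<in> Poly_Mapping.keys (?u * t * ?v)"
  from subsetD[OF Poly_Mapping.keys_mult this] obtain z where z: "z \<in> Poly_Mapping.keys (?u * t)" "x = z @ v"
    by (auto simp: plus_list_def)
  from subsetD[OF Poly_Mapping.keys_mult z(1)] obtain y where y: "y \<in> Poly_Mapping.keys t" "x = u @ y @ v"
    using z(2) by (auto simp: plus_list_def)
  have "irrefl {(x, y :: nat \<times> nat). x < y}" by (simp add: irrefl_def)
  then show "(x, u @ w @ v) \<in> smaller"
    using y t by (simp add: lenlex_append1)
qed

lemma gen_word: "gen x * gen y = Poly_Mapping.single [x, y] 1" "gen x = Poly_Mapping.single [x] 1"
  "ncconst c * Poly_Mapping.single w a = Poly_Mapping.single w (c * a)"
  by (simp_all add: gen_def mult_single plus_list_def)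

lemma reduces_letter:
  assumes "i \<in> {1..2*n}" "j \<in> {1..2*n}" "j \<le> i"
  shows "\<exists>t. reduces [(i, j)] t"
proof (cases "i = j")
  case True
  have "gen (i, i) \<in> I"
    by (intro relation_in_I qasym_relationsI) (use assms in auto)
  then have "reduces [(i, j)] 0" using True by (simp add: reduces_def words_over_zero gen_word)
  then show ?thesis by blast
next
  case False
  then have "gen (i, j) + ncconst q * gen (j, i) \<in> I" using assms by (intro skew_symmetry) auto
  moreover have "- Poly_Mapping.single [(j, i)] q \<in> words_over X"
    by (intro words_over_minus word_in) (use assms in auto)
  ultimately have "reduces [(i, j)] (- Poly_Mapping.single [(j, i)] q)"
    using False assms q_nonzero by (simp add: reduces_def gen_word Cons_lenlex_iff)
  then show ?thesis by blast
qed

lemma reduces_pair: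
  assumes x: "x \<in> X" "fst x < snd x" and y: "y \<in> X" "fst y < snd y" and "x < y"
  shows "\<exists>t. reduces [y, x] t"
proof -
  define W where "W = {[u, v] | u v. u \<in> X \<and> v \<in> X \<and> u < y}"
  have red: "\<exists>t. reduces [y, x] t" if "gen y * gen x - t \<in> I" "Poly_Mapping.keys t \<subseteq> W" for t
  proof (intro exI)
    have "Poly_Mapping.single [y, x] 1 - t \<in> I" using that(1) by (simp only: gen_word(1))
    moreover have "t \<in> words_over X" using that(2) by (fastforce simp: words_over_iff W_def)
    moreover have "(v, [y, x]) \<in> smaller" if "v \<in> W" for v
      using that by (auto simp: W_def Cons_lenlex_iff)
    ultimately show "reduces [y, x] t" using that(2) unfolding reduces_def by blast
  qed
  have keys: "Poly_Mapping.keys (Poly_Mapping.single w e - p) \<subseteq> W"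
    if "w \<in> W" "Poly_Mapping.keys p \<subseteq> W" for w e and p :: "(nat \<times> nat) ncpoly"
    using keys_diff[of "Poly_Mapping.single w e" p] that by (auto split: if_splits)
  have keys1: "Poly_Mapping.keys (Poly_Mapping.single w e :: (nat \<times> nat) ncpoly) \<subseteq> W"
    if "w \<in> W" for w e using that by auto
  obtain a b c d where xy: "x = (a, b)" "y = (c, d)" by (metis prod.exhaust)
  have W: "[(i, j), (k, l)] \<in> W"
    if "i < c \<or> i = c \<and> j < d" "i \<in> {1..2*n}" "j \<in> {1..2*n}" "k \<in> {1..2*n}" "l \<in> {1..2*n}" for i j k l
    using that by (auto simp: W_def xy(2))
  have rng: "1 \<le> a" "a < b" "b \<le> 2 * n" "1 \<le> c" "c < d" "d \<le> 2 * n" using x y by (auto simp: xy)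
  have "a < c \<or> a = c \<and> b < d" using \<open>x < y\<close> by (auto simp: xy)
  then consider "a = c" "b < d" | "b = c" | "a < c" "b = d" | "b < c" | "a < c" "c < b" "b < d" | "a < c" "d < b"
    by linarith
  then show ?thesis
  proof cases
    case 1
    show ?thesis
    proof (rule red)
      show "gen y * gen x - ncconst (inverse q) * (gen x * gen y) \<in> I"
        using commutation_shared(1)[of a b d] 1 rng by (simp add: xy)
      show "Poly_Mapping.keys (ncconst (inverse q) * (gen x * gen y)) \<subseteq> W"
        unfolding gen_word(1,3) xy by (intro keys1 W) (use 1 rng in auto)
    qed
  next
    case 2
    show ?thesis
    proof (rule red)
      show "gen y * gen x - ncconst (inverse q) * (gen x * gen y) \<in> I"
        using commutation_shared(2)[of a b d] 2 rng by (simp add: xy)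
      show "Poly_Mapping.keys (ncconst (inverse q) * (gen x * gen y)) \<subseteq> W"
        unfolding gen_word(1,3) xy by (intro keys1 W) (use 2 rng in auto)
    qed
  next
    case 3
    show ?thesis
    proof (rule red)
      show "gen y * gen x - ncconst (inverse q) * (gen x * gen y) \<in> I"
        using commutation_shared(3)[of a c b] 3 rng by (simp add: xy)
      show "Poly_Mapping.keys (ncconst (inverse q) * (gen x * gen y)) \<subseteq> W"
        unfolding gen_word(1,3) xy by (intro keys1 W) (use 3 rng in auto)
    qed
  next
    case 4
    show ?thesis
    proof (rule red)
      show "gen y * gen x - (gen (a, b) * gen (c, d) - (ncconst (q - inverse q) * (gen (a, c) * gen (b, d))
          - ncconst (q * (q - inverse q)) * (gen (a, d) * gen (b, c)))) \<in> I"
        unfolding xy by (rule commutation_disjoint(3)) (use 4 rng in auto)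
      show "Poly_Mapping.keys (gen (a, b) * gen (c, d) - (ncconst (q - inverse q) * (gen (a, c) * gen (b, d))
          - ncconst (q * (q - inverse q)) * (gen (a, d) * gen (b, c)))) \<subseteq> W"
        unfolding gen_word(1,3) by (intro keys keys1 W) (use 4 rng in auto)
    qed
  next
    case 5
    show ?thesis
    proof (rule red)
      show "gen y * gen x - (gen (a, b) * gen (c, d)
          - ncconst (q - inverse q) * (gen (a, d) * gen (c, b))) \<in> I"
        unfolding xy by (rule commutation_disjoint(2)) (use 5 rng in auto)
      show "Poly_Mapping.keys (gen (a, b) * gen (c, d)
          - ncconst (q - inverse q) * (gen (a, d) * gen (c, b))) \<subseteq> W"
        unfolding gen_word(1,3) by (intro keys keys1 W) (use 5 rng in auto)
    qed
  next
    case 6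
    show ?thesis
    proof (rule red)
      show "gen y * gen x - gen (a, b) * gen (c, d) \<in> I"
        unfolding xy by (rule commutation_disjoint(1)) (use 6 rng in auto)
      show "Poly_Mapping.keys (gen (a, b) * gen (c, d)) \<subseteq> W"
        unfolding gen_word(1,3) by (intro keys1 W) (use 6 rng in auto)
    qed
  qed
qed

definition normal :: "(nat \<times> nat) list \<Rightarrow> bool" where
  "normal w \<longleftrightarrow> sorted w \<and> set w \<subseteq> {(i, j). 1 \<le> i \<and> i < j \<and> j \<le> 2 * n}"

lemma not_sorted_split: "\<not> sorted w \<Longrightarrow> \<exists>u x y v. w = u @ [y, x] @ v \<and> x < (y :: 'a::linorder)"
proof (induction w)
  case (Cons a w)
  show ?case
  proof (cases "sorted w")
    case True
    then obtain b v where w: "w = b # v" "b < a"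
      using Cons.prems by (cases w) (auto simp del: sorted_simps simp add: sorted1 sorted2 not_le)
    then show ?thesis by (intro exI[of _ "[]"] exI[of _ b] exI[of _ a] exI[of _ v]) simp
  next
    case False
    then obtain u x y v where "w = u @ [y, x] @ v" "x < y" using Cons.IH by blast
    then show ?thesis by (intro exI[of _ "a # u"] exI[of _ x] exI[of _ y] exI[of _ v]) simp
  qed
qed simp

lemma reducible:
  assumes w: "set w \<subseteq> X" and "\<not> normal w"
  shows "\<exists>t. reduces w t"
proof (cases "set w \<subseteq> {(i, j). i < j}")
  case True
  with assms have "\<not> sorted w" by (auto simp: normal_def)
  then obtain u x y v where split: "w = u @ [y, x] @ v" "x < y" using not_sorted_split by blast
  have "\<exists>t. reduces [y, x] t"
    by (rule reduces_pair) (use split w True in auto)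
  then obtain t where "reduces [y, x] t" by blast
  from reduces_append[OF this, of u v] show ?thesis using split w by auto
next
  case False
  then obtain i j where ij: "(i, j) \<in> set w" "j \<le> i" by (metis (no_types, lifting) case_prodI mem_Collect_eq not_le subrelI)
  then obtain u v where split: "w = u @ [(i, j)] @ v" by (metis append_Cons append_Nil split_list)
  have "\<exists>t. reduces [(i, j)] t"
    by (rule reduces_letter) (use ij w in auto)
  then obtain t where "reduces [(i, j)] t" by blast
  from reduces_append[OF this, of u v] show ?thesis using split w by auto
qed

definition normalizes :: "(nat \<times> nat) ncpoly \<Rightarrow> (nat \<times> nat) ncpoly \<Rightarrow> bool" where
  "normalizes p r \<longleftrightarrow> p - r \<in> I \<and> Poly_Mapping.keys r \<subseteq> {w. normal w}"

lemma normalizes_combination: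
  assumes "\<And>w. w \<in> Poly_Mapping.keys p \<Longrightarrow> \<exists>r. normalizes (Poly_Mapping.single w 1) r"
  shows "\<exists>r. normalizes p r"
proof -
  obtain r where r: "\<And>w. w \<in> Poly_Mapping.keys p \<Longrightarrow> normalizes (Poly_Mapping.single w 1) (r w)"
    using assms by metis
  let ?c = "\<lambda>w. ncconst (Poly_Mapping.lookup p w) :: (nat \<times> nat) ncpoly"
  let ?r = "\<Sum>w\<in>Poly_Mapping.keys p. ?c w * r w"
  have "p = (\<Sum>w\<in>Poly_Mapping.keys p. ?c w * Poly_Mapping.single w 1)"
    using evaluate_gen_id[of p] by (simp add: nc.evaluate_def word_monomial)
  then have "p - ?r = (\<Sum>w\<in>Poly_Mapping.keys p. ?c w * (Poly_Mapping.single w 1 - r w))"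
    by (simp add: right_diff_distrib sum_subtractf)
  moreover have "(\<Sum>w\<in>W. ?c w * (Poly_Mapping.single w 1 - r w)) \<in> I"
    if "W \<subseteq> Poly_Mapping.keys p" for W
    using finite_subset[OF that finite_keys] that
    by (induction W rule: finite_induct)
      (auto intro!: I_closed(2,3) mult_I simp: r[unfolded normalizes_def])
  moreover have "Poly_Mapping.keys ?r \<subseteq> {w. normal w}"
  proof -
    have "Poly_Mapping.keys (?c w * r w) \<subseteq> Poly_Mapping.keys (r w)" for w
      using Poly_Mapping.keys_mult[of "?c w" "r w"] by (auto simp: plus_list_def split: if_splits)
    then have "Poly_Mapping.keys (?c w * r w) \<subseteq> {w. normal w}" if "w \<in> Poly_Mapping.keys p" for w
      using r[OF that] unfolding normalizes_def by blast
    then show ?thesis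
      using keys_sum[of "\<lambda>w. ?c w * r w" "Poly_Mapping.keys p"] by blast
  qed
  ultimately show ?thesis unfolding normalizes_def by (intro exI[of _ ?r]) auto
qed

text \<open>
  Well-founded induction on words: a word that is not normal has a reducible letter or an adjacent
  pair of letters in the wrong order.
\<close>

theorem normal_form:
  assumes "p \<in> words_over X"
  shows "\<exists>r. normalizes p r"
proof (rule normalizes_combination)
  fix w assume "w \<in> Poly_Mapping.keys p"
  then have "set w \<subseteq> X" using assms by (simp add: words_over_iff)
  have "wf smaller" by (rule wf_lenlex) (rule wf)
  then show "\<exists>r. normalizes (Poly_Mapping.single w 1) r"
    using \<open>set w \<subseteq> X\<close>
  proof (induction w rule: wf_induct_rule)
    case (less w)
    show ?case
    proof (cases "normal w")
      case True
      then show ?thesis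
        by (intro exI[of _ "Poly_Mapping.single w 1"]) (simp add: normalizes_def I_closed)
    next
      case False
      then obtain t where t: "reduces w t" using reducible less.prems by blast
      then have "\<exists>r. normalizes (Poly_Mapping.single v 1) r" if "v \<in> Poly_Mapping.keys t" for v
        using that less.IH[of v] by (auto simp: reduces_def words_over_iff)
      then obtain r where r: "normalizes t r" using normalizes_combination by blast
      have "(Poly_Mapping.single w 1 - t) + (t - r) \<in> I"
        using t r by (intro I_closed(3)) (auto simp: reduces_def normalizes_def)
      then show ?thesis using r by (intro exI[of _ r]) (simp add: normalizes_def)
    qed
  qed
qed

end

section \<open>Subalgebras with known relations\<close>

lemma quot_algebra_fields:
  "carrier (quot_algebra A I) = carrier (A Quot I)"
  "monoid.mult (quot_algebra A I) = monoid.mult (A Quot I)"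
  "add (quot_algebra A I) = add (A Quot I)"
  "one (quot_algebra A I) = one (A Quot I)"
  "zero (quot_algebra A I) = zero (A Quot I)"
  "smult (quot_algebra A I) = (\<lambda>c S. \<Union>p\<in>S. I +>\<^bsub>A\<^esub> (smult A c p))"
  by (simp_all add: quot_algebra_def ring.defs module.defs)

abbreviation coset :: "'a set \<Rightarrow> 'a ncpoly set \<Rightarrow> 'a ncpoly \<Rightarrow> 'a ncpoly set" where
  "coset X I p \<equiv> I +>\<^bsub>free_algebra X\<^esub> p"

lemma coset_eq: "coset X I p = {h + p | h. h \<in> I}"
  by (auto simp: a_r_coset_def r_coset_def)

context
  fixes X :: "'a set" and I :: "'a ncpoly set"
  assumes I: "ideal I (free_algebra X)"
begin

lemma coset_eq_iff: "coset X I p = coset X I r \<longleftrightarrow> p - r \<in> I"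
proof
  assume "coset X I p = coset X I r"
  moreover have "p \<in> coset X I p" using ideal_free_algebraD(2)[OF I] by (force simp: coset_eq)
  ultimately obtain h where "h \<in> I" "p = h + r" by (auto simp: coset_eq)
  then show "p - r \<in> I" by simp
next
  assume pr: "p - r \<in> I"
  have sub: "coset X I a \<subseteq> coset X I b" if ab: "a - b \<in> I" for a b
  proof
    fix x assume "x \<in> coset X I a"
    then obtain h where h: "h \<in> I" "x = h + a" by (auto simp: coset_eq)
    then have "x = (h + (a - b)) + b" by simp
    moreover have "h + (a - b) \<in> I" by (rule ideal_free_algebraD(3)[OF I h(1) ab])
    ultimately show "x \<in> coset X I b" unfolding coset_eq by blast
  qed
  have "- (p - r) \<in> I" by (rule ideal_free_algebraD(7)[OF I pr])
  then have "r - p \<in> I" by simp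
  then show "coset X I p = coset X I r" using sub pr by (intro equalityI) blast+
qed

lemma coset_carrier: "carrier (quot_algebra (free_algebra X) I) = coset X I ` words_over X"
  by (auto simp: quot_algebra_fields FactRing_def A_RCOSETS_def')

lemma coset_ops:
  assumes "p \<in> words_over X" "r \<in> words_over X"
  shows "coset X I p \<otimes>\<^bsub>quot_algebra (free_algebra X) I\<^esub> coset X I r = coset X I (p * r)"
    and "coset X I p \<oplus>\<^bsub>quot_algebra (free_algebra X) I\<^esub> coset X I r = coset X I (p + r)"
    and "\<one>\<^bsub>quot_algebra (free_algebra X) I\<^esub> = coset X I 1"
    and "c \<odot>\<^bsub>quot_algebra (free_algebra X) I\<^esub> coset X I p = coset X I (c \<cdot> p)"
proof -
  note hom = ideal.rcos_ring_hom[OF I]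
  show "coset X I p \<otimes>\<^bsub>quot_algebra (free_algebra X) I\<^esub> coset X I r = coset X I (p * r)"
    using ring_hom_mult[OF hom assms] by (simp add: quot_algebra_fields)
  show "coset X I p \<oplus>\<^bsub>quot_algebra (free_algebra X) I\<^esub> coset X I r = coset X I (p + r)"
    using ring_hom_add[OF hom assms] by (simp add: quot_algebra_fields)
  show "\<one>\<^bsub>quot_algebra (free_algebra X) I\<^esub> = coset X I 1"
    using ring_hom_one[OF hom] by (simp add: quot_algebra_fields)
  have "coset X I (c \<cdot> p') = coset X I (c \<cdot> p)" if "p' \<in> coset X I p" for p'
  proof -
    have "p' - p \<in> I" using that by (auto simp: coset_eq)
    then have "c \<cdot> (p' - p) \<in> I" by (rule ideal_free_algebraD(8)[OF I])
    then show ?thesis unfolding coset_eq_iff by (simp add: scal_def right_diff_distrib)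
  qed
  moreover have "p \<in> coset X I p" using ideal_free_algebraD(2)[OF I] by (force simp: coset_eq)
  ultimately have "(\<Union>p'\<in>coset X I p. coset X I (c \<cdot> p')) = coset X I (c \<cdot> p)" by blast
  then show "c \<odot>\<^bsub>quot_algebra (free_algebra X) I\<^esub> coset X I p = coset X I (c \<cdot> p)"
    by (simp only: quot_algebra_fields free_algebra_ops)
qed

end

lemma quotient_a_inv:
  assumes "ideal I (free_algebra X)" "p \<in> words_over X"
  shows "\<ominus>\<^bsub>quot_algebra (free_algebra X) I\<^esub> (coset X I p) = coset X I (- p)"
proof -
  interpret ring_hom_ring "free_algebra X" "free_algebra X Quot I" "coset X I"
    by (rule ideal.rcos_ring_hom_ring[OF assms(1)])
  have "\<ominus>\<^bsub>quot_algebra (free_algebra X) I\<^esub> (coset X I p) = \<ominus>\<^bsub>free_algebra X Quot I\<^esub> (coset X I p)"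
    by (simp only: a_inv_def m_inv_def quot_algebra_fields partial_object.simps monoid.simps)
  also have "\<dots> = coset X I (- p)"
    unfolding hom_a_inv[OF assms(2), symmetric] free_a_inv[OF assms(2)] ..
  finally show ?thesis .
qed

lemma evaluate_words_over:
  assumes f: "\<And>x. x \<in> X \<Longrightarrow> f x \<in> words_over Y" and p: "p \<in> words_over X"
  shows "nc.evaluate f p \<in> words_over Y"
  unfolding nc.evaluate_def
proof (rule words_over_sum)
  fix w assume "w \<in> Poly_Mapping.keys p"
  then have "set w \<subseteq> X" using p by (simp add: words_over_iff)
  then have "prod_list (map f w) \<in> words_over Y"
    by (induction w) (auto intro: words_over_one words_over_mult f)
  then show "ncconst (Poly_Mapping.lookup p w) * prod_list (map f w) \<in> words_over Y"
    by (intro words_over_mult words_over_single) auto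
qed

text \<open>
  The substitution of \<open>f x\<close> for \<open>x\<close> followed by the projection modulo \<open>J\<close> is a homomorphism from the
  free algebra. Its image is the generated subalgebra and its kernel is \<open>I\<close> by hypothesis, so this
  is the homomorphism theorem. The isomorphism maps the value at \<open>p\<close> back to the class of \<open>p\<close>.
\<close>

theorem presented_subalgebra:
  fixes X :: "'a set" and Y :: "'b set" and f :: "'a \<Rightarrow> 'b ncpoly"
  assumes J: "ideal J (free_algebra Y)" and I: "ideal I (free_algebra X)"
    and f: "\<And>x. x \<in> X \<Longrightarrow> f x \<in> words_over Y"
    and kernel: "\<And>p. p \<in> words_over X \<Longrightarrow> nc.evaluate f p \<in> J \<longleftrightarrow> p \<in> I"
  shows "algebra_isomorphic
    (generated_subalgebra (quot_algebra (free_algebra Y) J) ((\<lambda>x. coset Y J (f x)) ` X))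
    (quot_algebra (free_algebra X) I)"
proof -
  let ?A = "quot_algebra (free_algebra Y) J" and ?B = "quot_algebra (free_algebra X) I"
  let ?G = "generate_ring ?A (range (\<lambda>c. c \<odot>\<^bsub>?A\<^esub> \<one>\<^bsub>?A\<^esub>) \<union> (\<lambda>x. coset Y J (f x)) ` X)"
  define \<phi> where "\<phi> p = coset Y J (nc.evaluate f p)" for p
  have one: "1 \<in> words_over Z" for Z :: "'c set" by (rule words_over_one)
  have ev: "nc.evaluate f p \<in> words_over Y" if "p \<in> words_over X" for p
    by (rule evaluate_words_over[of X, OF _ that]) (rule f)
  have \<phi>_mult: "\<phi> (p * r) = \<phi> p \<otimes>\<^bsub>?A\<^esub> \<phi> r" and \<phi>_add: "\<phi> (p + r) = \<phi> p \<oplus>\<^bsub>?A\<^esub> \<phi> r"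
    and \<phi>_scal: "\<phi> (c \<cdot> p) = c \<odot>\<^bsub>?A\<^esub> \<phi> p"
    if "p \<in> words_over X" "r \<in> words_over X" for p r c
    using coset_ops(1,2)[OF J ev[OF that(1)] ev[OF that(2)]] coset_ops(4)[OF J ev[OF that(1)] one]
    unfolding \<phi>_def by (simp_all only: nc.evaluate_mult nc.evaluate_add nc.evaluate_scal scal_def[symmetric])
  have \<phi>_one: "\<phi> 1 = \<one>\<^bsub>?A\<^esub>"
    using coset_ops(3)[OF J one one] unfolding \<phi>_def by (simp only: nc.evaluate_one)
  have \<phi>_minus: "\<phi> (- p) = \<ominus>\<^bsub>?A\<^esub> \<phi> p" if "p \<in> words_over X" for p
    using quotient_a_inv[OF J ev[OF that]] unfolding \<phi>_def by (simp only: nc.evaluate_minus)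
  have \<phi>_eq: "\<phi> p = \<phi> r \<longleftrightarrow> coset X I p = coset X I r"
    if "p \<in> words_over X" "r \<in> words_over X" for p r
    using kernel[OF words_over_diff[OF that]]
    unfolding \<phi>_def coset_eq_iff[OF J] coset_eq_iff[OF I] nc.evaluate_diff .
  have "\<phi> ` words_over X = ?G"
  proof
    have single: "\<phi> (Poly_Mapping.single w c) \<in> ?G" if "set w \<subseteq> X" for w c
      using that
    proof (induction w)
      case Nil
      have "Poly_Mapping.single [] c = c \<cdot> (1 :: 'a ncpoly)" by (simp add: scal_def)
      then have "\<phi> (Poly_Mapping.single [] c) = c \<odot>\<^bsub>?A\<^esub> \<one>\<^bsub>?A\<^esub>"
        using \<phi>_scal[OF one one] \<phi>_one by simp
      then show ?case by (auto intro: generate_ring.incl)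
    next
      case (Cons x w)
      have "Poly_Mapping.single (x # w) c = gen x * Poly_Mapping.single w c"
        by (simp add: gen_def mult_single plus_list_def)
      then have "\<phi> (Poly_Mapping.single (x # w) c) = coset Y J (f x) \<otimes>\<^bsub>?A\<^esub> \<phi> (Poly_Mapping.single w c)"
        using Cons.prems \<phi>_mult[OF words_over_gen words_over_single] by (simp add: \<phi>_def nc.evaluate_gen)
      then show ?case using Cons by (auto intro!: generate_ring.eng_mult intro: generate_ring.incl)
    qed
    have zero: "\<phi> 0 \<in> ?G"
      using single[of "[]" 0] by simp
    have "\<phi> (\<Sum>w\<in>W. Poly_Mapping.single w (c w)) \<in> ?G" if "finite W" "\<And>w. w \<in> W \<Longrightarrow> set w \<subseteq> X" for W c
      using that
    proof (induction W rule: finite_induct)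
      case (insert w W)
      then have "\<phi> (\<Sum>w\<in>insert w W. Poly_Mapping.single w (c w))
          = \<phi> (Poly_Mapping.single w (c w)) \<oplus>\<^bsub>?A\<^esub> \<phi> (\<Sum>w\<in>W. Poly_Mapping.single w (c w))"
        by (subst \<phi>_add[symmetric]) (auto intro!: words_over_single words_over_sum)
      then show ?case using insert single by (auto intro!: generate_ring.eng_add)
    qed (simp add: zero)
    note sum = this
    show "\<phi> ` words_over X \<subseteq> ?G"
    proof (rule image_subsetI)
      fix p assume p: "p \<in> words_over X"
      have "p = (\<Sum>w\<in>Poly_Mapping.keys p. Poly_Mapping.single w (Poly_Mapping.lookup p w))"
        using evaluate_gen_id[of p] by (simp add: nc.evaluate_def word_monomial mult_single plus_list_def)
      moreover have "\<phi> (\<Sum>w\<in>Poly_Mapping.keys p. Poly_Mapping.single w (Poly_Mapping.lookup p w)) \<in> ?G"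
        by (rule sum) (use p in \<open>auto simp: words_over_iff\<close>)
      ultimately show "\<phi> p \<in> ?G" by simp
    qed
    show "?G \<subseteq> \<phi> ` words_over X"
    proof
      fix y assume "y \<in> ?G"
      then show "y \<in> \<phi> ` words_over X"
      proof induction
        case one
        then show ?case using \<phi>_one words_over_one by (metis image_eqI)
      next
        case (incl h)
        then show ?case
        proof
          assume "h \<in> range (\<lambda>c. c \<odot>\<^bsub>?A\<^esub> \<one>\<^bsub>?A\<^esub>)"
          then obtain c where "h = \<phi> (c \<cdot> 1)" using \<phi>_scal[OF one one] \<phi>_one by auto
          then show ?thesis by (auto intro!: imageI words_over_scal words_over_one)
        next
          assume "h \<in> (\<lambda>x. coset Y J (f x)) ` X"
          then obtain x where "x \<in> X" "h = \<phi> (gen x)" by (auto simp: \<phi>_def nc.evaluate_gen)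
          then show ?thesis by (auto intro!: imageI words_over_gen)
        qed
      next
        case (a_inv h)
        then obtain p where "p \<in> words_over X" "h = \<phi> p" by blast
        then have "\<ominus>\<^bsub>?A\<^esub> h = \<phi> (- p)" "- p \<in> words_over X"
          by (simp_all only: \<phi>_minus words_over_minus)
        then show ?case by blast
      next
        case (eng_add h1 h2)
        then obtain p r where "p \<in> words_over X" "h1 = \<phi> p" "r \<in> words_over X" "h2 = \<phi> r" by blast
        then have "h1 \<oplus>\<^bsub>?A\<^esub> h2 = \<phi> (p + r)" "p + r \<in> words_over X"
          by (simp_all only: \<phi>_add words_over_add)
        then show ?case by blast
      next
        case (eng_mult h1 h2)
        then obtain p r where "p \<in> words_over X" "h1 = \<phi> p" "r \<in> words_over X" "h2 = \<phi> r" by blast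
        then have "h1 \<otimes>\<^bsub>?A\<^esub> h2 = \<phi> (p * r)" "p * r \<in> words_over X"
          by (simp_all only: \<phi>_mult words_over_mult)
        then show ?case by blast
      qed
    qed
  qed
  \<comment> \<open>By the description of the kernel the class does not depend on the choice of \<open>p\<close>.\<close>
  define h where "h y = coset X I (SOME p. p \<in> words_over X \<and> \<phi> p = y)" for y
  have h: "h (\<phi> p) = coset X I p" if "p \<in> words_over X" for p
    unfolding h_def by (rule someI2[of _ p]) (use that \<phi>_eq in auto)
  let ?S = "generated_subalgebra ?A ((\<lambda>x. coset Y J (f x)) ` X)"
  have carrier: "carrier ?S = \<phi> ` words_over X"
    using \<open>\<phi> ` words_over X = ?G\<close> by (simp add: generated_subalgebra_def)
  have ops: "monoid.mult ?S = monoid.mult ?A" "add ?S = add ?A" "one ?S = one ?A" "smult ?S = smult ?A"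
    by (simp_all add: generated_subalgebra_def)
  have carrier_B: "carrier ?B = coset X I ` words_over X" by (rule coset_carrier[OF I])
  have "h \<in> ring_hom ?S ?B"
  proof (rule ring_hom_memI)
    fix x y assume "x \<in> carrier ?S" "y \<in> carrier ?S"
    then obtain p r where p: "p \<in> words_over X" "x = \<phi> p" and r: "r \<in> words_over X" "y = \<phi> r"
      unfolding carrier by blast
    show "h x \<in> carrier ?B" unfolding carrier_B p(2) h[OF p(1)] using p(1) by (rule imageI)
    show "h (x \<otimes>\<^bsub>?S\<^esub> y) = h x \<otimes>\<^bsub>?B\<^esub> h y"
      unfolding ops p(2) r(2) \<phi>_mult[OF p(1) r(1), symmetric] h[OF p(1)] h[OF r(1)]
        h[OF words_over_mult[OF p(1) r(1)]] by (rule coset_ops(1)[OF I p(1) r(1), symmetric])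
    show "h (x \<oplus>\<^bsub>?S\<^esub> y) = h x \<oplus>\<^bsub>?B\<^esub> h y"
      unfolding ops p(2) r(2) \<phi>_add[OF p(1) r(1), symmetric] h[OF p(1)] h[OF r(1)]
        h[OF words_over_add[OF p(1) r(1)]] by (rule coset_ops(2)[OF I p(1) r(1), symmetric])
  next
    show "h \<one>\<^bsub>?S\<^esub> = \<one>\<^bsub>?B\<^esub>"
      unfolding ops \<phi>_one[symmetric] h[OF one] by (rule coset_ops(3)[OF I one one, symmetric])
  qed
  moreover have "bij_betw h (carrier ?S) (carrier ?B)"
    unfolding carrier carrier_B bij_betw_def
  proof
    show "inj_on h (\<phi> ` words_over X)"
    proof (rule inj_onI, elim imageE)
      fix x y p r assume "h x = h y" "x = \<phi> p" "p \<in> words_over X" "y = \<phi> r" "r \<in> words_over X"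
      then show "x = y" by (simp only: h \<phi>_eq)
    qed
    show "h ` \<phi> ` words_over X = coset X I ` words_over X"
      unfolding image_image by (rule image_cong[OF refl h])
  qed
  moreover have "h (c \<odot>\<^bsub>?S\<^esub> x) = c \<odot>\<^bsub>?B\<^esub> h x" if "x \<in> carrier ?S" for c x
  proof -
    obtain p where p: "p \<in> words_over X" "x = \<phi> p" using \<open>x \<in> carrier ?S\<close> unfolding carrier by blast
    show ?thesis unfolding ops p(2) \<phi>_scal[OF p(1) p(1), symmetric] h[OF p(1)] h[OF words_over_scal[OF p(1)]]
      by (rule coset_ops(4)[OF I p(1) p(1), symmetric])
  qed
  ultimately show ?thesis
    unfolding algebra_isomorphic_def ring_iso_def by (intro bexI[of _ h] CollectI conjI allI ballI)
qed

section \<open>The kernel of the homomorphism to the quantum matrix algebra\<close>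

context scalars
begin

lemma evaluate_ncconst: "evaluate f (ncconst c) = \<kappa> c"
  by (simp add: evaluate_single)

lemma evaluate_evaluate: "evaluate f (nc.evaluate h p) = evaluate (\<lambda>x. evaluate f (h x)) p"
proof (induction p rule: ncpoly_induct)
  case (add p w c)
  have "evaluate f (prod_list (map h w)) = prod_list (map (\<lambda>x. evaluate f (h x)) w)"
    by (induction w) (simp_all add: evaluate_mult evaluate_one)
  then show ?case
    by (simp add: nc.evaluate_add evaluate_add add nc.evaluate_single evaluate_mult evaluate_single)
qed (simp add: evaluate_zero nc.evaluate_zero)

lemma evaluate_symplectic:
  assumes "q \<noteq> 0"
  shows "evaluate f (q_scalars.symplectic (ncconst q) n Y i j)
    = q_scalars.symplectic (\<kappa> q) n (\<lambda>i c. evaluate f (Y i c)) i j"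
proof -
  interpret a: q_scalars "ncconst q :: 'c ncpoly" "ncconst (inverse q)" by (rule nc.q_scalars[OF assms])
  interpret b: q_scalars "\<kappa> q" "\<kappa> (inverse q)" by (rule q_scalars[OF assms])
  show ?thesis
    by (simp add: a.symplectic_def b.symplectic_def evaluate_simps evaluate_ncconst)
qed

end

lemma qmat_relationsI:
  "i \<in> {1..2*n} \<Longrightarrow> j \<in> {1..2*n} \<Longrightarrow> k \<in> {1..2*n} \<Longrightarrow> i < j \<Longrightarrow>
     gen (i, k) * gen (j, k) - q \<cdot> (gen (j, k) * gen (i, k)) \<in> qmat_relations n q"
  "i \<in> {1..2*n} \<Longrightarrow> j \<in> {1..2*n} \<Longrightarrow> k \<in> {1..2*n} \<Longrightarrow> i < j \<Longrightarrow>
     gen (k, i) * gen (k, j) - q \<cdot> (gen (k, j) * gen (k, i)) \<in> qmat_relations n q"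
  "i \<in> {1..2*n} \<Longrightarrow> j \<in> {1..2*n} \<Longrightarrow> k \<in> {1..2*n} \<Longrightarrow> l \<in> {1..2*n} \<Longrightarrow> i < j \<Longrightarrow> k < l \<Longrightarrow>
     gen (i, l) * gen (j, k) - gen (j, k) * gen (i, l) \<in> qmat_relations n q"
  "i \<in> {1..2*n} \<Longrightarrow> j \<in> {1..2*n} \<Longrightarrow> k \<in> {1..2*n} \<Longrightarrow> l \<in> {1..2*n} \<Longrightarrow> i < j \<Longrightarrow> k < l \<Longrightarrow>
     gen (i, k) * gen (j, l) - gen (j, l) * gen (i, k) - (q - inverse q) \<cdot> (gen (i, l) * gen (j, k))
       \<in> qmat_relations n q"
  unfolding qmat_relations_def Let_def
  subgoal by (rule UnI1, rule UnI1, rule UnI1) blast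
  subgoal by (rule UnI1, rule UnI1, rule UnI2) blast
  subgoal by (rule UnI1, rule UnI2) blast
  subgoal by (rule UnI2) blast
  done

context skew_relations
begin

definition "J = Idl\<^bsub>free_algebra X\<^esub> qmat_relations n q"

lemma qmat_relations_subset: "qmat_relations n q \<subseteq> words_over X"
  unfolding qmat_relations_def Let_def
  by (intro subsetI; elim UnE CollectE exE conjE; hypsubst; intro words_over_intros; simp)

lemma ideal_J: "ideal J (free_algebra X)"
  unfolding J_def by (rule free.genideal_ideal[OF qmat_relations_subset])

lemmas J_closed = ideal_free_algebraD[OF ideal_J]

lemma qmat_relation_in_J: "r \<in> qmat_relations n q \<Longrightarrow> r \<in> J"
  unfolding J_def using free.genideal_self[OF qmat_relations_subset] by blast

text \<open>
  The ideal \<open>J\<close> lives in the polynomials in the generators with indices up to \<open>2n\<close>. Its preimage \<open>J'\<close>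
  under the substitution that kills all other generators is an ideal of the ring of all
  polynomials. Modulo \<open>J'\<close> the generators form an infinite matrix that is zero out of range.
\<close>

definition restrict_gens :: "(nat \<times> nat) ncpoly \<Rightarrow> (nat \<times> nat) ncpoly" where
  "restrict_gens = nc.evaluate (\<lambda>x. if x \<in> X then gen x else 0)"

lemma restrict_gens_in: "restrict_gens p \<in> words_over X"
  unfolding restrict_gens_def
proof (induction p rule: ncpoly_induct)
  case (add p w c)
  have "prod_list (map (\<lambda>x. if x \<in> X then gen x else 0) w) \<in> words_over X"
    by (induction w) (auto simp: words_over_one words_over_zero intro!: words_over_mult words_over_gen)
  then show ?case unfolding nc.evaluate_add nc.evaluate_single
    by (intro words_over_add add words_over_mult const_in)
qed (simp add: nc.evaluate_zero words_over_zero)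

lemma restrict_gens_id:
  assumes "p \<in> words_over X"
  shows "restrict_gens p = p"
proof -
  have "restrict_gens p = nc.evaluate gen p"
    unfolding restrict_gens_def by (rule nc.evaluate_cong) (use assms in \<open>auto simp: words_over_iff\<close>)
  then show ?thesis by (simp only: evaluate_gen_id)
qed

definition J' :: "(nat \<times> nat) ncpoly set" where
  "J' = {p. restrict_gens p \<in> J}"

lemma two_sided_J': "two_sided J'"
  unfolding two_sided_def J'_def restrict_gens_def
  using restrict_gens_in[unfolded restrict_gens_def]
  by (auto simp: nc.evaluate_zero nc.evaluate_add nc.evaluate_mult intro: J_closed(2-5))

lemma gen_in_J': "x \<notin> X \<Longrightarrow> gen x \<in> J'"
  using J_closed(2) by (simp add: J'_def restrict_gens_def nc.evaluate_gen)

lemma J_in_J': "p \<in> J \<Longrightarrow> p \<in> J'"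
  using restrict_gens_id[of p] J_closed(1) by (auto simp: J'_def)

lemma quantum_matrix_quotient:
  "quantum_matrix (everywhere (ncconst q)) (everywhere (ncconst (inverse q)))
     (\<lambda>i j. only_at J' (gen (i, j)))"
proof -
  have zero: "only_at J' p = 0" if "p \<in> J'" for p by (rule only_at_zero[OF that two_sided_J'])
  have out: "only_at J' (gen (i, j)) = 0" if "i \<notin> {1..2*n} \<or> j \<notin> {1..2*n}" for i j
    using that by (intro zero gen_in_J') auto
  have rel: "only_at J' a = only_at J' b" if "a - b \<in> J" for a b
  proof -
    have "only_at J' a - only_at J' b = 0"
      unfolding only_at_ops by (rule zero[OF J_in_J'[OF that]])
    then show ?thesis by simp
  qed
  show ?thesis unfolding quantum_matrix_def
  proof (intro conjI allI impI)
    fix i j k :: nat assume o: "i < j"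
    show "only_at J' (gen (i, k)) * only_at J' (gen (j, k)) =
        everywhere (ncconst q) * (only_at J' (gen (j, k)) * only_at J' (gen (i, k)))"
    proof (cases "i \<in> {1..2*n} \<and> j \<in> {1..2*n} \<and> k \<in> {1..2*n}")
      case True
      then have "gen (i, k) * gen (j, k) - q \<cdot> (gen (j, k) * gen (i, k)) \<in> J"
        using o by (intro qmat_relation_in_J qmat_relationsI) auto
      then show ?thesis unfolding only_at_ops scal_def by (rule rel)
    next
      case False
      then show ?thesis using out by auto
    qed
    show "only_at J' (gen (k, i)) * only_at J' (gen (k, j)) =
        everywhere (ncconst q) * (only_at J' (gen (k, j)) * only_at J' (gen (k, i)))"
    proof (cases "i \<in> {1..2*n} \<and> j \<in> {1..2*n} \<and> k \<in> {1..2*n}")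
      case True
      then have "gen (k, i) * gen (k, j) - q \<cdot> (gen (k, j) * gen (k, i)) \<in> J"
        using o by (intro qmat_relation_in_J qmat_relationsI) auto
      then show ?thesis unfolding only_at_ops scal_def by (rule rel)
    next
      case False
      then show ?thesis using out by auto
    qed
  next
    fix i j k l :: nat assume o: "i < j" "k < l"
    show "only_at J' (gen (i, l)) * only_at J' (gen (j, k)) = only_at J' (gen (j, k)) * only_at J' (gen (i, l))"
    proof (cases "i \<in> {1..2*n} \<and> j \<in> {1..2*n} \<and> k \<in> {1..2*n} \<and> l \<in> {1..2*n}")
      case True
      then have "gen (i, l) * gen (j, k) - gen (j, k) * gen (i, l) \<in> J"
        using o by (intro qmat_relation_in_J qmat_relationsI) auto
      then show ?thesis unfolding only_at_ops by (rule rel)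
    next
      case False
      then show ?thesis using out by auto
    qed
    have "only_at J' (gen (i, k)) * only_at J' (gen (j, l)) - only_at J' (gen (j, l)) * only_at J' (gen (i, k))
        = everywhere (ncconst (q - inverse q)) * (only_at J' (gen (i, l)) * only_at J' (gen (j, k)))"
    proof (cases "i \<in> {1..2*n} \<and> j \<in> {1..2*n} \<and> k \<in> {1..2*n} \<and> l \<in> {1..2*n}")
      case True
      then have "gen (i, k) * gen (j, l) - gen (j, l) * gen (i, k) - (q - inverse q) \<cdot> (gen (i, l) * gen (j, k)) \<in> J"
        using o by (intro qmat_relation_in_J qmat_relationsI) auto
      then show ?thesis unfolding only_at_ops scal_def by (rule rel)
    next
      case False
      then show ?thesis using out o by auto
    qed
    then show "only_at J' (gen (i, k)) * only_at J' (gen (j, l)) - only_at J' (gen (j, l)) * only_at J' (gen (i, k))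
        = (everywhere (ncconst q) - everywhere (ncconst (inverse q)))
            * (only_at J' (gen (i, l)) * only_at J' (gen (j, k)))"
      by (simp only: quot.\<kappa>_diff)
  qed
qed

end

text \<open>
  The left subalgebra is the case \<open>g i c = (i, c)\<close>, the right one the case \<open>g i c = (c, i)\<close>. The power of
  \<open>q\<^sup>1\<^sup>/\<^sup>2\<close> in the definition of \<open>z i j\<close> is a product of two row factors and two column factors.
\<close>

locale skew_subalgebra = skew_relations +
  fixes g :: "nat \<Rightarrow> nat \<Rightarrow> nat \<times> nat" and row_factor col_factor :: "nat \<Rightarrow> complex"
  assumes g: "g = (\<lambda>i c. (i, c)) \<or> g = (\<lambda>i c. (c, i))"
    and factors: "row_factor i \<noteq> 0" "col_factor c \<noteq> 0"
begin

definition z_poly :: "nat \<times> nat \<Rightarrow> (nat \<times> nat) ncpoly" where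
  "z_poly = (\<lambda>(i, j). symplectic n (\<lambda>i c. ncconst (row_factor i * col_factor c) * gen (g i c)) i j)"

lemma z_poly_in:
  assumes "x \<in> X"
  shows "z_poly x \<in> words_over X"
proof -
  obtain i j where ij: "x = (i, j)" "i \<in> {1..2*n}" "j \<in> {1..2*n}" using assms by auto
  have gX: "g a c \<in> X" if "a \<in> {1..2*n}" "c \<in> {1..2*n}" for a c using g that by auto
  show ?thesis unfolding ij(1) z_poly_def symplectic_def prod.case
    by (intro words_over_sum words_over_diff words_over_mult const_in words_over_gen gX) (use ij in auto)
qed

lemma evaluate_z_poly_in:
  assumes "p \<in> words_over X"
  shows "nc.evaluate z_poly p \<in> words_over X"
  by (rule evaluate_words_over[of X, OF _ assms]) (rule z_poly_in)

text \<open>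
  The generators modulo \<open>J'\<close> form a quantum matrix in the product of all quotients, up to the choice
  between rows and columns. So the relations hold there for its symplectic form, and the component
  at \<open>J'\<close> of this statement is the claim.
\<close>

lemma z_poly_relations:
  assumes r: "r \<in> qasym_relations n q"
  shows "nc.evaluate z_poly r \<in> J"
proof -
  let ?F = "\<lambda>x. only_at J' (gen x) :: (nat \<times> nat) ncpoly all_quotients"
  let ?k = "\<lambda>c. everywhere (ncconst c) :: (nat \<times> nat) ncpoly all_quotients"
  interpret Q: q_scalars "?k q" "?k (inverse q)" by (rule quot.q_scalars[OF q_nonzero])
  let ?Y = "\<lambda>i c. ?k (row_factor i * col_factor c) * ?F (g i c)"
  have "quantum_matrix (?k q) (?k (inverse q)) (\<lambda>i c. ?F (g i c))"
    using g quantum_matrix_quotient Q.quantum_matrix_transpose[OF quantum_matrix_quotient] by auto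
  then have "quantum_matrix (?k q) (?k (inverse q)) ?Y"
  proof (rule Q.quantum_matrix_scale)
    show "?k (row_factor i * col_factor c) * ?k (row_factor j * col_factor d)
        = ?k (row_factor i * col_factor d) * ?k (row_factor j * col_factor c)" for i j c d
      by (simp only: quot.\<kappa>_mult[symmetric] mult.commute mult.left_commute mult.assoc)
  qed (rule quot.\<kappa>_central)
  then have Z: "Q.quantum_antisym (Q.symplectic n ?Y)" by (rule Q.symplectic_antisym)
  have eq: "(\<lambda>(i, j). Q.symplectic n ?Y i j) = (\<lambda>x. quot.evaluate ?F (z_poly x))"
    by (rule ext, rename_tac x, case_tac x) (simp add: z_poly_def quot.evaluate_symplectic[OF q_nonzero] quot.evaluate_mult
        quot.evaluate_ncconst quot.evaluate_gen)
  have "quot.evaluate (\<lambda>x. quot.evaluate ?F (z_poly x)) r = 0"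
    unfolding eq[symmetric] by (rule quot.evaluate_qasym_relations[OF q_nonzero Z r])
  moreover have "is_at J' (quot.evaluate ?F p) p" for p
  proof -
    have "is_at J' (quot.evaluate ?F p) (nc.evaluate gen p)"
      by (rule is_at_evaluate) (rule is_at_simps(2))
    then show ?thesis by (simp only: evaluate_gen_id)
  qed
  then have "is_at J' (quot.evaluate (\<lambda>x. quot.evaluate ?F (z_poly x)) r) (nc.evaluate z_poly r)"
    by (rule is_at_evaluate)
  ultimately have "is_at J' 0 (nc.evaluate z_poly r)" by (simp only:)
  then have "nc.evaluate z_poly r \<in> J'" by (rule is_at_zeroD[OF _ two_sided_J'])
  moreover have "nc.evaluate z_poly r \<in> words_over X"
    using evaluate_z_poly_in relations_subset r by blast
  ultimately show ?thesis using restrict_gens_id by (simp add: J'_def)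
qed

lemma I_subset_kernel:
  assumes "p \<in> I"
  shows "nc.evaluate z_poly p \<in> J"
proof -
  let ?K = "{p \<in> words_over X. nc.evaluate z_poly p \<in> J}"
  have "ideal ?K (free_algebra X)"
    by (rule ideal_free_algebraI)
      (auto simp: nc.evaluate_simps words_over_intros evaluate_z_poly_in simp del: One_nat_def
        intro: J_closed(2-5))
  moreover have "qasym_relations n q \<subseteq> ?K"
    using relations_subset z_poly_relations by auto
  ultimately have "I \<subseteq> ?K" unfolding I_def by (rule free.genideal_minimal)
  then show ?thesis using assms by blast
qed

text \<open>
  In the representation by operators the generators act by the entries of the matrix from
  \<open>generic_skew_model\<close>, divided by the row and column factors. Thus the polynomial \<open>z_poly (i, j)\<close> acts
  as \<open>w i j\<close> of that matrix. Words are sent to products of operators with known leading exponents,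
  and a sorted word is determined by the multiset of its letters.
\<close>

lemma kernel_trivial:
  assumes keys: "Poly_Mapping.keys r \<subseteq> {w. normal w}" and J: "nc.evaluate z_poly r \<in> J"
  shows "r = 0"
proof -
  interpret model: skew_model q n by unfold_locales (rule q_nonzero)
  obtain M where M: "model.q_matrix M"
    and leads: "\<And>i j. 1 \<le> i \<Longrightarrow> i < j \<Longrightarrow> j \<le> model.N \<Longrightarrow> model.leads (model.symplectic n M i j) (model.exponent i j)"
    by (rule model.generic_skew_model) blast
  define f where "f i c = row_factor i * col_factor c" for i c
  have f0: "f i c \<noteq> 0" for i c using factors by (simp add: f_def)
  \<comment> \<open>The factors in \<open>z_poly\<close> are cancelled in advance.\<close>
  define Y where "Y i c = const_op (inverse (f i c)) * M i c" for i c
  have Y: "model.q_matrix Y" unfolding Y_def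
  proof (rule model.quantum_matrix_scale[OF M])
    show "const_op (inverse (f i c)) * const_op (inverse (f j d))
        = (const_op (inverse (f i d)) * const_op (inverse (f j c)) :: mop)" for i j c d
      by (simp add: op.\<kappa>_mult[symmetric] f_def mult_ac)
  qed (rule const_op_central)
  have "\<exists>F. (\<forall>i c. F (g i c) = Y i c) \<and> model.q_matrix (\<lambda>i j. F (i, j))"
    using g
  proof
    assume "g = (\<lambda>i c. (i, c))"
    then show ?thesis by (intro exI[of _ "\<lambda>(i, c). Y i c"]) (simp add: Y)
  next
    assume "g = (\<lambda>i c. (c, i))"
    then show ?thesis
      by (intro exI[of _ "\<lambda>(c, i). Y i c"]) (simp add: model.quantum_matrix_transpose[OF Y])
  qed
  then obtain F where Fg: "\<And>i c. F (g i c) = Y i c" and F: "model.q_matrix (\<lambda>i j. F (i, j))" by blast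
  have "op.evaluate F p = 0" if "p \<in> J" for p
  proof -
    let ?K = "{p \<in> words_over X. op.evaluate F p = 0}"
    have "ideal ?K (free_algebra X)"
      by (rule ideal_free_algebraI) (auto simp: op.evaluate_simps words_over_intros)
    moreover have "qmat_relations n q \<subseteq> ?K"
      using qmat_relations_subset op.evaluate_qmat_relations[OF q_nonzero F] by auto
    ultimately have "J \<subseteq> ?K" unfolding J_def by (rule free.genideal_minimal)
    then show ?thesis using that by blast
  qed
  then have "op.evaluate (\<lambda>x. op.evaluate F (z_poly x)) r = 0"
    using J by (simp add: op.evaluate_evaluate[symmetric])
  moreover have "op.evaluate F (z_poly (i, j)) = model.symplectic n M i j" for i j
  proof -
    have "const_op (f i c) * Y i c = M i c" for i c
      using f0 by (simp add: Y_def mult.assoc[symmetric] op.\<kappa>_mult[symmetric] op.\<kappa>_one)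
    then show ?thesis
      by (simp add: z_poly_def op.evaluate_symplectic[OF q_nonzero] op.evaluate_mult op.evaluate_ncconst
          op.evaluate_gen Fg f_def[symmetric])
  qed
  then have "op.evaluate (\<lambda>x. op.evaluate F (z_poly x)) r
      = (\<Sum>w\<in>Poly_Mapping.keys r. const_op (Poly_Mapping.lookup r w) * prod_list (map (\<lambda>(i, j). model.symplectic n M i j) w))"
    unfolding op.evaluate_def
    by (intro sum.cong refl arg_cong2[of _ _ _ _ "(*)"] arg_cong[of _ _ prod_list] map_cong) auto
  ultimately have zero: "(\<Sum>w\<in>Poly_Mapping.keys r. const_op (Poly_Mapping.lookup r w)
      * prod_list (map (\<lambda>(i, j). model.symplectic n M i j) w)) = 0" by simp
  have nf: "sorted w" "set w \<subseteq> {(i, j). 0 < i \<and> i < j \<and> j \<le> model.N}" if "w \<in> Poly_Mapping.keys r" for w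
  proof -
    have "normal w" using that keys by blast
    then show "sorted w" "set w \<subseteq> {(i, j). 0 < i \<and> i < j \<and> j \<le> model.N}"
      by (fastforce simp: normal_def model.N_def)+
  qed
  have "Poly_Mapping.lookup r w = 0" if "w \<in> Poly_Mapping.keys r" for w
  proof (rule model.leads_independent[OF finite_keys _ _ zero that])
    show "model.leads (prod_list (map (\<lambda>(i, j). model.symplectic n M i j) w))
        (sum_list (map (\<lambda>(i, j). model.exponent i j) w))" if "w \<in> Poly_Mapping.keys r" for w
      by (rule model.leads_prod_list) (use nf(2)[OF that] leads in auto)
    show "inj_on (\<lambda>w. sum_list (map (\<lambda>(i, j). model.exponent i j) w)) (Poly_Mapping.keys r)"
    proof (rule inj_onI)
      fix v w assume v: "v \<in> Poly_Mapping.keys r" and w: "w \<in> Poly_Mapping.keys r"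
        and "sum_list (map (\<lambda>(i, j). model.exponent i j) v) = sum_list (map (\<lambda>(i, j). model.exponent i j) w)"
      then have "mset v = mset w" by (intro model.exponent_inj nf)
      then show "v = w" using nf(1)[OF v] nf(1)[OF w] properties_for_sort sorted_sort_id by metis
    qed
  qed
  then show ?thesis by (metis in_keys_iff keys_eq_empty subsetI subset_empty)
qed

text \<open>
  Modulo \<open>I\<close> every polynomial is a combination of normal words, and such a combination lies in the
  kernel only if it is zero.
\<close>

lemma kernel:
  assumes p: "p \<in> words_over X"
  shows "nc.evaluate z_poly p \<in> J \<longleftrightarrow> p \<in> I"
proof
  assume pJ: "nc.evaluate z_poly p \<in> J"
  obtain r where r: "p - r \<in> I" "Poly_Mapping.keys r \<subseteq> {w. normal w}"
    using normal_form[OF p] by (auto simp: normalizes_def)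
  have "nc.evaluate z_poly p - nc.evaluate z_poly (p - r) \<in> J"
    by (rule J_closed(6)[OF pJ I_subset_kernel[OF r(1)]])
  then have "nc.evaluate z_poly r \<in> J" by (simp add: nc.evaluate_diff)
  then have "r = 0" by (rule kernel_trivial[OF r(2)])
  then show "p \<in> I" using r(1) by simp
qed (rule I_subset_kernel)

theorem isomorphic:
  "algebra_isomorphic
     (generated_subalgebra (qmat_algebra n q)
        {presented_class X (qmat_relations n q) (z_poly (i, j)) | i j. i \<in> {1..2*n} \<and> j \<in> {1..2*n}})
     (qasym_algebra n q)"
proof -
  have pairs: "{F (i, j) | i j. i \<in> A \<and> j \<in> B} = F ` (A \<times> B)"
    for F :: "nat \<times> nat \<Rightarrow> (nat \<times> nat) ncpoly set" and A B
    by auto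
  have "{presented_class X (qmat_relations n q) (z_poly (i, j)) | i j. i \<in> {1..2*n} \<and> j \<in> {1..2*n}}
      = (\<lambda>x. coset X J (z_poly x)) ` X"
    unfolding presented_class_def J_def[symmetric] by (rule pairs)
  moreover have "algebra_isomorphic
      (generated_subalgebra (quot_algebra (free_algebra X) J) ((\<lambda>x. coset X J (z_poly x)) ` X))
      (quot_algebra (free_algebra X) I)"
    using ideal_J ideal_I z_poly_in kernel by (rule presented_subalgebra)
  ultimately show ?thesis
    unfolding qmat_algebra_def qasym_algebra_def presented_algebra_def J_def I_def by (simp only:)
qed

lemma z_poly_eq:
  assumes "\<And>k. k \<in> {1..n} \<Longrightarrow>
    row_factor i * row_factor j * (col_factor (2*k-1) * col_factor (2*k)) = a k"
  shows "z_poly (i, j) = (\<Sum>k = 1..n. a k \<cdot>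
    (gen (g i (2*k-1)) * gen (g j (2*k)) - q \<cdot> (gen (g i (2*k)) * gen (g j (2*k-1)))))"
  unfolding z_poly_def symplectic_def prod.case
proof (rule sum.cong)
  fix k assume k: "k \<in> {1..n}"
  have swap: "x * (ncconst d * y) = ncconst d * (x * y)" for d and x y :: "(nat \<times> nat) ncpoly"
    by (metis nc.\<kappa>_central mult.assoc)
  have m: "ncconst c * x * (ncconst d * y) = ncconst (c * d) * (x * y)" for c d and x y :: "(nat \<times> nat) ncpoly"
    unfolding nc.\<kappa>_mult mult.assoc swap[of x] ..
  have a: "row_factor i * col_factor (2*k-1) * (row_factor j * col_factor (2*k)) = a k"
    "row_factor i * col_factor (2*k) * (row_factor j * col_factor (2*k-1)) = a k"
    unfolding assms[OF k, symmetric] by (simp_all only: mult_ac)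
  show "ncconst (row_factor i * col_factor (2*k-1)) * gen (g i (2*k-1))
        * (ncconst (row_factor j * col_factor (2*k)) * gen (g j (2*k)))
      - ncconst q * (ncconst (row_factor i * col_factor (2*k)) * gen (g i (2*k))
        * (ncconst (row_factor j * col_factor (2*k-1)) * gen (g j (2*k-1))))
    = a k \<cdot> (gen (g i (2*k-1)) * gen (g j (2*k)) - q \<cdot> (gen (g i (2*k)) * gen (g j (2*k-1))))"
    unfolding m a scal_def right_diff_distrib swap[of "ncconst q" "a k"] ..
qed simp

end

theorem theorem3p1:
  fixes n :: nat and q s :: complex
  assumes "n \<ge> 1"
    and "q \<noteq> 0"
    and "q = 1 \<or> (\<forall>m::nat. m > 0 \<longrightarrow> q ^ m \<noteq> 1)"
    and "s ^ 2 = q"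
  shows "algebra_isomorphic (left_subalgebra n q s) (qasym_algebra n q)
       \<and> algebra_isomorphic (right_subalgebra n q s) (qasym_algebra n q)"
proof
  have s: "s \<noteq> 0" using assms(2,4) by auto
  have odd: "odd (2 * k - 1)" "int (2 * k - 1) = 2 * int k - 1" if "k \<in> {1..m}" for k m :: nat
    using that by auto
  \<comment> \<open>For \<open>c = 2k - 1\<close> the column factor is \<open>s\<close> to the power \<open>1 - 4k\<close>.\<close>
  interpret L: skew_subalgebra n q "\<lambda>i c. (i, c)" "\<lambda>i. s powi int i"
    "\<lambda>c. if odd c then s powi (- 1 - 2 * int c) else 1"
    using s assms(2) by unfold_locales auto
  have "L.z_poly (i, j) = zL_poly n q s i j" for i j
    unfolding zL_poly_def Let_def
    by (rule L.z_poly_eq) (use s odd in \<open>simp add: power_int_add[symmetric] algebra_simps del: power_int_of_nat power_int_minus\<close>)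
  then show "algebra_isomorphic (left_subalgebra n q s) (qasym_algebra n q)"
    using L.isomorphic unfolding left_subalgebra_def zL_def by simp
  \<comment> \<open>For \<open>c = 2k - 1\<close> the column factor is \<open>s\<close> to the power \<open>4k - 1\<close>.\<close>
  interpret R: skew_subalgebra n q "\<lambda>i c. (c, i)" "\<lambda>i. s powi (- int i)"
    "\<lambda>c. if odd c then s powi (2 * int c + 1) else 1"
    using s assms(2) by unfold_locales auto
  have "R.z_poly (i, j) = zR_poly n q s i j" for i j
    unfolding zR_poly_def Let_def
    by (rule R.z_poly_eq) (use s odd in \<open>simp add: power_int_add[symmetric] algebra_simps del: power_int_of_nat power_int_minus\<close>)
  then show "algebra_isomorphic (right_subalgebra n q s) (qasym_algebra n q)"
    using R.isomorphic unfolding right_subalgebra_def zR_def by simp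
qed

end
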